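(* We have $S_{\mathrm{rt}}(10)=35$, $S_{\mathrm{rt}}(11)=43$, $S_{\mathrm{rt}}(12)=52$, $S_{\mathrm{rt}}(13)=64$ and $S_{\mathrm{rt}}(14)=74$. Moreover, for each $n\in\{10,11,12,13,14\}$, every $n$-point set $P\subset\mathbb{R}^2$ with $S_{\mathrm{rt}}(P)=S_{\mathrm{rt}}(n)$ is similar to one of the following point sets (each of which attains $S_{\mathrm{rt}}(n)$, and which are pairwise non-similar): \begin{itemize} \item $n=10$: $\{0,1,2\}^2\cup\{(3,1)\}$; \item $n=11$: $\{0,1,2\}^2\cup\{(3,1),(1,-1)\}$; \item $n=12$: $\{0,1,2\}^2\cup\{(-1,1),(3,1),(1,-1)\}$, and $\{0,1,2,3\}^2\setminus\{(0,0),(0,3),(3,0),(3,3)\}$; \item $n=13$: $\{(x,y)\in\mathbb{Z}^2 : |x|+|y|\le 2\}$, and $A:=\{(\pm1,\pm2),(\pm2,\pm1),(0,\pm1),(-1,0),(0,0),(1,0)\}$ (all sign combinations); \item $n=14$: $A\cup\{(3,0)\}$ with $A$ as in the case $n=13$. \end{itemize}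
   Context: An $n$-point set is a subset of $\mathbb{R}^2$ of cardinality $n$. For a finite set $P\subset\mathbb{R}^2$, $S_{\mathrm{rt}}(P)$ denotes the number of isosceles right triangles contained in $P$, i.e. the number of $3$-element subsets of $P$ that are the vertices of a (non-degenerate) isosceles right triangle. $S_{\mathrm{rt}}(n)$ denotes the maximum of $S_{\mathrm{rt}}(P)$ over all $n$-point sets $P\subset\mathbb{R}^2$. Two point sets are similar if one is mapped onto the other by a similarity of the plane (reflections allowed). *)

theory Defs
  imports "HOL-Analysis.Analysis"
begin

(* The plane is real \<times> real: the metric and inner product of HOL-Analysis on this
   product type are the Euclidean ones. *)
type_synonym point = "real \<times> real"

definition n_point_set :: "nat \<Rightarrow> point set \<Rightarrow> bool" where
  "n_point_set n P \<longleftrightarrow> finite P \<and> card P = n"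

(* a is the vertex of the right angle; card T = 3 together with the other two conditions
   makes the triangle non-degenerate. *)
definition isosceles_right_triangle :: "point set \<Rightarrow> bool" where
  "isosceles_right_triangle T \<longleftrightarrow> card T = 3 \<and>
     (\<exists>a b c. T = {a, b, c} \<and> orthogonal (b - a) (c - a) \<and> dist a b = dist a c)"

definition S_rt :: "point set \<Rightarrow> nat" where
  "S_rt P = card {T. T \<subseteq> P \<and> isosceles_right_triangle T}"

definition S_rt_max :: "nat \<Rightarrow> nat" where
  "S_rt_max n = Max {S_rt P | P. n_point_set n P}"

definition optimal :: "nat \<Rightarrow> point set \<Rightarrow> bool" where
  "optimal n P \<longleftrightarrow> n_point_set n P \<and> S_rt P = S_rt_max n"

(* Maps scaling all distances by a factor r > 0; on a finite-dimensional space such a map is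
   automatically bijective. Reflections are included. *)
definition similarity :: "(point \<Rightarrow> point) \<Rightarrow> bool" where
  "similarity f \<longleftrightarrow> (\<exists>r>0. \<forall>x y. dist (f x) (f y) = r * dist x y)"

definition similar :: "point set \<Rightarrow> point set \<Rightarrow> bool" where
  "similar P Q \<longleftrightarrow> (\<exists>f. similarity f \<and> f ` P = Q)"

definition E10 :: "point set" where
  "E10 = {0, 1, 2} \<times> {0, 1, 2} \<union> {(3, 1)}"

definition E11 :: "point set" where
  "E11 = {0, 1, 2} \<times> {0, 1, 2} \<union> {(3, 1), (1, -1)}"

definition E12a :: "point set" where
  "E12a = {0, 1, 2} \<times> {0, 1, 2} \<union> {(-1, 1), (3, 1), (1, -1)}"

definition E12b :: "point set" where
  "E12b = {0, 1, 2, 3} \<times> {0, 1, 2, 3} - {(0, 0), (0, 3), (3, 0), (3, 3)}"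

definition E13a :: "point set" where
  "E13a = {(x, y). x \<in> \<int> \<and> y \<in> \<int> \<and> \<bar>x\<bar> + \<bar>y\<bar> \<le> 2}"

definition E13b :: "point set" where
  "E13b = {(1, 2), (1, -2), (-1, 2), (-1, -2),
           (2, 1), (2, -1), (-2, 1), (-2, -1),
           (0, 1), (0, -1), (-1, 0), (0, 0), (1, 0)}"

definition E14 :: "point set" where
  "E14 = E13b \<union> {(3, 0)}"

(* The maximum defining S_rt_max is taken over a finite nonempty set. *)

lemma S_rt_le:
  assumes "n_point_set n P"
  shows "S_rt P \<le> 2 ^ n"
proof -
  have fin: "finite (Pow P)" and c: "card (Pow P) = 2 ^ n"
    using assms by (auto simp: n_point_set_def card_Pow)
  have "S_rt P \<le> card (Pow P)"
    unfolding S_rt_def by (rule card_mono[OF fin]) auto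
  then show ?thesis using c by simp
qed

lemma finite_S_rt_values: "finite {S_rt P | P. n_point_set n P}"
  by (rule finite_subset[of _ "{..2 ^ n}"]) (auto dest: S_rt_le)

lemma S_rt_values_nonempty: "{S_rt P | P. n_point_set n P} \<noteq> {}"
proof -
  have "infinite (UNIV :: point set)"
    by (simp add: finite_prod infinite_UNIV_char_0)
  then obtain P :: "point set" where "finite P" "card P = n"
    using infinite_arbitrarily_large by blast
  then show ?thesis by (auto simp: n_point_set_def)
qed

end

theory Submission
  imports Defs
begin

text \<open>Deleting a point of minimum degree (number of triangles through it) from a set of n points with s
  triangles leaves at least s (n - 3) / n of them. Hence a rich set arises from a single triangle by adding
  points one at a time, the number of triangles staying above a threshold at every step, and
  from seven points on the new point can be taken of minimum degree. As long as the new point lies in a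
  triangle with two old points, it is one of six points determined by these two; so up to similarity there
  are finitely many sets on such chains. Sets with isolated points, which would escape this search, are
  excluded by hand. The search itself is a finite check on sets of Gaussian integers, carried out by rewriting:
  a trie maps twice the coordinates (modulo 128, as 7-bit words) of every point of the plane to its
  degree, and a certificate says for every candidate why it is excluded or to which other set, and by
  which similarity, the enlarged set corresponds.\<close>

text \<open>The obstacle is a point in no triangle: it could sit anywhere in the plane, so it
  escapes enumeration. If deleting a minimum-degree point \<open>v\<close> isolates another point
  \<open>w\<close>, then \<open>v\<close> and \<open>w\<close> lie in exactly the same triangles,
  and these are at most two. So the set has at most two triangles more than one with two points
  fewer, which contradicts the thresholds from nine points on. Among sets of six, seven and eight
  points exceptions survive: either a chain reaches them in another order, or they have two points
  of so small degree that nothing rich grows out of them. Minimality is demanded only from eight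
  points on, to leave room for these other orders. The thresholds descend from 74 at fourteen
  points, yet one search serves all five sizes, because the extremal values for ten to thirteen
  points lie above the thresholds too. A certificate replaces canonical forms and tests of
  similarity: it names a similarity, and the rewriting merely applies it and compares.\<close>

declare split_paired_All [simp del] split_paired_Ex [simp del]

subsection \<open>Counting triangles\<close>

abbreviation irt :: "point set \<Rightarrow> bool" where "irt \<equiv> isosceles_right_triangle"

definition deg :: "point set \<Rightarrow> point \<Rightarrow> nat" where
  "deg P v = card {T. T \<subseteq> P \<and> irt T \<and> v \<in> T}"

definition codeg :: "point set \<Rightarrow> point \<Rightarrow> point \<Rightarrow> nat" where
  "codeg P v w = card {T. T \<subseteq> P \<and> irt T \<and> v \<in> T \<and> w \<in> T}"

definition tri :: "point \<Rightarrow> point \<Rightarrow> point \<Rightarrow> bool" where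
  "tri a b c \<longleftrightarrow> irt {a, b, c}"

lemma irt_card: "irt T \<Longrightarrow> card T = 3"
  by (simp add: isosceles_right_triangle_def)

lemma tri_distinct: "tri a b c \<Longrightarrow> a \<noteq> b \<and> a \<noteq> c \<and> b \<noteq> c"
  unfolding tri_def using irt_card[of "{a, b, c}"]
  by (auto simp: card_insert_if split: if_splits)

lemma tri_commute: "tri a b c = tri b a c" "tri a b c = tri a c b"
  by (simp_all add: tri_def insert_commute)

lemma finite_triangles: "finite P \<Longrightarrow> finite {T. T \<subseteq> P \<and> Q T}"
  by (rule finite_subset[of _ "Pow P"]) auto

lemma S_rt_remove:
  assumes "finite P"
  shows "S_rt P = S_rt (P - {v}) + deg P v"
proof -
  have "{T. T \<subseteq> P \<and> irt T} = {T. T \<subseteq> P - {v} \<and> irt T} \<union> {T. T \<subseteq> P \<and> irt T \<and> v \<in> T}"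
    by auto
  moreover have "card ({T. T \<subseteq> P - {v} \<and> irt T} \<union> {T. T \<subseteq> P \<and> irt T \<and> v \<in> T}) =
      card {T. T \<subseteq> P - {v} \<and> irt T} + card {T. T \<subseteq> P \<and> irt T \<and> v \<in> T}"
    using assms by (intro card_Un_disjoint finite_triangles) auto
  ultimately show ?thesis
    by (simp add: S_rt_def deg_def)
qed

lemma S_rt_insert:
  assumes "finite P" "v \<notin> P"
  shows "S_rt (insert v P) = S_rt P + deg (insert v P) v"
  using S_rt_remove[of "insert v P" v] assms by simp

lemma deg_insert:
  assumes "finite P" "x \<notin> P"
  shows "deg (insert x P) v = deg P v + codeg (insert x P) v x"
proof -
  have "{T. T \<subseteq> insert x P \<and> irt T \<and> v \<in> T} =
     {T. T \<subseteq> P \<and> irt T \<and> v \<in> T} \<union> {T. T \<subseteq> insert x P \<and> irt T \<and> v \<in> T \<and> x \<in> T}"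
    by auto
  moreover have "card ({T. T \<subseteq> P \<and> irt T \<and> v \<in> T} \<union> {T. T \<subseteq> insert x P \<and> irt T \<and> v \<in> T \<and> x \<in> T}) =
      card {T. T \<subseteq> P \<and> irt T \<and> v \<in> T} + card {T. T \<subseteq> insert x P \<and> irt T \<and> v \<in> T \<and> x \<in> T}"
    using assms by (intro card_Un_disjoint finite_triangles) auto
  ultimately show ?thesis
    by (simp add: deg_def codeg_def)
qed

lemma codeg_commute: "codeg P v w = codeg P w v"
  unfolding codeg_def by (rule arg_cong[of _ _ card]) auto

lemma third_point:
  assumes "irt T" "v \<in> T" "w \<in> T" "v \<noteq> w"
  obtains y where "T = {v, w, y}" "tri v w y"
proof -
  have "finite T" "card T = 3" using irt_card[OF assms(1)] by (auto intro: card_ge_0_finite)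
  then have "card (T - {v, w}) = 1" using assms by (subst card_Diff_subset) auto
  then obtain y where y: "T - {v, w} = {y}" by (auto simp: card_1_singleton_iff)
  then have "T = {v, w, y}" using assms by auto
  with assms(1) show ?thesis by (intro that[of y]) (auto simp: tri_def)
qed

lemma codeg_eq:
  assumes "v \<in> P" "w \<in> P" "v \<noteq> w"
  shows "codeg P v w = card {y \<in> P. tri v w y}"
proof -
  have "bij_betw (\<lambda>y. {v, w, y}) {y \<in> P. tri v w y} {T. T \<subseteq> P \<and> irt T \<and> v \<in> T \<and> w \<in> T}"
  proof (rule bij_betwI')
    fix x y assume "x \<in> {y \<in> P. tri v w y}" "y \<in> {y \<in> P. tri v w y}"
    then have "x \<noteq> v" "x \<noteq> w" "y \<noteq> v" "y \<noteq> w" using tri_distinct by blast+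
    then show "({v, w, x} = {v, w, y}) = (x = y)" by auto
  next
    fix x assume "x \<in> {y \<in> P. tri v w y}"
    then show "{v, w, x} \<in> {T. T \<subseteq> P \<and> irt T \<and> v \<in> T \<and> w \<in> T}"
      using assms by (auto simp: tri_def)
  next
    fix T assume T: "T \<in> {T. T \<subseteq> P \<and> irt T \<and> v \<in> T \<and> w \<in> T}"
    then obtain y where "T = {v, w, y}" "tri v w y" using third_point assms(3) by blast
    then show "\<exists>x \<in> {y \<in> P. tri v w y}. T = {v, w, x}" using T by (intro bexI[of _ y]) auto
  qed
  then show ?thesis by (simp add: codeg_def bij_betw_same_card)
qed

lemma sum_deg:
  assumes "finite P"
  shows "(\<Sum>v\<in>P. deg P v) = 3 * S_rt P"
proof -
  have "(\<Sum>v\<in>P. card {T \<in> {T. T \<subseteq> P \<and> irt T}. v \<in> T}) = 3 * card {T. T \<subseteq> P \<and> irt T}"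
  proof (rule sum_multicount)
    show "\<forall>T\<in>{T. T \<subseteq> P \<and> irt T}. card {v \<in> P. v \<in> T} = 3"
    proof
      fix T assume T: "T \<in> {T. T \<subseteq> P \<and> irt T}"
      then have "{v \<in> P. v \<in> T} = T" by auto
      with T show "card {v \<in> P. v \<in> T} = 3" by (simp add: irt_card)
    qed
  qed (use assms in \<open>auto intro: finite_triangles\<close>)
  then show ?thesis by (simp add: deg_def S_rt_def conj_assoc)
qed

lemma obtain_min_deg:
  assumes "finite P" "P \<noteq> {}"
  obtains v where "v \<in> P" "\<And>w. w \<in> P \<Longrightarrow> deg P v \<le> deg P w"
    "card P * deg P v \<le> 3 * S_rt P"
proof -
  obtain v where v: "v \<in> P" "\<And>w. w \<in> P \<Longrightarrow> deg P v \<le> deg P w"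
    using ex_has_least_nat[of "\<lambda>v. v \<in> P" _ "deg P"] assms(2) by blast
  have "card P * deg P v \<le> (\<Sum>w\<in>P. deg P w)"
    using sum_bounded_below[of P "deg P v" "deg P"] v by simp
  with v show ?thesis using sum_deg[OF assms(1)] that by simp
qed

text \<open>The degree as a sum over pairs of list entries, the form in which the tries accumulate
  it. The point \<open>v\<close> may itself be an entry, since pairs containing \<open>v\<close>
  contribute nothing.\<close>

primrec pair_count :: "point list \<Rightarrow> point \<Rightarrow> nat" where
  "pair_count [] v = 0"
| "pair_count (x # xs) v = pair_count xs v + length (filter (\<lambda>y. tri v x y) xs)"

lemma deg_pair_count:
  "distinct xs \<Longrightarrow> deg (insert v (set xs)) v = pair_count xs v"
proof (induction xs)
  case Nil
  have "{T. T \<subseteq> {v} \<and> irt T \<and> v \<in> T} = {}"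
    using irt_card[of "{v}"] irt_card[of "{}"] by (auto dest!: subset_singletonD)
  then show ?case by (simp add: deg_def)
next
  case (Cons x xs)
  show ?case
  proof (cases "x = v")
    case True
    then have "filter (\<lambda>y. tri v x y) xs = []"
      using tri_distinct[of v v] by (simp add: filter_empty_conv) blast
    with True Cons show ?thesis by simp
  next
    case False
    let ?Q = "insert v (set xs)"
    have "{y \<in> insert x ?Q. tri v x y} = {y \<in> set xs. tri v x y}"
      using tri_distinct[of v x] by auto
    moreover have "card {y \<in> set xs. tri v x y} = length (filter (\<lambda>y. tri v x y) xs)"
      using Cons.prems by (simp flip: set_filter add: distinct_card)
    ultimately have "codeg (insert x ?Q) v x = length (filter (\<lambda>y. tri v x y) xs)"
      using False by (simp add: codeg_eq)
    then show ?thesis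
      using Cons False deg_insert[of ?Q x v] by (simp add: insert_commute)
  qed
qed

lemma S_rt_Cons:
  "distinct (x # xs) \<Longrightarrow> S_rt (set (x # xs)) = S_rt (set xs) + pair_count xs x"
  using S_rt_insert[of "set xs" x] deg_pair_count[of xs x] by simp

lemma S_rt_empty: "S_rt {} = 0"
  using irt_card[of "{}"] by (auto simp: S_rt_def)

subsection \<open>Points of small degree\<close>

text \<open>The triangles through \<open>u\<close>, \<open>v\<close> and those through
  \<open>u\<close>, \<open>w\<close> have at most \<open>{u, v, w}\<close> in common, so the two
  codegrees add up to at most the degree of \<open>u\<close> plus one. Minimality of
  \<open>u\<close> makes each codegree at least that degree minus the old degree of \<open>v\<close>
  or \<open>w\<close>. This caps the growth of a set that has two points of small degree.\<close>

lemma min_deg_le_two_degs: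
  assumes "finite P" "u \<notin> P" "v \<in> P" "w \<in> P" "v \<noteq> w"
    and min: "\<And>x. x \<in> P \<Longrightarrow> deg (insert u P) u \<le> deg (insert u P) x"
  shows "deg (insert u P) u \<le> deg P v + deg P w + 1"
proof -
  let ?Q = "insert u P"
  let ?A = "\<lambda>x. {T. T \<subseteq> ?Q \<and> irt T \<and> u \<in> T \<and> x \<in> T}"
  have "?A v \<inter> ?A w \<subseteq> {{u, v, w}}"
  proof
    fix T assume T: "T \<in> ?A v \<inter> ?A w"
    then have "irt T" "u \<in> T" "v \<in> T" "u \<noteq> v" using assms by auto
    then obtain y where "T = {u, v, y}" using third_point by blast
    moreover have "w \<in> T" "w \<noteq> u" using T assms by auto
    ultimately show "T \<in> {{u, v, w}}" using assms(5) by auto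
  qed
  then have "card (?A v \<inter> ?A w) \<le> 1"
    using card_mono[of "{{u, v, w}}" "?A v \<inter> ?A w"] by simp
  moreover have "card (?A v \<union> ?A w) \<le> deg ?Q u"
    unfolding deg_def using assms(1) by (intro card_mono finite_triangles) auto
  moreover have "card (?A v) + card (?A w) = card (?A v \<union> ?A w) + card (?A v \<inter> ?A w)"
    using assms(1) by (intro card_Un_Int finite_triangles) auto
  ultimately have "codeg ?Q v u + codeg ?Q w u \<le> deg ?Q u + 1"
    by (simp add: codeg_commute[of _ _ u]) (simp add: codeg_def)
  moreover have "deg ?Q u \<le> deg P v + codeg ?Q v u" "deg ?Q u \<le> deg P w + codeg ?Q w u"
    using min[OF assms(3)] min[OF assms(4)] deg_insert[of P u] assms(1,2) by auto
  ultimately show ?thesis by linarith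
qed

section \<open>The six points that complete two given points to an isosceles right triangle\<close>

definition rot :: "'a::ab_group_add \<times> 'a \<Rightarrow> 'a \<times> 'a" where
  "rot p = (- snd p, fst p)"

text \<open>The right angle is at \<open>a\<close>, and \<open>c\<close> arises from
  \<open>b\<close> by the positive quarter turn about \<open>a\<close>. Fixing the orientation
  leaves every triangle exactly one such description, see \<open>apex_unique\<close>.\<close>

definition apex :: "point \<Rightarrow> point \<Rightarrow> point \<Rightarrow> bool" where
  "apex a b c \<longleftrightarrow> a \<noteq> b \<and> c = a + rot (b - a)"

lemma apex_distinct: "apex a b c \<Longrightarrow> a \<noteq> b \<and> a \<noteq> c \<and> b \<noteq> c"
  by (auto simp: apex_def rot_def prod_eq_iff)

lemma orthogonal_equal_norm_iff:
  fixes x y u v :: real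
  assumes "x * u + y * v = 0" "x\<^sup>2 + y\<^sup>2 = u\<^sup>2 + v\<^sup>2" "x\<^sup>2 + y\<^sup>2 \<noteq> 0"
  shows "u = - y \<and> v = x \<or> u = y \<and> v = - x"
proof -
  have "(u\<^sup>2 - y\<^sup>2) * (x\<^sup>2 + y\<^sup>2) = 0" "(v\<^sup>2 - x\<^sup>2) * (x\<^sup>2 + y\<^sup>2) = 0"
    using assms(1,2) by algebra+
  then have "u\<^sup>2 = y\<^sup>2" "v\<^sup>2 = x\<^sup>2"
    using assms(3) by (metis eq_iff_diff_eq_0 mult_eq_0_iff)+
  then have "u = y \<or> u = - y" "v = x \<or> v = - x"
    by (simp_all add: power2_eq_iff)
  then show ?thesis using assms(1,3) by (auto simp: power2_eq_square)
qed

lemma irt_iff: "irt T \<longleftrightarrow> (\<exists>a b c. T = {a, b, c} \<and> apex a b c)"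
proof
  assume "irt T"
  then obtain a b c where T: "T = {a, b, c}" "card T = 3" "orthogonal (b - a) (c - a)" "dist a b = dist a c"
    by (auto simp: isosceles_right_triangle_def)
  obtain x y where b: "b - a = (x, y)" by (metis surj_pair)
  obtain u v where c: "c - a = (u, v)" by (metis surj_pair)
  have "a \<noteq> b" using T by auto
  then have "x \<noteq> 0 \<or> y \<noteq> 0" using b by (auto simp: prod_eq_iff)
  then have nz: "x\<^sup>2 + y\<^sup>2 \<noteq> 0" by (simp add: sum_power2_eq_zero_iff)
  have o: "x * u + y * v = 0" using T(3) b c by (simp add: orthogonal_def)
  have "norm (b - a) = norm (c - a)" using T(4) by (simp add: dist_norm norm_minus_commute)
  then have n: "x\<^sup>2 + y\<^sup>2 = u\<^sup>2 + v\<^sup>2" using b c by (simp add: norm_Pair)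
  have bb: "b = a + (x, y)" and cc: "c = a + (u, v)" using b c by (simp_all add: algebra_simps)
  consider "u = - y" "v = x" | "u = y" "v = - x"
    using orthogonal_equal_norm_iff[OF o n nz] by auto
  then show "\<exists>a b c. T = {a, b, c} \<and> apex a b c"
  proof cases
    case 1
    then have "apex a b c" using \<open>a \<noteq> b\<close> by (simp add: apex_def rot_def bb cc)
    then show ?thesis using T by blast
  next
    case 2
    have "a \<noteq> c" using T \<open>a \<noteq> b\<close> by (auto simp: card_insert_if)
    then have "apex a c b" using 2 by (simp add: apex_def rot_def bb cc)
    moreover have "T = {a, c, b}" using T by auto
    ultimately show ?thesis by blast
  qed
next
  assume "\<exists>a b c. T = {a, b, c} \<and> apex a b c"
  then obtain a b c where T: "T = {a, b, c}" "apex a b c" by auto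
  have "card T = 3" using T apex_distinct[of a b c] by simp
  moreover have "orthogonal (b - a) (c - a)"
    using T by (simp add: apex_def rot_def orthogonal_def inner_prod_def algebra_simps)
  moreover have "dist a b = dist a c"
    using T by (simp add: apex_def rot_def dist_norm norm_minus_commute norm_prod_def power2_commute add.commute)
  ultimately show "irt T" using T unfolding isosceles_right_triangle_def by blast
qed

lemma tri_iff: "tri a b c \<longleftrightarrow> apex a b c \<or> apex a c b \<or> apex b a c \<or> apex b c a \<or> apex c a b \<or> apex c b a"
proof
  assume t: "tri a b c"
  then obtain a' b' c' where s: "{a, b, c} = {a', b', c'}" and ap: "apex a' b' c'"
    by (auto simp: tri_def irt_iff)
  have "a' \<in> {a, b, c}" "b' \<in> {a, b, c}" "c' \<in> {a, b, c}" using s by auto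
  then show "apex a b c \<or> apex a c b \<or> apex b a c \<or> apex b c a \<or> apex c a b \<or> apex c b a"
    using ap apex_distinct[OF ap] by auto
next
  assume "apex a b c \<or> apex a c b \<or> apex b a c \<or> apex b c a \<or> apex c a b \<or> apex c b a"
  moreover have "{a, c, b} = {a, b, c}" "{b, a, c} = {a, b, c}" "{b, c, a} = {a, b, c}"
    "{c, a, b} = {a, b, c}" "{c, b, a} = {a, b, c}" by auto
  ultimately show "tri a b c" unfolding tri_def irt_iff by metis
qed

text \<open>For the square erected to the left of the segment from \<open>v\<close> to
  \<open>w\<close>: its two far corners and its centre. With \<open>side w v\<close> on the other
  side these are all six completions.\<close>

definition side :: "point \<Rightarrow> point \<Rightarrow> point set" where
  "side v w = {v + rot (w - v), w + rot (w - v), (1/2) *\<^sub>R (v + w + rot (w - v))}"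

lemma tri_side:
  assumes "tri v w a"
  shows "a \<in> side v w \<union> side w v"
proof -
  obtain v1 v2 w1 w2 a1 a2 where [simp]: "v = (v1, v2)" "w = (w1, w2)" "a = (a1, a2)"
    by (metis surj_pair)
  consider "apex v w a" | "apex v a w" | "apex w v a" | "apex w a v" | "apex a v w" | "apex a w v"
    using assms tri_iff by blast
  then show ?thesis
  proof cases
    case 1 then show ?thesis unfolding apex_def side_def by blast
  next
    case 2
    then have "a = v + rot (v - w)" by (simp add: apex_def rot_def; argo?)
    then show ?thesis by (simp add: side_def)
  next
    case 3 then show ?thesis unfolding apex_def side_def by blast
  next
    case 4
    then have "a = w + rot (w - v)" by (simp add: apex_def rot_def; argo?)
    then show ?thesis by (simp add: side_def)
  next
    case 5
    then have "a = (1/2) *\<^sub>R (v + w + rot (w - v))" by (simp add: apex_def rot_def; argo?)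
    then show ?thesis by (simp add: side_def)
  next
    case 6
    then have "a = (1/2) *\<^sub>R (w + v + rot (v - w))" by (simp add: apex_def rot_def; argo?)
    then show ?thesis by (simp add: side_def)
  qed
qed

text \<open>Both far corners of the square together with \<open>v\<close> form half of it; its
  centre and one far corner form a quarter of it with the adjacent one of \<open>v\<close> and
  \<open>w\<close>.\<close>

lemma tri_of_side:
  assumes "v \<noteq> w" "x \<in> side v w" "y \<in> side v w" "x \<noteq> y"
  shows "tri v x y \<or> tri w x y"
proof -
  obtain v1 v2 w1 w2 where vw: "v = (v1, v2)" "w = (w1, w2)"
    by (metis surj_pair)
  define p q m where "p = v + rot (w - v)" and "q = w + rot (w - v)"
    and "m = (1/2) *\<^sub>R (v + w + rot (w - v))"
  have "apex p v q" "apex m p v" "apex m w q"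
    using assms(1) by (auto simp: p_def q_def m_def apex_def rot_def vw field_simps)
  then have "tri v p q" "tri v p m" "tri w q m"
    unfolding tri_iff by auto
  then have "tri v p q" "tri v p m" "tri w q m" "tri v q p" "tri v m p" "tri w m q"
    by (simp_all add: tri_commute(2)[of _ m] tri_commute(2)[of _ q p])
  moreover have "x \<in> {p, q, m}" "y \<in> {p, q, m}"
    using assms by (auto simp: side_def p_def q_def m_def)
  ultimately show ?thesis using assms(4)
    by (elim insertE emptyE) simp_all
qed

text \<open>Pigeonhole: two of the three completions lie on the same side of the line through
  \<open>v\<close> and \<open>w\<close>.\<close>

lemma three_completions:
  assumes "tri v w a" "tri v w b" "tri v w c" "a \<noteq> b" "a \<noteq> c" "b \<noteq> c"
  shows "\<exists>x\<in>{a, b, c}. \<exists>y\<in>{a, b, c}. tri v x y \<or> tri w x y"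
proof -
  have "v \<noteq> w" using assms(1) tri_distinct by blast
  then have *: "tri v x y \<or> tri w x y" if "x \<in> side v w \<and> y \<in> side v w \<or> x \<in> side w v \<and> y \<in> side w v" "x \<noteq> y" for x y
    using tri_of_side[of v w x y] tri_of_side[of w v x y] that by auto
  have "a \<in> side v w \<or> a \<in> side w v" "b \<in> side v w \<or> b \<in> side w v" "c \<in> side v w \<or> c \<in> side w v"
    using assms tri_side by auto
  then show ?thesis using *[of a b] *[of a c] *[of b c] assms by auto
qed

text \<open>Every triangle of \<open>w\<close> contains \<open>v\<close>, because none is left after
  the removal of \<open>v\<close>; since the degree of \<open>v\<close> is minimal, every triangle
  of \<open>v\<close> contains \<open>w\<close> as well. With three common triangles,
  \<open>three_completions\<close> would yield a triangle through only one of the two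
  points.\<close>

lemma isolated_after_removal:
  assumes "finite P" "v \<in> P" "w \<in> P" "v \<noteq> w"
    and min: "\<And>x. x \<in> P \<Longrightarrow> deg P v \<le> deg P x"
    and pos: "0 < deg P v"
    and iso: "deg (P - {v}) w = 0"
  shows "S_rt P = S_rt (P - {v, w}) + deg P v" "deg P w = deg P v" "deg P v \<le> 2"
    "deg P v = card {y \<in> P. tri v w y}"
proof -
  have P: "insert v (P - {v}) = P" using assms(2) by auto
  have dw: "deg P w = codeg P w v"
    using deg_insert[of "P - {v}" v w] assms(1) iso unfolding P by simp
  have sub: "{T. T \<subseteq> P \<and> irt T \<and> v \<in> T \<and> w \<in> T} \<subseteq> {T. T \<subseteq> P \<and> irt T \<and> v \<in> T}" by auto
  have "{T. T \<subseteq> P \<and> irt T \<and> v \<in> T \<and> w \<in> T} = {T. T \<subseteq> P \<and> irt T \<and> v \<in> T}"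
    using min[OF assms(3)] dw
    unfolding codeg_commute[of P w v]
    by (intro card_seteq finite_triangles assms sub) (simp add: codeg_def deg_def)
  then have vw: "w \<in> T" if "T \<subseteq> P" "irt T" "v \<in> T" for T using that by auto
  then have "{T. T \<subseteq> P \<and> irt T \<and> v \<in> T} = {T. T \<subseteq> P \<and> irt T \<and> v \<in> T \<and> w \<in> T}" by auto
  then have dv: "deg P v = codeg P v w" by (simp add: deg_def codeg_def)
  then show "deg P w = deg P v" using dw by (simp add: codeg_commute)
  show c: "deg P v = card {y \<in> P. tri v w y}"
    using dv codeg_eq assms(2-4) by simp
  have "S_rt (P - {v}) = S_rt (P - {v} - {w}) + deg (P - {v}) w"
    using assms(1) by (intro S_rt_remove) auto
  moreover have "P - {v} - {w} = P - {v, w}" by auto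
  ultimately show "S_rt P = S_rt (P - {v, w}) + deg P v"
    using S_rt_remove[OF assms(1), of v] iso by simp
  have wv: "v \<in> T" if "T \<subseteq> P" "irt T" "w \<in> T" for T
  proof (rule ccontr)
    assume "v \<notin> T"
    then have "T \<in> {T. T \<subseteq> P - {v} \<and> irt T \<and> w \<in> T}" using that by auto
    moreover have "finite {T. T \<subseteq> P - {v} \<and> irt T \<and> w \<in> T}" using assms(1) by (intro finite_triangles) auto
    ultimately show False using iso by (auto simp: deg_def)
  qed
  show "deg P v \<le> 2"
  proof (rule ccontr)
    assume "\<not> deg P v \<le> 2"
    then have "3 \<le> card {y \<in> P. tri v w y}" using c by simp
    then obtain A where "A \<subseteq> {y \<in> P. tri v w y}" "card A = 3"
      by (meson obtain_subset_with_card_n)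
    moreover from this obtain a b c where "A = {a, b, c}" and ne: "a \<noteq> b" "a \<noteq> c" "b \<noteq> c"
      unfolding card_3_iff by blast
    ultimately have abc: "{a, b, c} \<subseteq> {y \<in> P. tri v w y}" by simp
    then have "\<exists>x\<in>{a, b, c}. \<exists>y\<in>{a, b, c}. tri v x y \<or> tri w x y"
      using ne by (intro three_completions) simp_all
    then obtain x y where xy: "x \<in> {a, b, c}" "y \<in> {a, b, c}" "tri v x y \<or> tri w x y"
      by blast
    have "tri v w x" "tri v w y" "x \<in> P" "y \<in> P" using xy abc by auto
    then have "x \<noteq> v" "x \<noteq> w" "y \<noteq> v" "y \<noteq> w" using tri_distinct by blast+
    then show False
      using xy(3) vw[of "{v, x, y}"] wv[of "{w, x, y}"] \<open>x \<in> P\<close> \<open>y \<in> P\<close> assms(2-4)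
      by (auto simp: tri_def)
  qed
qed

subsection \<open>Similarities\<close>

text \<open>Bijectivity is included so that inverses are at hand; all similarities constructed below
  are explicit affine maps.\<close>

definition bsim :: "(point \<Rightarrow> point) \<Rightarrow> bool" where
  "bsim f \<longleftrightarrow> similarity f \<and> bij f"

lemma bsim_inv:
  assumes "bsim f"
  shows "bsim (inv f)"
proof -
  obtain r where r: "r > 0" "\<And>x y. dist (f x) (f y) = r * dist x y" and "bij f"
    using assms by (auto simp: bsim_def similarity_def)
  then have "dist (inv f x) (inv f y) = (1 / r) * dist x y" for x y
    using r(2)[of "inv f x" "inv f y"] by (simp add: bij_is_surj surj_f_inv_f field_simps)
  then show ?thesis
    using r(1) \<open>bij f\<close> unfolding bsim_def similarity_def
    by (intro conjI exI[of _ "1 / r"]) (auto simp: bij_imp_bij_inv)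
qed

lemma bsim_comp:
  assumes "bsim f" "bsim g"
  shows "bsim (f \<circ> g)"
proof -
  obtain r s where "r > 0" "\<And>x y. dist (f x) (f y) = r * dist x y"
     "s > 0" "\<And>x y. dist (g x) (g y) = s * dist x y"
    using assms by (auto simp: bsim_def similarity_def)
  then have "similarity (f \<circ> g)"
    unfolding similarity_def by (intro exI[of _ "r * s"]) simp
  then show ?thesis using assms by (auto simp: bsim_def intro: bij_comp)
qed

text \<open>In complex terms, multiplication by \<open>p + i q\<close> followed by a translation;
  distances are scaled by the modulus of the factor.\<close>

lemma bsim_affine:
  assumes "p \<noteq> 0 \<or> q \<noteq> 0"
  shows "bsim (\<lambda>z. (a + p * fst z - q * snd z, b + q * fst z + p * snd z))"
proof -
  define f :: "point \<Rightarrow> point" where "f z = (a + p * fst z - q * snd z, b + q * fst z + p * snd z)" for z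
  have n: "p\<^sup>2 + q\<^sup>2 > 0" using assms by (simp add: sum_power2_gt_zero_iff)
  have "dist (f x) (f y) = sqrt (p\<^sup>2 + q\<^sup>2) * dist x y" for x y
  proof -
    have "(p * (fst x - fst y) - q * (snd x - snd y))\<^sup>2 + (q * (fst x - fst y) + p * (snd x - snd y))\<^sup>2 =
       (p\<^sup>2 + q\<^sup>2) * ((fst x - fst y)\<^sup>2 + (snd x - snd y)\<^sup>2)" by algebra
    then show ?thesis
      by (simp add: dist_prod_def f_def dist_real_def algebra_simps real_sqrt_mult[symmetric])
  qed
  then have sim: "similarity f" unfolding similarity_def using n by (intro exI[of _ "sqrt (p\<^sup>2 + q\<^sup>2)"]) auto
  have "inj f"
  proof (rule injI)
    fix x y assume "f x = f y"
    moreover obtain r where "r > 0" "dist (f x) (f y) = r * dist x y"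
      using sim unfolding similarity_def by blast
    ultimately show "x = y" by simp
  qed
  moreover have "surj f"
  proof (rule surjI)
    fix z
    let ?u = "fst z - a" and ?v = "snd z - b"
    have "p * (p * ?u + q * ?v) - q * (p * ?v - q * ?u) = ?u * (p\<^sup>2 + q\<^sup>2)"
      "q * (p * ?u + q * ?v) + p * (p * ?v - q * ?u) = ?v * (p\<^sup>2 + q\<^sup>2)"
      by algebra+
    then have "p * ((p * ?u + q * ?v) / (p\<^sup>2 + q\<^sup>2)) - q * ((p * ?v - q * ?u) / (p\<^sup>2 + q\<^sup>2)) = ?u"
      "q * ((p * ?u + q * ?v) / (p\<^sup>2 + q\<^sup>2)) + p * ((p * ?v - q * ?u) / (p\<^sup>2 + q\<^sup>2)) = ?v"
      using assms by (simp_all flip: diff_divide_distrib add_divide_distrib)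
    then show "f ((p * ?u + q * ?v) / (p\<^sup>2 + q\<^sup>2), (p * ?v - q * ?u) / (p\<^sup>2 + q\<^sup>2)) = z"
      by (simp add: f_def prod_eq_iff algebra_simps)
  qed
  ultimately have "bsim f" using sim by (simp add: bsim_def bij_def)
  then show ?thesis by (simp add: f_def[abs_def])
qed

text \<open>Pythagoras turns the orthogonality into an equation between distances, which a
  similarity visibly preserves.\<close>

lemma irt_iff_dist:
  "irt T \<longleftrightarrow> card T = 3 \<and> (\<exists>a b c. T = {a, b, c} \<and>
     (dist b c)\<^sup>2 = (dist a b)\<^sup>2 + (dist a c)\<^sup>2 \<and> dist a b = dist a c)"
proof -
  have "orthogonal (b - a) (c - a) \<longleftrightarrow> (dist b c)\<^sup>2 = (dist a b)\<^sup>2 + (dist a c)\<^sup>2" for a b c :: point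
  proof -
    have "(dist b c)\<^sup>2 = (norm ((b - a) - (c - a)))\<^sup>2" by (simp add: dist_norm)
    also have "\<dots> = (norm (b - a))\<^sup>2 + (norm (c - a))\<^sup>2 - 2 * inner (b - a) (c - a)"
      unfolding power2_norm_eq_inner by (simp add: inner_diff_left inner_diff_right inner_commute)
    finally show ?thesis by (simp add: orthogonal_def dist_norm norm_minus_commute)
  qed
  then show ?thesis unfolding isosceles_right_triangle_def by presburger
qed

lemma irt_image_imp:
  assumes "bsim f" "irt T"
  shows "irt (f ` T)"
proof -
  obtain r where r: "r > 0" "\<And>x y. dist (f x) (f y) = r * dist x y" and "inj f"
    using assms by (auto simp: bsim_def similarity_def bij_is_inj)
  obtain a b c where T: "T = {a, b, c}" "(dist b c)\<^sup>2 = (dist a b)\<^sup>2 + (dist a c)\<^sup>2"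
     "dist a b = dist a c" "card T = 3"
    using assms(2) unfolding irt_iff_dist by blast
  have "card (f ` T) = 3" using T(4) card_image[OF inj_on_subset[OF \<open>inj f\<close> subset_UNIV]] by simp
  moreover have "f ` T = {f a, f b, f c}" using T by simp
  moreover have "(dist (f b) (f c))\<^sup>2 = (dist (f a) (f b))\<^sup>2 + (dist (f a) (f c))\<^sup>2"
    unfolding r(2) using T(2) by (simp add: power_mult_distrib flip: distrib_left)
  moreover have "dist (f a) (f b) = dist (f a) (f c)" unfolding r(2) using T by simp
  ultimately show ?thesis unfolding irt_iff_dist by blast
qed

lemma inv_image: "bij f \<Longrightarrow> inv f ` (f ` P) = P"
  by (simp add: image_comp bij_is_inj)

lemma image_inv: "bij f \<Longrightarrow> f ` (inv f ` P) = P"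
  by (simp add: image_image bij_is_surj surj_f_inv_f)

lemma irt_image:
  assumes "bsim f"
  shows "irt (f ` T) \<longleftrightarrow> irt T"
proof
  assume "irt (f ` T)"
  then have "irt (inv f ` (f ` T))" by (rule irt_image_imp[OF bsim_inv[OF assms]])
  then show "irt T" using assms inv_image[of f T] by (simp add: bsim_def)
qed (rule irt_image_imp[OF assms])

lemma deg_image:
  assumes "bsim f"
  shows "deg (f ` P) (f v) = deg P v" "S_rt (f ` P) = S_rt P"
proof -
  have b: "bij f" using assms by (simp add: bsim_def)
  have "bij_betw ((`) f) {T. T \<subseteq> P \<and> irt T \<and> v \<in> T} {T. T \<subseteq> f ` P \<and> irt T \<and> f v \<in> T}"
  proof (rule bij_betw_byWitness[of _ "(`) (inv f)"])
    show "(`) (inv f) ` {T. T \<subseteq> f ` P \<and> irt T \<and> f v \<in> T} \<subseteq> {T. T \<subseteq> P \<and> irt T \<and> v \<in> T}"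
    proof (clarify, intro conjI)
      fix T assume T: "T \<subseteq> f ` P" "irt T" "f v \<in> T"
      show "inv f ` T \<subseteq> P" using T(1) inv_image[OF b] by blast
      show "irt (inv f ` T)" using T(2) bsim_inv[OF assms] irt_image by blast
      show "v \<in> inv f ` T" using T(3) b by (metis bij_inv_eq_iff image_eqI)
    qed
  qed (auto simp: inv_image[OF b] image_inv[OF b] irt_image[OF assms])
  then show "deg (f ` P) (f v) = deg P v" by (simp add: deg_def bij_betw_same_card)
  have "bij_betw ((`) f) {T. T \<subseteq> P \<and> irt T} {T. T \<subseteq> f ` P \<and> irt T}"
  proof (rule bij_betw_byWitness[of _ "(`) (inv f)"])
    show "(`) (inv f) ` {T. T \<subseteq> f ` P \<and> irt T} \<subseteq> {T. T \<subseteq> P \<and> irt T}"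
    proof (clarify, intro conjI)
      fix T assume T: "T \<subseteq> f ` P" "irt T"
      show "inv f ` T \<subseteq> P" using T(1) inv_image[OF b] by blast
      show "irt (inv f ` T)" using T(2) bsim_inv[OF assms] irt_image by blast
    qed
  qed (auto simp: inv_image[OF b] image_inv[OF b] irt_image[OF assms])
  then show "S_rt (f ` P) = S_rt P" by (simp add: S_rt_def bij_betw_same_card)
qed

subsection \<open>Extension chains\<close>

text \<open>Downwards from th 14 = 74, each value is the previous one reduced by the fraction 3 / k (rounded down) that
  a point of minimum degree can account for. Only th 6 is one lower, for sets of seven points in
  which deleting a point of minimum degree isolates another one.\<close>

definition th :: "nat \<Rightarrow> nat" where
  "th k = [0, 0, 0, 1, 2, 3, 5, 9, 13, 19, 26, 35, 46, 59, 74] ! k"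

text \<open>Upper bounds for \<open>S_rt\<close> on \<open>k\<close> points; for ten to fourteen
  points they are the claimed maxima. At three and at fourteen points they agree with
  \<open>th\<close>.\<close>

definition ub :: "nat \<Rightarrow> nat" where
  "ub k = [0, 0, 0, 1, 4, 8, 11, 15, 20, 28, 35, 43, 52, 64, 74] ! k"

definition extremal :: "nat \<Rightarrow> point set set" where
  "extremal k = [{E10}, {E11}, {E12a, E12b}, {E13a, E13b}, {E14}] ! (k - 10)"

text \<open>One step of a chain. A positive degree leaves finitely many choices for
  \<open>v\<close>. Minimality is imposed once the enlarged set has eight points; before that,
  \<open>good6_double\<close> and \<open>rich7\<close> add points in an order of their own.\<close>

definition ext :: "nat \<Rightarrow> point set \<Rightarrow> point \<Rightarrow> bool" where
  "ext k P v \<longleftrightarrow> k < 14 \<and> v \<notin> P \<and> th (Suc k) \<le> S_rt (insert v P) \<and> 0 < deg (insert v P) v \<and>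
     (7 \<le> k \<longrightarrow> (\<forall>w\<in>P. deg (insert v P) v \<le> deg (insert v P) w))"

text \<open>The gap at seven triangles on five points is what \<open>rich7\<close> uses: a
  five-point subset with at least seven triangles then has exactly eight.\<close>

definition final :: "nat \<Rightarrow> point set \<Rightarrow> bool" where
  "final k P \<longleftrightarrow> S_rt P \<le> ub k \<and> (k = 5 \<longrightarrow> S_rt P \<noteq> 7) \<and>
     (10 \<le> k \<and> S_rt P = ub k \<longrightarrow> (\<exists>E\<in>extremal k. \<exists>f. bsim f \<and> f ` E = P))"

text \<open>All sets reachable from \<open>P\<close> by chains are final. The inductive form
  provides induction over the tree of extensions, which is finite in depth because
  \<open>ext\<close> stops at fourteen points.\<close>

inductive good :: "nat \<Rightarrow> point set \<Rightarrow> bool" where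
  goodI: "finite P \<Longrightarrow> card P = k \<Longrightarrow> final k P \<Longrightarrow>
    (\<And>v. ext k P v \<Longrightarrow> good (Suc k) (insert v P)) \<Longrightarrow> good k P"

lemma goodD:
  assumes "good k P"
  shows "finite P" "card P = k" "final k P" "ext k P v \<Longrightarrow> good (Suc k) (insert v P)"
  using assms by (auto elim: good.cases)

text \<open>A similarity carries chains to chains, so one representative of each similarity class
  has to be searched. An extension point of the image is pulled back by the inverse.\<close>

lemma good_image:
  assumes "good k P" "bsim f"
  shows "good k (f ` P)"
  using assms(1)
proof (induction)
  case (goodI P k)
  have b: "bij f" using assms(2) by (simp add: bsim_def)
  show ?case
  proof (rule good.intros)
    show "finite (f ` P)" using goodI by simp
    show "card (f ` P) = k" using goodI card_image[OF inj_on_subset[OF bij_is_inj[OF b] subset_UNIV]] by simp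
    show "final k (f ` P)" unfolding final_def deg_image(2)[OF assms(2)]
    proof (intro conjI impI)
      assume "10 \<le> k \<and> S_rt P = ub k"
      then obtain E g where "E \<in> extremal k" "bsim g" "g ` E = P"
        using goodI unfolding final_def by blast
      then show "\<exists>E\<in>extremal k. \<exists>g. bsim g \<and> g ` E = f ` P"
        using bsim_comp[OF assms(2)] by (intro bexI[of _ E] exI[of _ "f \<circ> g"]) (auto simp: image_comp)
    qed (use goodI in \<open>auto simp: final_def\<close>)
  next
    fix u assume u: "ext k (f ` P) u"
    define v where "v = inv f u"
    have fv: "f v = u" using b by (simp add: v_def bij_is_surj surj_f_inv_f)
    have img: "insert u (f ` P) = f ` insert v P" by (simp add: fv)
    have d: "deg (insert u (f ` P)) (f w) = deg (insert v P) w" for w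
      unfolding img by (rule deg_image(1)[OF assms(2)])
    have "S_rt (insert u (f ` P)) = S_rt (insert v P)"
      unfolding img by (rule deg_image(2)[OF assms(2)])
    then have "ext k P v"
      using u d d[of v] unfolding ext_def fv by (auto simp flip: fv)
    then show "good (Suc k) (insert u (f ` P))" unfolding img using goodI by blast
  qed
qed

lemma ub_values: "ub 3 = 1" "ub 4 = 4" "ub 5 = 8" "ub 6 = 11" "ub 7 = 15" "ub 8 = 20" "ub 9 = 28"
  "ub 10 = 35" "ub 11 = 43" "ub 12 = 52" "ub 13 = 64" "ub 14 = 74"
  by (simp_all add: ub_def)

subsection \<open>Every rich point set lies on an extension chain\<close>

lemma S_rt_mono: "finite P \<Longrightarrow> Q \<subseteq> P \<Longrightarrow> S_rt Q \<le> S_rt P"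
  unfolding S_rt_def by (intro card_mono finite_triangles) auto

lemma deg_mono: "finite P \<Longrightarrow> Q \<subseteq> P \<Longrightarrow> deg Q v \<le> deg P v"
  unfolding deg_def by (intro card_mono finite_triangles) auto

lemma S_rt_add_deg_le: "finite P \<Longrightarrow> Q \<subseteq> P - {v} \<Longrightarrow> S_rt Q + deg P v \<le> S_rt P"
  using S_rt_remove[of P v] S_rt_mono[of "P - {v}" Q] by simp

lemma deg_pos_of_tri:
  assumes "finite P" "v \<in> P" "w \<in> P" "x \<in> P" "tri v w x"
  shows "0 < deg P v"
proof -
  have "{v, w, x} \<in> {T. T \<subseteq> P \<and> irt T \<and> v \<in> T}" using assms by (auto simp: tri_def)
  then have "{T. T \<subseteq> P \<and> irt T \<and> v \<in> T} \<noteq> {}" by auto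
  then show ?thesis unfolding deg_def using finite_triangles[OF assms(1)] by (simp add: card_gt_0_iff)
qed

lemma S_rt_four:
  assumes "distinct [a, b, c, d]"
  shows "S_rt {a, b, c, d} = of_bool (tri a b c) + of_bool (tri a b d) + of_bool (tri a c d) + of_bool (tri b c d)"
  using S_rt_Cons[of a "[b, c, d]"] S_rt_Cons[of b "[c, d]"] S_rt_Cons[of c "[d]"] S_rt_Cons[of d "[]"] assms
  by (simp add: S_rt_empty)

lemma S_rt_five:
  assumes "distinct [a, b, c, d, e]"
  shows "S_rt {a, b, c, d, e} = of_bool (tri a b c) + of_bool (tri a b d) + of_bool (tri a b e) +
    of_bool (tri a c d) + of_bool (tri a c e) + of_bool (tri a d e) +
    of_bool (tri b c d) + of_bool (tri b c e) + of_bool (tri b d e) + of_bool (tri c d e)"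
  using S_rt_Cons[of a "[b, c, d, e]"] S_rt_four[of b c d e] assms
  by simp

lemma S_rt_card3: "card P = 3 \<Longrightarrow> S_rt P \<le> 1"
proof -
  assume c: "card P = 3"
  then have f: "finite P" by (simp add: card_ge_0_finite)
  have "{T. T \<subseteq> P \<and> irt T} \<subseteq> {P}"
  proof
    fix T assume "T \<in> {T. T \<subseteq> P \<and> irt T}"
    then have "T \<subseteq> P" "card T = card P" using c irt_card[of T] by auto
    then show "T \<in> {P}" using card_subset_eq[OF f] by simp
  qed
  then show ?thesis unfolding S_rt_def using card_mono[of "{P}"] by fastforce
qed

lemma irt_of_card3:
  assumes "card P = 3" "S_rt P \<noteq> 0"
  shows "irt P"
proof -
  have f: "finite P" using assms by (simp add: card_ge_0_finite)
  have "{T. T \<subseteq> P \<and> irt T} \<noteq> {}" using assms(2) unfolding S_rt_def by force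
  then obtain T where "T \<subseteq> P" "irt T" by blast
  then have "T = P" using assms f irt_card by (metis card_subset_eq)
  with \<open>irt T\<close> show ?thesis by simp
qed

lemma S_rt_irt: "irt T \<Longrightarrow> S_rt T = 1"
proof -
  assume T: "irt T"
  then have "card T = 3" "finite T" by (auto simp: irt_card intro: card_ge_0_finite)
  have "{U. U \<subseteq> T \<and> irt U} = {T}"
    using T \<open>card T = 3\<close> \<open>finite T\<close> by (auto simp: irt_card dest: card_subset_eq)
  then show ?thesis by (simp add: S_rt_def)
qed

definition noiso :: "point set \<Rightarrow> bool" where
  "noiso P \<longleftrightarrow> (\<forall>v\<in>P. 0 < deg P v)"

lemma iso_S_rt: "finite P \<Longrightarrow> \<not> noiso P \<Longrightarrow> \<exists>w\<in>P. S_rt P = S_rt (P - {w})"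
  unfolding noiso_def using S_rt_remove by (metis add.right_neutral gr_zeroI)

lemma good_insert:
  assumes "good k Q" "v \<notin> Q" "k < 14" "th (Suc k) \<le> S_rt (insert v Q)" "0 < deg (insert v Q) v"
    and "7 \<le> k \<Longrightarrow> \<forall>w\<in>Q. deg (insert v Q) v \<le> deg (insert v Q) w"
  shows "good (Suc k) (insert v Q)"
  using goodD(4)[OF assms(1)] assms unfolding ext_def by blast

lemma good_remove:
  assumes "good k (P - {v})" "v \<in> P" "k < 14" "th (Suc k) \<le> S_rt P" "0 < deg P v"
    and "7 \<le> k \<Longrightarrow> \<forall>w\<in>P. deg P v \<le> deg P w"
  shows "good (Suc k) P"
proof -
  have "insert v (P - {v}) = P" using assms(2) by auto
  with good_insert[OF assms(1), of v] assms(3-) show ?thesis by auto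
qed

text \<open>The dichotomy behind every passage to one more point. If deleting a minimum-degree point
  isolates nothing, averaging the degrees limits the loss. Otherwise it is deleted together with the
  point that it isolates, and the loss is at most two triangles.\<close>

lemma removal_cases:
  assumes P: "finite P" "card P = Suc k" "noiso P"
  obtains v where "v \<in> P" "card (P - {v}) = k" "finite (P - {v})"
      "\<forall>w\<in>P. deg P v \<le> deg P w" "0 < deg P v"
      "S_rt P = S_rt (P - {v}) + deg P v" "(k - 2) * S_rt P \<le> Suc k * S_rt (P - {v})"
      "noiso (P - {v})"
  | v w where "v \<in> P" "w \<in> P" "v \<noteq> w" "card (P - {v, w}) = k - 1" "finite (P - {v, w})"
      "S_rt P = S_rt (P - {v, w}) + deg P v" "deg P w = deg P v" "0 < deg P v" "deg P v \<le> 2"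
      "deg P v = card {y \<in> P. tri v w y}"
proof -
  have "P \<noteq> {}" using P by auto
  then obtain v where v: "v \<in> P" "\<And>w. w \<in> P \<Longrightarrow> deg P v \<le> deg P w" "Suc k * deg P v \<le> 3 * S_rt P"
    using obtain_min_deg P by metis
  have pos: "0 < deg P v" using P v by (auto simp: noiso_def)
  have S: "S_rt P = S_rt (P - {v}) + deg P v" using S_rt_remove P by blast
  have c: "card (P - {v}) = k" "finite (P - {v})" using P v by auto
  show ?thesis
  proof (cases "noiso (P - {v})")
    case True
    have "(k - 2) * S_rt P \<le> Suc k * S_rt (P - {v})"
    proof (cases "k \<le> 2")
      case False
      then obtain m where "k = m + 2" by (metis le_add_diff_inverse2 nat_le_linear)
      then show ?thesis using v(3) S by (simp add: algebra_simps)
    qed simp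
    then show ?thesis using that(1)[OF v(1) c] True v(2) pos S by blast
  next
    case False
    then obtain w where w: "w \<in> P" "v \<noteq> w" "deg (P - {v}) w = 0"
      by (auto simp: noiso_def)
    have "card (P - {v, w}) = k - 1" "finite (P - {v, w})"
      using P v w by (simp_all add: card_Diff_subset)
    then show ?thesis
      using that(2)[OF v(1) w(1,2)] isolated_after_removal[OF P(1) v(1) w(1,2) v(2) pos w(3)] pos by auto
  qed
qed

section \<open>Sets at or above the threshold without isolated points, by increasing size\<close>

definition rich :: "nat \<Rightarrow> nat \<Rightarrow> bool" where
  "rich k t \<longleftrightarrow> (\<forall>P. finite P \<longrightarrow> card P = k \<longrightarrow> t \<le> S_rt P \<longrightarrow> noiso P \<longrightarrow> good k P)"

definition bounded_by :: "nat \<Rightarrow> nat \<Rightarrow> bool" where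
  "bounded_by k b \<longleftrightarrow> (\<forall>P. finite P \<longrightarrow> card P = k \<longrightarrow> S_rt P \<le> b)"

lemma bounded_by_rich:
  assumes "rich (Suc k) t" "bounded_by k b" "b \<le> ub (Suc k)" "t \<le> Suc (ub (Suc k))"
  shows "bounded_by (Suc k) (ub (Suc k))"
  unfolding bounded_by_def
proof (intro allI impI)
  fix P :: "point set" assume P: "finite P" "card P = Suc k"
  consider "S_rt P < t" | "t \<le> S_rt P" "noiso P" | "\<not> noiso P" by linarith
  then show "S_rt P \<le> ub (Suc k)"
  proof cases
    case 2
    then have "good (Suc k) P" using assms(1) P by (auto simp: rich_def)
    then show ?thesis using goodD(3) by (auto simp: final_def)
  next
    case 3
    then obtain w where "w \<in> P" "S_rt P = S_rt (P - {w})" using iso_S_rt P by blast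
    moreover have "S_rt (P - {w}) \<le> b" using assms(2) P \<open>w \<in> P\<close> by (simp add: bounded_by_def)
    ultimately show ?thesis using assms(3) by simp
  qed (use assms(4) in simp)
qed

text \<open>The fourth hypothesis says that \<open>th k\<close> does not exceed the share
  \<open>(k - 2) / (k + 1)\<close> of the next threshold, rounded up. The third one excludes that a
  second point becomes isolated, for the set would then have at most \<open>b + 2\<close>
  triangles.\<close>

lemma rich_step:
  assumes "rich k (th k)" "bounded_by (k - 1) b" "b + 2 < th (Suc k)"
    "Suc k * th k < (k - 2) * th (Suc k) + Suc k" "7 \<le> k" "k < 14"
  shows "rich (Suc k) (th (Suc k))"
  unfolding rich_def
proof (intro allI impI)
  fix P assume P: "finite P" "card P = Suc k" "th (Suc k) \<le> S_rt P" "noiso P"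
  from P(1,2,4) show "good (Suc k) P"
  proof (cases rule: removal_cases)
    case (1 v)
    have "(k - 2) * th (Suc k) \<le> Suc k * S_rt (P - {v})"
      using 1(7) P(3) by (meson le_trans mult_le_mono2)
    then have "Suc k * th k < Suc k * (S_rt (P - {v}) + 1)" using assms(4) by simp
    then have "th k \<le> S_rt (P - {v})" by (simp only: mult_less_cancel1) simp
    then have "good k (P - {v})" using assms(1) 1 by (auto simp: rich_def)
    then show ?thesis using good_remove 1 assms(6) P(3) by blast
  next
    case (2 v w)
    have "S_rt (P - {v, w}) \<le> b" using 2 assms(2) by (simp add: bounded_by_def)
    then show ?thesis using 2 assms(3) P(3) by simp
  qed
qed

text \<open>The outcome of the search enters as a hypothesis on a single triangle, which keeps the
  combinatorial argument apart from the computation; \<open>good_triangle\<close> discharges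
  it.\<close>

context
  assumes good3: "good 3 {(0, 0), (1, 0), (0, 1)}"
begin

text \<open>The complex affine map that sends 0 to \<open>a\<close> and 1 to \<open>b\<close> sends
  \<open>i\<close> to \<open>c\<close>.\<close>

lemma good3_irt:
  assumes "irt T"
  shows "good 3 T"
proof -
  obtain a b c where T: "T = {a, b, c}" "apex a b c" using assms irt_iff by blast
  obtain a1 a2 b1 b2 where ab: "a = (a1, a2)" "b = (b1, b2)" by (metis surj_pair)
  let ?f = "\<lambda>z. (a1 + (b1 - a1) * fst z - (b2 - a2) * snd z, a2 + (b2 - a2) * fst z + (b1 - a1) * snd z)"
  have ne: "b1 - a1 \<noteq> 0 \<or> b2 - a2 \<noteq> 0" using T(2) by (simp add: apex_def ab) argo
  have g: "good 3 (?f ` {(0, 0), (1, 0), (0, 1)})"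
    by (rule good_image[OF good3 bsim_affine[OF ne]])
  have "c = (a1 - (b2 - a2), a2 + (b1 - a1))" using T(2) by (simp add: apex_def ab rot_def)
  then have "?f ` {(0, 0), (1, 0), (0, 1)} = T" by (simp add: T(1) ab)
  with g show ?thesis by (rule subst[rotated])
qed

text \<open>Four times the minimum degree is at most three times the number of triangles, so a point
  of minimum degree does not lie in all of them. Deleting it therefore leaves three points that form
  a triangle.\<close>

lemma rich4_all:
  assumes "finite P" "card P = 4" "2 \<le> S_rt P"
  shows "good 4 P"
proof -
  have "P \<noteq> {}" using assms by auto
  then obtain v where v: "v \<in> P" "card P * deg P v \<le> 3 * S_rt P"
    using obtain_min_deg assms(1) by metis
  have S: "S_rt P = S_rt (P - {v}) + deg P v" using S_rt_remove assms(1) by blast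
  have c: "card (P - {v}) = 3" using assms v by simp
  then have "S_rt (P - {v}) \<le> 1" by (rule S_rt_card3)
  moreover have "S_rt (P - {v}) \<noteq> 0" using v(2) S assms by auto
  ultimately have "good 3 (P - {v})" "0 < deg P v"
    using good3_irt irt_of_card3[OF c] S assms by auto
  then have "good (Suc 3) P" using v(1) assms by (intro good_remove[of 3 P v]) (auto simp: th_def)
  then show ?thesis by simp
qed

lemma bounded3: "bounded_by 3 1"
  using S_rt_card3 by (simp add: bounded_by_def)

lemma rich4: "rich 4 2"
  using rich4_all by (simp add: rich_def)

lemma bounded4: "bounded_by 4 4"
  using bounded_by_rich[of 3 2 1] rich4 bounded3 by (simp add: ub_def)

lemma rich5: "rich 5 3"
  unfolding rich_def
proof (intro allI impI)
  fix P assume P: "finite P" "card P = 5" "3 \<le> S_rt P" "noiso P"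
  have "P \<noteq> {}" using P by auto
  then obtain v where v: "v \<in> P" "card P * deg P v \<le> 3 * S_rt P"
    using obtain_min_deg P(1) by metis
  have S: "S_rt P = S_rt (P - {v}) + deg P v" using S_rt_remove P by blast
  \<comment> \<open>At least two fifths of the triangles survive the deletion, which for three or
    more triangles means at least two. \<open>rich4_all\<close> then applies whether or not a point
    has become isolated.\<close>
  have "2 \<le> S_rt (P - {v})" using v(2) P S by simp
  then have "good 4 (P - {v})" using P v by (intro rich4_all) auto
  then have "good (Suc 4) P" using v(1) P by (intro good_remove[of 4 P v]) (auto simp: th_def noiso_def)
  then show "good 5 P" by simp
qed

lemma bounded5: "bounded_by 5 8"
  using bounded_by_rich[of 4 3 4] rich5 bounded4 by (simp add: ub_def)

text \<open>The chain starting from two triangles sharing their side vw, when v and w have no other triangles.\<close>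

lemma good6_double:
  assumes "distinct [v, w, c1, c2, x, y]" "tri v w c1" "tri v w c2" "tri c1 c2 x"
    "3 \<le> S_rt {c1, c2, x, y}"
  shows "good 6 {v, w, c1, c2, x, y}"
proof -
  have d2: "2 \<le> deg P v" if "{v, w, c1, c2} \<subseteq> P" "finite P" for P
  proof -
    have "card {{v, w, c1}, {v, w, c2}} = 2"
      using assms(1) by (auto simp: card_insert_if doubleton_eq_iff insert_eq_iff)
    moreover have "card {{v, w, c1}, {v, w, c2}} \<le> deg P v"
      unfolding deg_def using that assms(2,3) by (intro card_mono finite_triangles) (auto simp: tri_def)
    ultimately show ?thesis by simp
  qed
  have "2 \<le> S_rt {v, w, c1, c2}"
    using d2[of "{v, w, c1, c2}"] S_rt_add_deg_le[of "{v, w, c1, c2}" "{}" v] by simp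
  then have 4: "good 4 {v, w, c1, c2}" using assms(1) by (intro rich4_all) auto
  have c: "irt {c1, c2, x}" using assms(4) by (simp add: tri_def)
  let ?A = "insert x {v, w, c1, c2}"
  have "S_rt {c1, c2, x} + 2 \<le> S_rt ?A"
    using S_rt_add_deg_le[of ?A "{c1, c2, x}" v] d2[of ?A] assms(1) by auto
  moreover have "tri x c1 c2" using assms(4) tri_commute by metis
  then have "0 < deg ?A x" by (intro deg_pos_of_tri[of _ x c1 c2]) simp_all
  moreover have "x \<notin> {v, w, c1, c2}" "y \<notin> ?A" using assms(1) by auto
  ultimately have 5: "good 5 ?A"
    using good_insert[OF 4, of x] S_rt_irt[OF c] by (simp add: th_def)
  let ?B = "insert y ?A"
  have "S_rt {c1, c2, x, y} + 2 \<le> S_rt ?B"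
    using S_rt_add_deg_le[of ?B "{c1, c2, x, y}" v] d2[of ?B] assms(1) by auto
  moreover have "S_rt {c1, c2, x, y} = S_rt {c1, c2, x} + deg {c1, c2, x, y} y"
  proof -
    have "insert y {c1, c2, x} = {c1, c2, x, y}" by auto
    then show ?thesis using S_rt_insert[of "{c1, c2, x}" y] assms(1) by auto
  qed
  then have "0 < deg {c1, c2, x, y} y" using S_rt_irt[OF c] assms(5) by simp
  then have "0 < deg ?B y" using deg_mono[of ?B "{c1, c2, x, y}" y] by auto
  ultimately have "good 6 ?B"
    using good_insert[OF 5, of y] assms(5) \<open>y \<notin> ?A\<close> by (simp add: th_def)
  moreover have "?B = {v, w, c1, c2, x, y}" by auto
  ultimately show ?thesis by simp
qed

lemma rich6: "rich 6 6"
  unfolding rich_def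
proof (intro allI impI)
  fix P assume P: "finite P" "card P = 6" "6 \<le> S_rt P" "noiso P"
  have k: "card P = Suc 5" using P by simp
  from P(1) k P(4) show "good 6 P"
  proof (cases rule: removal_cases)
    case (1 v)
    have "3 \<le> S_rt (P - {v})" using 1(7) P(3) by simp
    then have "good 5 (P - {v})" using rich5 1 by (auto simp: rich_def)
    then have "good (Suc 5) P" using 1 P(3) by (intro good_remove[of 5 P v]) (auto simp: th_def)
    then show ?thesis by simp
  next
    case (2 v w)
    let ?R = "P - {v, w}"
    \<comment> \<open>Six triangles arise here only as \<open>4 + 2\<close>: all four triples of the
      remaining points are triangles, and \<open>v\<close> and \<open>w\<close> share two.\<close>
    have "S_rt ?R \<le> 4" using bounded4 2 by (simp add: bounded_by_def)
    then have R: "S_rt ?R = 4" "card {y \<in> P. tri v w y} = 2" using 2 P(3) by auto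
    then obtain c1 c2 where c: "{y \<in> P. tri v w y} = {c1, c2}" "c1 \<noteq> c2" by (auto simp: card_2_iff)
    then have ct: "tri v w c1" "tri v w c2" "c1 \<in> P" "c2 \<in> P" by auto
    then have cR: "c1 \<in> ?R" "c2 \<in> ?R" using tri_distinct by blast+
    have "card (?R - {c1, c2}) = 2" using 2 cR c by (simp add: card_Diff_subset)
    then obtain x y where xy: "?R - {c1, c2} = {x, y}" "x \<noteq> y" by (auto simp: card_2_iff)
    then have Req: "?R = {c1, c2, x, y}" using cR by auto
    have "x \<in> ?R - {c1, c2}" "y \<in> ?R - {c1, c2}" unfolding xy(1) by auto
    then have d: "distinct [v, w, c1, c2, x, y]" using 2 c cR xy(2) by auto
    have S4: "S_rt {c1, c2, x, y} = 4" using R(1) unfolding Req .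
    have "distinct [c1, c2, x, y]" using d by simp
    from S_rt_four[OF this] S4 have "tri c1 c2 x"
      by (cases "tri c1 c2 x") (auto simp: of_bool_def split: if_splits)
    then have "good 6 {v, w, c1, c2, x, y}"
      using d ct(1,2) S4 by (intro good6_double) simp_all
    moreover have "{v, w, c1, c2, x, y} = P" using Req 2 by blast
    ultimately show ?thesis by simp
  qed
qed

lemma bounded6: "bounded_by 6 11"
  using bounded_by_rich[of 5 6 8] rich6 bounded5 by (simp add: ub_def)

text \<open>The Booleans stand for the triples of \<open>c1\<close>, \<open>c2\<close>,
  \<open>a1\<close>, \<open>a2\<close>, \<open>a3\<close>: \<open>p\<close> for those with both
  \<open>c1\<close> and \<open>c2\<close>, \<open>q\<close> and \<open>r\<close> for those with
  exactly one of them, \<open>s\<close> for the last one. Two triples fail, and each lies in at most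
  two of the three quadruples formed by \<open>c1\<close>, \<open>c2\<close> and two of the others.
  So some quadruple misses at most one triangle, and then one of its two \<open>p\<close> triples is
  a triangle.\<close>

lemma ten_bools:
  assumes "of_bool p1 + of_bool p2 + of_bool p3 + of_bool q1 + of_bool q2 + of_bool q3 +
    of_bool r1 + of_bool r2 + of_bool r3 + of_bool s = (8::nat)"
  shows "(p1 \<or> p2) \<and> 3 \<le> of_bool p1 + of_bool p2 + of_bool q1 + (of_bool r1 :: nat) \<or>
    (p1 \<or> p3) \<and> 3 \<le> of_bool p1 + of_bool p3 + of_bool q2 + (of_bool r2 :: nat) \<or>
    (p2 \<or> p3) \<and> 3 \<le> of_bool p2 + of_bool p3 + of_bool q3 + (of_bool r3 :: nat)"
proof (rule ccontr)
  assume n: "\<not> ?thesis"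
  have "of_bool q1 \<le> (1::nat)" "of_bool q2 \<le> (1::nat)" "of_bool q3 \<le> (1::nat)"
    "of_bool r1 \<le> (1::nat)" "of_bool r2 \<le> (1::nat)" "of_bool r3 \<le> (1::nat)" "of_bool s \<le> (1::nat)"
    by simp_all
  then show False using assms n by (cases p1; cases p2; cases p3) (simp_all; linarith)+
qed

text \<open>The exceptional sets consist of five points with eight triangles and a pair lying in
  just one triangle. They are not claimed to be on a chain; the two points of degree one limit what
  can be built on them.\<close>

lemma rich7:
  assumes P: "finite P" "card P = 7" "9 \<le> S_rt P" "noiso P"
  shows "good 7 P \<or> S_rt P \<le> 9 \<and> (\<exists>v\<in>P. \<exists>w\<in>P. v \<noteq> w \<and> deg P v = 1 \<and> deg P w = 1)"
proof -
  have k: "card P = Suc 6" using P by simp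
  from P(1) k P(4) show ?thesis
  proof (cases rule: removal_cases)
    case (1 v)
    have "6 \<le> S_rt (P - {v})" using 1(7) P(3) by simp
    then have "good 6 (P - {v})" using rich6 1 by (auto simp: rich_def)
    then have "good (Suc 6) P" using 1 P(3) by (intro good_remove[of 6 P v]) (auto simp: th_def)
    then show ?thesis by simp
  next
    case (2 v w)
    let ?R = "P - {v, w}"
    have R7: "7 \<le> S_rt ?R" "card ?R = 5" using 2 P(3) by auto
    have "noiso ?R"
    proof (rule ccontr)
      assume "\<not> noiso ?R"
      then obtain x where "x \<in> ?R" "S_rt ?R = S_rt (?R - {x})" using iso_S_rt 2 by blast
      moreover have "S_rt (?R - {x}) \<le> 4" using bounded4 R7 2 \<open>x \<in> ?R\<close> by (simp add: bounded_by_def)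
      ultimately show False using R7 by simp
    qed
    then have "good 5 ?R" using rich5 R7 2 by (auto simp: rich_def)
    then have "final 5 ?R" by (rule goodD)
    \<comment> \<open>Seven triangles on five points are excluded by \<open>final\<close>.\<close>
    then have R8: "S_rt ?R = 8" using R7 by (auto simp: final_def ub_def)
    show ?thesis
    proof (cases "deg P v = 1")
      case True
      then show ?thesis using 2 R8 by auto
    next
      case False
      then have "card {y \<in> P. tri v w y} = 2" using 2 by simp
      then obtain c1 c2 where c: "{y \<in> P. tri v w y} = {c1, c2}" "c1 \<noteq> c2" by (auto simp: card_2_iff)
      then have ct: "tri v w c1" "tri v w c2" "c1 \<in> P" "c2 \<in> P" by auto
      then have cR: "c1 \<in> ?R" "c2 \<in> ?R" using tri_distinct by blast+
      have "card (?R - {c1, c2}) = 3" using R7 cR c by (simp add: card_Diff_subset)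
      then obtain a1 a2 a3 where a: "?R - {c1, c2} = {a1, a2, a3}" "a1 \<noteq> a2" "a1 \<noteq> a3" "a2 \<noteq> a3"
        unfolding card_3_iff by blast
      then have Req: "?R = {c1, c2, a1, a2, a3}" using cR by auto
      have aR: "a1 \<in> ?R - {c1, c2}" "a2 \<in> ?R - {c1, c2}" "a3 \<in> ?R - {c1, c2}" unfolding a(1) by auto
      then have d: "distinct [c1, c2, a1, a2, a3]" "distinct [v, w, c1, c2]" using a c cR 2 by auto
      have P_eq: "P = {v, w, c1, c2, a1, a2, a3}" using Req 2 by blast
      \<comment> \<open>The first six points are on a chain by \<open>good6_double\<close>, which is
        content with the lowered threshold 5; \<open>z\<close> comes last, whatever its degree, as
        long as it is positive.\<close>
      have fin: "good 7 P" if "distinct [v, w, c1, c2, x, y, z]" "P = {v, w, c1, c2, x, y, z}"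
        "tri c1 c2 x" "3 \<le> S_rt {c1, c2, x, y}" for x y z
      proof -
        have "good 6 {v, w, c1, c2, x, y}" using that ct by (intro good6_double) auto
        moreover have "P - {z} = {v, w, c1, c2, x, y}" using that(1) unfolding that(2) by auto
        ultimately have "good 6 (P - {z})" by simp
        moreover have "z \<in> P" using that(2) by simp
        ultimately have "good (Suc 6) P"
          using P by (intro good_remove[of 6 P z]) (auto simp: th_def noiso_def)
        then show ?thesis by simp
      qed
      have "\<exists>x y z. distinct [v, w, c1, c2, x, y, z] \<and> {x, y, z} = {a1, a2, a3} \<and>
          tri c1 c2 x \<and> 3 \<le> S_rt {c1, c2, x, y}"
      proof -
        have vw: "v \<notin> set [a1, a2, a3]" "w \<notin> set [a1, a2, a3]" using aR by auto
        have four: "S_rt {c1, c2, a1, a2} = of_bool (tri c1 c2 a1) + of_bool (tri c1 c2 a2) + of_bool (tri c1 a1 a2) + of_bool (tri c2 a1 a2)"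
          "S_rt {c1, c2, a1, a3} = of_bool (tri c1 c2 a1) + of_bool (tri c1 c2 a3) + of_bool (tri c1 a1 a3) + of_bool (tri c2 a1 a3)"
          "S_rt {c1, c2, a2, a3} = of_bool (tri c1 c2 a2) + of_bool (tri c1 c2 a3) + of_bool (tri c1 a2 a3) + of_bool (tri c2 a2 a3)"
          using d by (simp_all add: S_rt_four)
        have comm: "{c1, c2, y, x} = {c1, c2, x, y}" for x y by auto
        have "(tri c1 c2 a1 \<or> tri c1 c2 a2) \<and> 3 \<le> S_rt {c1, c2, a1, a2} \<or>
          (tri c1 c2 a1 \<or> tri c1 c2 a3) \<and> 3 \<le> S_rt {c1, c2, a1, a3} \<or>
          (tri c1 c2 a2 \<or> tri c1 c2 a3) \<and> 3 \<le> S_rt {c1, c2, a2, a3}"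
          unfolding four using R8 S_rt_five[OF d(1)] unfolding Req by (intro ten_bools) simp
        then consider "tri c1 c2 a1" "3 \<le> S_rt {c1, c2, a1, a2}" | "tri c1 c2 a2" "3 \<le> S_rt {c1, c2, a2, a1}"
          | "tri c1 c2 a1" "3 \<le> S_rt {c1, c2, a1, a3}" | "tri c1 c2 a3" "3 \<le> S_rt {c1, c2, a3, a1}"
          | "tri c1 c2 a2" "3 \<le> S_rt {c1, c2, a2, a3}" | "tri c1 c2 a3" "3 \<le> S_rt {c1, c2, a3, a2}"
          by (metis comm)
        then show ?thesis
        proof cases
          case 1 then show ?thesis using d vw by (intro exI[of _ a1] exI[of _ a2] exI[of _ a3]) auto
        next
          case 2 then show ?thesis using d vw by (intro exI[of _ a2] exI[of _ a1] exI[of _ a3]) auto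
        next
          case 3 then show ?thesis using d vw by (intro exI[of _ a1] exI[of _ a3] exI[of _ a2]) auto
        next
          case 4 then show ?thesis using d vw by (intro exI[of _ a3] exI[of _ a1] exI[of _ a2]) auto
        next
          case 5 then show ?thesis using d vw by (intro exI[of _ a2] exI[of _ a3] exI[of _ a1]) auto
        next
          case 6 then show ?thesis using d vw by (intro exI[of _ a3] exI[of _ a2] exI[of _ a1]) auto
        qed
      qed
      then obtain x y z where xyz: "distinct [v, w, c1, c2, x, y, z]" "{x, y, z} = {a1, a2, a3}"
          "tri c1 c2 x" "3 \<le> S_rt {c1, c2, x, y}" by blast
      have "P = {v, w, c1, c2, x, y, z}" unfolding P_eq using xyz(2) by auto
      then show ?thesis using fin xyz by blast
    qed
  qed
qed

lemma bounded7: "bounded_by 7 15"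
  unfolding bounded_by_def
proof (intro allI impI)
  fix P :: "point set" assume P: "finite P" "card P = 7"
  consider "S_rt P < 9" | "9 \<le> S_rt P" "noiso P" | "\<not> noiso P" by linarith
  then show "S_rt P \<le> 15"
  proof cases
    case 2
    then consider "good 7 P" | "S_rt P \<le> 9" using rich7 P by blast
    then show ?thesis by cases (auto dest: goodD(3) simp: final_def ub_def)
  next
    case 3
    then obtain w where "w \<in> P" "S_rt P = S_rt (P - {w})" using iso_S_rt P by blast
    moreover have "S_rt (P - {w}) \<le> 11" using bounded6 P \<open>w \<in> P\<close> by (simp add: bounded_by_def)
    ultimately show ?thesis by simp
  qed simp
qed

text \<open>On an exceptional seven-point set with at most nine triangles and two points of degree
  one, a new minimum-degree point gains at most \<open>1 + 1 + 1\<close> and misses 13. The new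
  exception is a six-point set with eleven triangles plus a pair that shares two triangles.\<close>

lemma rich8:
  assumes P: "finite P" "card P = 8" "13 \<le> S_rt P" "noiso P"
  shows "good 8 P \<or> S_rt P \<le> 13 \<and> (\<exists>v\<in>P. \<exists>w\<in>P. v \<noteq> w \<and> deg P v = 2 \<and> deg P w = 2)"
proof -
  have k: "card P = Suc 7" using P by simp
  from P(1) k P(4) show ?thesis
  proof (cases rule: removal_cases)
    case (1 v)
    let ?Q = "P - {v}"
    have "9 \<le> S_rt ?Q" using 1(7) P(3) by simp
    then consider "good 7 ?Q" | "S_rt ?Q \<le> 9" "\<exists>a\<in>?Q. \<exists>b\<in>?Q. a \<noteq> b \<and> deg ?Q a = 1 \<and> deg ?Q b = 1"
      using rich7[of ?Q] 1 by blast
    then show ?thesis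
    proof cases
      case 1
      then have "good (Suc 7) P" using \<open>v \<in> P\<close> \<open>\<forall>w\<in>P. deg P v \<le> deg P w\<close> \<open>0 < deg P v\<close> P(3)
        by (intro good_remove[of 7 P v]) (auto simp: th_def)
      then show ?thesis by simp
    next
      case 2
      then obtain a b where ab: "a \<in> ?Q" "b \<in> ?Q" "a \<noteq> b" "deg ?Q a = 1" "deg ?Q b = 1" by blast
      have ins: "insert v ?Q = P" using 1 by auto
      have "deg P v \<le> deg ?Q a + deg ?Q b + 1"
        using min_deg_le_two_degs[of ?Q v a b] ab 1 unfolding ins by blast
      then show ?thesis using ab 1 2 P(3) by simp
    qed
  next
    case (2 v w)
    let ?R = "P - {v, w}"
    have "S_rt ?R \<le> 11" using bounded6 2 by (simp add: bounded_by_def)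
    then have "deg P v = 2" "deg P w = 2" "S_rt P \<le> 13" using 2 P(3) by auto
    then show ?thesis using 2 by blast
  qed
qed

lemma bounded8: "bounded_by 8 20"
  unfolding bounded_by_def
proof (intro allI impI)
  fix P :: "point set" assume P: "finite P" "card P = 8"
  consider "S_rt P < 13" | "13 \<le> S_rt P" "noiso P" | "\<not> noiso P" by linarith
  then show "S_rt P \<le> 20"
  proof cases
    case 2
    then consider "good 8 P" | "S_rt P \<le> 13" using rich8 P by blast
    then show ?thesis by cases (auto dest: goodD(3) simp: final_def ub_def)
  next
    case 3
    then obtain w where "w \<in> P" "S_rt P = S_rt (P - {w})" using iso_S_rt P by blast
    moreover have "S_rt (P - {w}) \<le> 15" using bounded7 P \<open>w \<in> P\<close> by (simp add: bounded_by_def)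
    ultimately show ?thesis by simp
  qed simp
qed

text \<open>The exceptions die out here. A new minimum-degree point on an exceptional eight-point
  set gains at most \<open>2 + 2 + 1\<close>, giving at most 18; a pair sharing all its triangles
  gives at most \<open>15 + 2\<close>.\<close>

lemma rich9: "rich 9 19"
  unfolding rich_def
proof (intro allI impI)
  fix P assume P: "finite P" "card P = 9" "19 \<le> S_rt P" "noiso P"
  have k: "card P = Suc 8" using P by simp
  from P(1) k P(4) show "good 9 P"
  proof (cases rule: removal_cases)
    case (1 v)
    let ?Q = "P - {v}"
    have "13 \<le> S_rt ?Q" using 1(7) P(3) by simp
    then consider "good 8 ?Q" | "S_rt ?Q \<le> 13" "\<exists>a\<in>?Q. \<exists>b\<in>?Q. a \<noteq> b \<and> deg ?Q a = 2 \<and> deg ?Q b = 2"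
      using rich8[of ?Q] 1 by blast
    then show ?thesis
    proof cases
      case 1
      then have "good (Suc 8) P" using \<open>v \<in> P\<close> \<open>\<forall>w\<in>P. deg P v \<le> deg P w\<close> \<open>0 < deg P v\<close> P(3)
        by (intro good_remove[of 8 P v]) (auto simp: th_def)
      then show ?thesis by simp
    next
      case 2
      then obtain a b where ab: "a \<in> ?Q" "b \<in> ?Q" "a \<noteq> b" "deg ?Q a = 2" "deg ?Q b = 2" by blast
      have ins: "insert v ?Q = P" using 1 by auto
      have "deg P v \<le> deg ?Q a + deg ?Q b + 1"
        using min_deg_le_two_degs[of ?Q v a b] ab 1 unfolding ins by blast
      then show ?thesis using ab 1 2 P(3) by simp
    qed
  next
    case (2 v w)
    let ?R = "P - {v, w}"
    have "S_rt ?R \<le> 15" using bounded7 2 by (simp add: bounded_by_def)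
    then show ?thesis using 2 P(3) by auto
  qed
qed

lemma bounded9: "bounded_by 9 28"
  using bounded_by_rich[of 8 19 20] rich9 bounded8 by (simp add: ub_def)

text \<open>From here on \<open>rich_step\<close> applies, with the bound for two points fewer in
  the role of \<open>b\<close>; richness and bounds are therefore obtained alternately.\<close>

lemma rich10: "rich 10 26" using rich_step[of 9 20] rich9 bounded8 by (simp add: th_def)
lemma bounded10: "bounded_by 10 35" using bounded_by_rich[of 9 26 28] rich10 bounded9 by (simp add: ub_def)
lemma rich11: "rich 11 35" using rich_step[of 10 28] rich10 bounded9 by (simp add: th_def)
lemma bounded11: "bounded_by 11 43" using bounded_by_rich[of 10 35 35] rich11 bounded10 by (simp add: ub_def)
lemma rich12: "rich 12 46" using rich_step[of 11 35] rich11 bounded10 by (simp add: th_def)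
lemma bounded12: "bounded_by 12 52" using bounded_by_rich[of 11 46 43] rich12 bounded11 by (simp add: ub_def)
lemma rich13: "rich 13 59" using rich_step[of 12 43] rich12 bounded11 by (simp add: th_def)
lemma bounded13: "bounded_by 13 64" using bounded_by_rich[of 12 59 52] rich13 bounded12 by (simp add: ub_def)
lemma rich14: "rich 14 74" using rich_step[of 13 52] rich13 bounded12 by (simp add: th_def)
lemma bounded14: "bounded_by 14 74" using bounded_by_rich[of 13 74 64] rich14 bounded13 by (simp add: ub_def)

lemma rich_upto: "k \<in> {10..14} \<Longrightarrow> rich k (th k) \<and> bounded_by (k - 1) (ub (k - 1)) \<and> bounded_by k (ub k)"
  using rich10 rich11 rich12 rich13 rich14 bounded9 bounded10 bounded11 bounded12 bounded13 bounded14
  by (auto simp: atLeastAtMost_insertL[symmetric] th_def ub_def numeral_eq_Suc atLeastAtMostSuc_conv)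

lemma max_similar:
  assumes "k \<in> {10..14}" "n_point_set k P" "ub k \<le> S_rt P"
  shows "\<exists>E\<in>extremal k. similar P E"
proof -
  have k: "k = 10 \<or> k = 11 \<or> k = 12 \<or> k = 13 \<or> k = 14" using assms(1) by auto
  then have num: "th k \<le> ub k" "ub (k - 1) < ub k" by (auto simp: th_def ub_def)
  have P: "finite P" "card P = k" using assms(2) by (auto simp: n_point_set_def)
  \<comment> \<open>A point in no triangle could be deleted without loss, against
    \<open>ub (k - 1) < ub k\<close>.\<close>
  have "noiso P"
  proof (rule ccontr)
    assume "\<not> noiso P"
    then obtain w where "w \<in> P" "S_rt P = S_rt (P - {w})" using iso_S_rt P by blast
    moreover have "S_rt (P - {w}) \<le> ub (k - 1)"
      using rich_upto[OF assms(1)] P \<open>w \<in> P\<close> by (simp add: bounded_by_def)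
    ultimately show False using num assms(3) by simp
  qed
  then have "good k P" using rich_upto[OF assms(1)] P num assms(3) by (auto simp: rich_def)
  moreover have "S_rt P = ub k" using rich_upto[OF assms(1)] P assms(3) by (simp add: bounded_by_def le_antisym)
  ultimately obtain E f where "E \<in> extremal k" and f: "bsim f" "f ` E = P"
    using goodD(3) assms(1) unfolding final_def by fastforce
  moreover have "similarity (inv f)" "inv f ` P = E"
    using f bsim_inv[OF f(1)] inv_image[of f E] by (auto simp: bsim_def)
  ultimately show ?thesis by (auto simp: similar_def)
qed

lemma S_rt_le_ub: "k \<in> {10..14} \<Longrightarrow> n_point_set k P \<Longrightarrow> S_rt P \<le> ub k"
  using rich_upto by (auto simp: bounded_by_def n_point_set_def)

end

subsection \<open>Words, tries and the search step\<close>

text \<open>Words with the least significant bit first. The operations below are two's complement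
  arithmetic modulo \<open>2 ^ n\<close>, where \<open>n\<close> is the common length of the
  words.\<close>

datatype bits = End | B0 bits | B1 bits

fun badd :: "bits \<Rightarrow> bits \<Rightarrow> bits" and badd1 :: "bits \<Rightarrow> bits \<Rightarrow> bits" where
  "badd (B0 x) (B0 y) = B0 (badd x y)"
| "badd (B0 x) (B1 y) = B1 (badd x y)"
| "badd (B1 x) (B0 y) = B1 (badd x y)"
| "badd (B1 x) (B1 y) = B0 (badd1 x y)"
| "badd End y = End"
| "badd (B0 x) End = End"
| "badd (B1 x) End = End"
| "badd1 (B0 x) (B0 y) = B1 (badd x y)"
| "badd1 (B0 x) (B1 y) = B0 (badd1 x y)"
| "badd1 (B1 x) (B0 y) = B0 (badd1 x y)"
| "badd1 (B1 x) (B1 y) = B1 (badd1 x y)"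
| "badd1 End y = End"
| "badd1 (B0 x) End = End"
| "badd1 (B1 x) End = End"

primrec bcompl :: "bits \<Rightarrow> bits" where
  "bcompl End = End" | "bcompl (B0 x) = B1 (bcompl x)" | "bcompl (B1 x) = B0 (bcompl x)"

primrec bneg :: "bits \<Rightarrow> bits" where
  "bneg End = End" | "bneg (B0 x) = B0 (bneg x)" | "bneg (B1 x) = B1 (bcompl x)"

text \<open>Repeats the top bit, so that a word shortened by dropping its low bit regains its length
  and keeps its sign.\<close>

fun bsext :: "bits \<Rightarrow> bits" where
  "bsext End = End"
| "bsext (B0 End) = B0 (B0 End)"
| "bsext (B1 End) = B1 (B1 End)"
| "bsext (B0 (B0 x)) = B0 (bsext (B0 x))"
| "bsext (B0 (B1 x)) = B0 (bsext (B1 x))"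
| "bsext (B1 (B0 x)) = B1 (bsext (B0 x))"
| "bsext (B1 (B1 x)) = B1 (bsext (B1 x))"

primrec bhalf :: "bits \<Rightarrow> bits" where
  "bhalf End = End" | "bhalf (B0 x) = bsext x" | "bhalf (B1 x) = bsext x"

primrec beven :: "bits \<Rightarrow> bool" where
  "beven End = False" | "beven (B0 x) = True" | "beven (B1 x) = False"

text \<open>The count at a node belongs to the word that leads to it. A pair of coordinates is
  looked up by following the first word and then the second, without concatenating them.\<close>

datatype trie = Lf | Nd nat trie trie

fun bump :: "bits \<Rightarrow> trie \<Rightarrow> trie" where
  "bump End Lf = Nd (Suc 0) Lf Lf"
| "bump (B0 k) Lf = Nd 0 (bump k Lf) Lf"
| "bump (B1 k) Lf = Nd 0 Lf (bump k Lf)"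
| "bump End (Nd c l r) = Nd (Suc c) l r"
| "bump (B0 k) (Nd c l r) = Nd c (bump k l) r"
| "bump (B1 k) (Nd c l r) = Nd c l (bump k r)"

fun bump2 :: "bits \<Rightarrow> bits \<Rightarrow> trie \<Rightarrow> trie" where
  "bump2 End y t = bump y t"
| "bump2 (B0 k) y Lf = Nd 0 (bump2 k y Lf) Lf"
| "bump2 (B1 k) y Lf = Nd 0 Lf (bump2 k y Lf)"
| "bump2 (B0 k) y (Nd c l r) = Nd c (bump2 k y l) r"
| "bump2 (B1 k) y (Nd c l r) = Nd c l (bump2 k y r)"

fun look :: "bits \<Rightarrow> trie \<Rightarrow> nat" where
  "look k Lf = 0"
| "look End (Nd c l r) = c"
| "look (B0 k) (Nd c l r) = look k l"
| "look (B1 k) (Nd c l r) = look k r"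

fun look2 :: "bits \<Rightarrow> bits \<Rightarrow> trie \<Rightarrow> nat" where
  "look2 x y Lf = 0"
| "look2 End y (Nd c l r) = look y (Nd c l r)"
| "look2 (B0 k) y (Nd c l r) = look2 k y l"
| "look2 (B1 k) y (Nd c l r) = look2 k y r"

fun bumps :: "(bits \<times> bits) list \<Rightarrow> trie \<Rightarrow> trie" where
  "bumps [] t = t"
| "bumps ((x, y) # ks) t = bumps ks (bump2 x y t)"

primrec brev :: "bits \<Rightarrow> bits \<Rightarrow> bits" where
  "brev End q = q" | "brev (B0 p) q = brev p (B0 q)" | "brev (B1 p) q = brev p (B1 q)"

text \<open>Collected paths have their last bit first. Reading seven bits back gives the second
  coordinate, reversing what remains gives the first.\<close>

fun split_path :: "nat \<Rightarrow> bits \<Rightarrow> bits \<Rightarrow> bits \<times> bits" where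
  "split_path 0 p q = (brev p End, q)"
| "split_path (Suc n) End q = (End, q)"
| "split_path (Suc n) (B0 p) q = split_path n p (B0 q)"
| "split_path (Suc n) (B1 p) q = split_path n p (B1 q)"

text \<open>Here and in the functions below a test is an argument that is matched against
  \<open>True\<close> and \<open>False\<close>. Rewriting works on the arguments first, so a branch
  unfolds only after its test has been decided.\<close>

fun cons_if :: "bool \<Rightarrow> 'a \<Rightarrow> 'a list \<Rightarrow> 'a list" where
  "cons_if True p ps = p # ps"
| "cons_if False p ps = ps"

primrec heavy_paths :: "nat \<Rightarrow> trie \<Rightarrow> bits \<Rightarrow> bits list \<Rightarrow> bits list" where
  "heavy_paths r Lf p acc = acc"
| "heavy_paths r (Nd c l t) p acc =
     heavy_paths r l (B0 p) (heavy_paths r t (B1 p) (cons_if (r \<le> c) p acc))"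

primrec split_paths :: "bits list \<Rightarrow> (bits \<times> bits) list" where
  "split_paths [] = []"
| "split_paths (p # ps) =
     split_path (Suc (Suc (Suc (Suc (Suc (Suc (Suc 0))))))) p End # split_paths ps"

definition heavy :: "nat \<Rightarrow> trie \<Rightarrow> (bits \<times> bits) list" where
  "heavy r t = split_paths (heavy_paths r t End [])"

text \<open>For a stored point \<open>(x, y)\<close> the words of \<open>x\<close>,
  \<open>y\<close>, \<open>-y\<close>, \<open>2x\<close>, \<open>2y\<close>, \<open>-2y\<close>,
  \<open>x + y\<close>, \<open>-x - y\<close>, \<open>x - y\<close>, \<open>y - x\<close>. Computed
  once per point, they leave only two additions for each key of a pair.\<close>

datatype vrec = VR bits bits bits bits bits bits bits bits bits bits

definition mkrec2 :: "bits \<Rightarrow> bits \<Rightarrow> bits \<Rightarrow> bits \<Rightarrow> vrec" where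
  "mkrec2 x y nx ny = VR x y ny (badd x x) (badd y y) (badd ny ny)
     (badd x y) (badd nx ny) (badd x ny) (badd y nx)"

definition mkrec :: "bits \<Rightarrow> bits \<Rightarrow> vrec" where
  "mkrec x y = mkrec2 x y (bneg x) (bneg y)"

text \<open>Multiplies by \<open>1 - i\<close>: since \<open>(1 + i) (1 - i) = 2\<close>, the key of
  the stored point becomes twice the coordinates.\<close>

fun node_recs :: "(bits \<times> bits) list \<Rightarrow> vrec list" where
  "node_recs [] = []"
| "node_recs ((x, y) # ps) = mkrec (badd x y) (badd y (bneg x)) # node_recs ps"

text \<open>The completions of a pair: the four outer corners of the squares on its two sides, then
  the two centres. For stored points \<open>c\<close> and \<open>d\<close> the centres have the keys
  \<open>c + i d\<close> and \<open>d + i c\<close>.\<close>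

fun pair_keys :: "vrec \<Rightarrow> vrec list \<Rightarrow> (bits \<times> bits) list" where
  "pair_keys r [] = []"
| "pair_keys (VR x y ny dx dy ndy s ns d nd) (VR x' y' ny' dx' dy' ndy' s' ns' d' nd' # rs) =
     (badd dx ns', badd dy d') # (badd ndy s', badd dx nd') # (badd ns dx', badd d dy') #
     (badd s ndy', badd nd dx') # (badd x ny', badd y x') # (badd ny x', badd x y') #
     pair_keys (VR x y ny dx dy ndy s ns d nd) rs"

text \<open>At the key of a point outside the set, the count is the degree that the point would have
  after its insertion.\<close>

primrec degree_trie :: "vrec list \<Rightarrow> trie" where
  "degree_trie [] = Lf"
| "degree_trie (r # rs) = bumps (pair_keys r rs) (degree_trie rs)"

fun bump_key :: "vrec \<Rightarrow> trie \<Rightarrow> trie" where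
  "bump_key (VR x y ny dx dy ndy s ns d nd) t = bump2 d s t"

fun bump_dkey :: "vrec \<Rightarrow> trie \<Rightarrow> trie" where
  "bump_dkey (VR x y ny dx dy ndy s ns d nd) t = bump2 (badd d d) (badd s s) t"

primrec key_trie :: "vrec list \<Rightarrow> trie" where
  "key_trie [] = Lf"
| "key_trie (r # rs) = bump_key r (key_trie rs)"

text \<open>If the right angle of a triangle is at an old point \<open>d\<close>, the other two
  vertices determine twice the key of \<open>d\<close> without a division; hence a second trie with
  doubled keys.\<close>

primrec dkey_trie :: "vrec list \<Rightarrow> trie" where
  "dkey_trie [] = Lf"
| "dkey_trie (r # rs) = bump_dkey r (dkey_trie rs)"

datatype ukey = UK bits bits bits bits bits bits bits

definition mkukey2 :: "bits \<Rightarrow> bits \<Rightarrow> bits \<Rightarrow> bits \<Rightarrow> ukey" where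
  "mkukey2 x y nx ny = UK x y nx ny (badd x y) (badd y nx) (badd x ny)"

definition mkukey :: "bits \<Rightarrow> bits \<Rightarrow> ukey" where
  "mkukey x y = mkukey2 x y (bneg x) (bneg y)"

text \<open>Looks up the six possible third vertices of a triangle through an old and a new point.
  As words wrap around, the sum may be too large but never too small, which is the safe direction
  for refuting minimality.\<close>

fun codeg_bound :: "vrec \<Rightarrow> ukey \<Rightarrow> trie \<Rightarrow> trie \<Rightarrow> nat" where
  "codeg_bound (VR x y ny dx dy ndy s ns d nd) (UK a b na nb p q m) t1 t2 =
     look2 (badd ndy b) (badd dx na) t1 + (look2 (badd dx nb) (badd dy a) t1 +
     (look2 (badd ns p) (badd d q) t1 + (look2 (badd s m) (badd nd p) t1 +
     (look2 (badd dx m) (badd dy p) t2 + look2 (badd ndy p) (badd dx q) t2))))"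

fun look_key :: "vrec \<Rightarrow> trie \<Rightarrow> nat" where
  "look_key (VR x y ny dx dy ndy s ns d nd) t = look2 d s t"

fun small_deg :: "bool \<Rightarrow> vrec \<Rightarrow> ukey \<Rightarrow> nat \<Rightarrow> trie \<Rightarrow> trie \<Rightarrow> trie \<Rightarrow> bool" where
  "small_deg False q u n t t1 t2 = False"
| "small_deg True q u n t t1 t2 = (Suc (look_key q t + codeg_bound q u t1 t2) \<le> n)"

text \<open>Searches for an old point whose degree stays below \<open>n\<close> even after the
  insertion of \<open>u\<close>. Only if its degree before the insertion is already below
  \<open>n\<close> is the codegree computed.\<close>

fun not_min :: "bool \<Rightarrow> vrec list \<Rightarrow> ukey \<Rightarrow> nat \<Rightarrow> trie \<Rightarrow> trie \<Rightarrow> trie \<Rightarrow> bool" where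
  "not_min True qs u n t t1 t2 = True"
| "not_min False [] u n t t1 t2 = False"
| "not_min False (q # qs) u n t t1 t2 =
     not_min (small_deg (Suc (look_key q t) \<le> n) q u n t t1 t2) qs u n t t1 t2"

fun excluded2 :: "bool \<Rightarrow> bits \<Rightarrow> bits \<Rightarrow> vrec list \<Rightarrow> trie \<Rightarrow> trie \<Rightarrow> trie \<Rightarrow> bool" where
  "excluded2 True x y rs t t1 t2 = True"
| "excluded2 False x y rs t t1 t2 = not_min False rs (mkukey x y) (look2 x y t) t t1 t2"

fun excluded1 :: "bool \<Rightarrow> bits \<Rightarrow> bits \<Rightarrow> vrec list \<Rightarrow> trie \<Rightarrow> trie \<Rightarrow> trie \<Rightarrow> bool" where
  "excluded1 False x y rs t t1 t2 = True"
| "excluded1 True x y rs t t1 t2 = excluded2 (Suc 0 \<le> look2 x y t1) x y rs t t1 t2"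

fun no_ext :: "bool \<Rightarrow> (bits \<times> bits) list \<Rightarrow> nat \<Rightarrow> vrec list \<Rightarrow> trie \<Rightarrow> trie \<Rightarrow> trie \<Rightarrow> bool" where
  "no_ext False gs r rs t t1 t2 = False"
| "no_ext True [] r rs t t1 t2 = True"
| "no_ext True ((x, y) # gs) r rs t t1 t2 =
     no_ext (excluded1 (r \<le> look2 x y t) x y rs t t1 t2) gs r rs t t1 t2"

section \<open>Certificate entries and the similarities that they apply to encoded point
  lists\<close>

datatype disp = DP | DR | DS | DM bool bool bool bool bits bits

fun turn :: "(bits \<times> bits) list \<Rightarrow> (bits \<times> bits) list" where
  "turn [] = []"
| "turn ((x, y) # ps) = (badd x (bneg y), badd x y) # turn ps"

text \<open>The new point comes with doubled coordinates. If it is not integral but the sum of these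
  coordinates is even, multiplying everything by \<open>1 + i\<close> makes it integral.\<close>

fun add_point :: "bool \<Rightarrow> bits \<Rightarrow> bits \<Rightarrow> (bits \<times> bits) list \<Rightarrow> (bits \<times> bits) list" where
  "add_point True x y ws = (bhalf (badd x (bneg y)), bhalf (badd x y)) # turn ws"
| "add_point False x y ws = (bhalf x, bhalf y) # ws"

fun integral :: "bool \<Rightarrow> bits \<Rightarrow> bits \<Rightarrow> bool" where
  "integral True x y = beven (badd x y)"
| "integral False x y = (beven x \<and> beven y)"

fun bneg_if :: "bool \<Rightarrow> bits \<Rightarrow> bits" where
  "bneg_if True x = bneg x" | "bneg_if False x = x"

fun swap_if :: "bool \<Rightarrow> bits \<times> bits \<Rightarrow> bits \<times> bits" where
  "swap_if True (x, y) = (y, x)" | "swap_if False p = p"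

fun flip_shift :: "bool \<Rightarrow> bool \<Rightarrow> bits \<Rightarrow> bits \<Rightarrow> bits \<times> bits \<Rightarrow> bits \<times> bits" where
  "flip_shift b c tx ty (x, y) = (badd (bneg_if b x) tx, badd (bneg_if c y) ty)"

primrec moves :: "bool \<Rightarrow> bool \<Rightarrow> bool \<Rightarrow> bits \<Rightarrow> bits \<Rightarrow> (bits \<times> bits) list \<Rightarrow> (bits \<times> bits) list" where
  "moves a b c tx ty [] = []"
| "moves a b c tx ty (p # ps) = flip_shift b c tx ty (swap_if a p) # moves a b c tx ty ps"

text \<open>An order on bit patterns, not on integers. Any fixed order would serve, since sorting
  only has to make an enlarged set coincide literally with a stored node.\<close>

fun bless :: "bits \<Rightarrow> bits \<Rightarrow> bool" where
  "bless (B0 x) (B0 y) = bless x y"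
| "bless (B0 x) (B1 y) = True"
| "bless (B1 x) (B0 y) = False"
| "bless (B1 x) (B1 y) = bless x y"
| "bless End y = True"
| "bless (B0 x) End = False"
| "bless (B1 x) End = False"

fun bless2 :: "bits \<Rightarrow> bits \<Rightarrow> bits \<Rightarrow> bits \<Rightarrow> bool" where
  "bless2 (B0 x) (B0 y) a b = bless2 x y a b"
| "bless2 (B0 x) (B1 y) a b = True"
| "bless2 (B1 x) (B0 y) a b = False"
| "bless2 (B1 x) (B1 y) a b = bless2 x y a b"
| "bless2 End y a b = bless a b"
| "bless2 (B0 x) End a b = False"
| "bless2 (B1 x) End a b = False"

fun pinsert :: "bits \<times> bits \<Rightarrow> (bits \<times> bits) list \<Rightarrow> (bits \<times> bits) list" where
  "pinsert p [] = [p]"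
| "pinsert (x, y) ((x', y') # qs) =
    (if bless2 x x' y y' then (x, y) # (x', y') # qs else (x', y') # pinsert (x, y) qs)"

primrec psort :: "(bits \<times> bits) list \<Rightarrow> (bits \<times> bits) list" where
  "psort [] = []" | "psort (p # ps) = pinsert p (psort ps)"

fun enc :: "nat \<Rightarrow> int \<Rightarrow> bits" where
  "enc 0 z = End"
| "enc (Suc n) z = (if even z then B0 (enc n (z div 2)) else B1 (enc n (z div 2)))"

subsection \<open>Meaning of the words and tries\<close>

abbreviation e7 :: "int \<Rightarrow> bits" where "e7 \<equiv> enc 7"

definition encp :: "int \<times> int \<Rightarrow> bits \<times> bits" where
  "encp p = (e7 (fst p), e7 (snd p))"

lemma enc_add_carry: "badd (enc n a) (enc n b) = enc n (a + b) \<and>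
  badd1 (enc n a) (enc n b) = enc n (a + b + 1)"
proof (induction n arbitrary: a b)
  case (Suc n)
  have *: "(a + b) div 2 = a div 2 + b div 2 + (if odd a \<and> odd b then 1 else 0)"
    "(a + b + 1) div 2 = a div 2 + b div 2 + (if odd a \<or> odd b then 1 else 0)" for a b :: int
    by (auto elim!: evenE oddE)
  show ?case
    by (simp add: Suc * algebra_simps)
qed simp

lemmas enc_add = enc_add_carry[THEN conjunct1]

lemma enc_compl: "bcompl (enc n a) = enc n (- a - 1)"
proof (induction n arbitrary: a)
  case (Suc n)
  have "(- a - 1) div 2 = - (a div 2) - 1" by presburger
  then show ?case by (simp add: Suc)
qed simp

lemma enc_neg: "bneg (enc n a) = enc n (- a)"
proof (induction n arbitrary: a)
  case (Suc n)
  have "even a \<Longrightarrow> (- a) div 2 = - (a div 2)" "odd a \<Longrightarrow> (- a) div 2 = - (a div 2) - 1" by presburger+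
  then show ?case by (simp add: Suc enc_compl)
qed simp

lemma enc_eq_imp_dvd: "enc n a = enc n b \<Longrightarrow> 2 ^ n dvd a - b"
proof (induction n arbitrary: a b)
  case (Suc n)
  then have "even a = even b" "enc n (a div 2) = enc n (b div 2)" by (auto split: if_splits)
  with Suc.IH have "2 ^ n dvd a div 2 - b div 2" by blast
  then have "2 * 2 ^ n dvd 2 * (a div 2 - b div 2)" by (rule mult_dvd_mono[OF dvd_refl])
  moreover have "2 * (a div 2 - b div 2) = a - b" using \<open>even a = even b\<close> by presburger
  ultimately show ?case by simp
qed simp

lemma e7_eq: "e7 a = e7 b \<longleftrightarrow> a = b" if "\<bar>a - b\<bar> < 128"
proof
  assume "e7 a = e7 b"
  then have "128 dvd a - b" using enc_eq_imp_dvd[of 7 a b] by simp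
  then obtain k where "a - b = 128 * k" by (auto simp: dvd_def)
  then show "a = b" using that by presburger
qed simp

lemma enc_ext: "- (2 ^ n) \<le> a \<Longrightarrow> a < 2 ^ n \<Longrightarrow> bsext (enc (Suc n) a) = enc (Suc (Suc n)) a"
proof (induction n arbitrary: a)
  case 0
  then have "a = 0 \<or> a = -1" by auto
  then show ?case by auto
next
  case (Suc n)
  have "- (2 ^ n) \<le> a div 2" "a div 2 < 2 ^ n" using Suc.prems by auto
  then have "bsext (enc (Suc n) (a div 2)) = enc (Suc (Suc n)) (a div 2)" by (rule Suc.IH)
  then show ?case
    by (auto split: if_splits)
qed

lemma e7_half: "-64 \<le> a \<Longrightarrow> a < 64 \<Longrightarrow> bhalf (e7 a) = e7 (a div 2)"
proof -
  assume a: "-64 \<le> a" "a < 64"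
  have n: "(7::nat) = Suc (Suc 5)" by simp
  have "bsext (enc (Suc 5) (a div 2)) = enc (Suc (Suc 5)) (a div 2)"
    using a by (intro enc_ext) auto
  then show "bhalf (e7 a) = e7 (a div 2)" unfolding n enc.simps(2)[of "Suc 5" a] by simp
qed

lemma e7_even: "beven (e7 a) = even a"
  by (simp add: eval_nat_numeral)

primrec bapp :: "bits \<Rightarrow> bits \<Rightarrow> bits" where
  "bapp End y = y" | "bapp (B0 x) y = B0 (bapp x y)" | "bapp (B1 x) y = B1 (bapp x y)"

lemma bapp_End: "bapp x End = x"
  by (induction x) auto

lemma look2_bapp: "look2 x y t = look (bapp x y) t"
  by (induction x y t rule: look2.induct) auto

lemma bump2_bapp: "bump2 x y t = bump (bapp x y) t"
  by (induction x y t rule: bump2.induct) auto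

lemma look_bump: "look k (bump k' t) = look k t + of_bool (k = k')"
proof (induction k' t arbitrary: k rule: bump.induct)
  case 1 show ?case by (cases k) simp_all
next
  case (2 k') then show ?case by (cases k) simp_all
next
  case (3 k') then show ?case by (cases k) simp_all
next
  case 4 show ?case by (cases k) simp_all
next
  case (5 k' c l r) then show ?case by (cases k) simp_all
next
  case (6 k' c l r) then show ?case by (cases k) simp_all
qed

text \<open>The first words have equal length, so the concatenated path determines both
  coordinates.\<close>

lemma bapp_enc_eq: "bapp (enc n a) x = bapp (enc n b) y \<longleftrightarrow> enc n a = enc n b \<and> x = y"
  by (induction n arbitrary: a b) auto

definition lookp :: "int \<times> int \<Rightarrow> trie \<Rightarrow> nat" where
  "lookp p t = look2 (e7 (fst p)) (e7 (snd p)) t"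

lemma lookp_bump2: "lookp p (bump2 (e7 a) (e7 b) t) = lookp p t + of_bool (encp p = encp (a, b))"
  by (simp add: lookp_def look2_bapp bump2_bapp look_bump bapp_enc_eq encp_def)

lemma lookp_Lf: "lookp p Lf = 0"
  by (simp add: lookp_def)

lemma lookp_bumps: "lookp p (bumps (map encp ks) t) = lookp p t + count_list (map encp ks) (encp p)"
proof (induction ks arbitrary: t)
  case (Cons k ks)
  have "bumps (map encp (k # ks)) t = bumps (map encp ks) (bump2 (e7 (fst k)) (e7 (snd k)) t)"
    by (simp add: encp_def)
  then show ?case using Cons by (auto simp: lookp_bump2)
qed simp

lemma brev_bapp: "brev (brev p q) r = brev q (bapp p r)"
  by (induction p arbitrary: q r) auto

lemma heavy_paths_subset: "set acc \<subseteq> set (heavy_paths r t p acc)"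
proof (induction t arbitrary: p acc)
  case (Nd c l t)
  have "set acc \<subseteq> set (cons_if (r \<le> c) p acc)" by (cases "r \<le> c") auto
  then show ?case using Nd.IH by simp blast
qed simp

text \<open>\<open>r\<close> must be positive, because a key in an absent branch has count zero and
  is not collected.\<close>

lemma heavy_paths: "0 < r \<Longrightarrow> r \<le> look k t \<Longrightarrow> brev k p \<in> set (heavy_paths r t p acc)"
proof (induction k t arbitrary: p acc rule: look.induct)
  case (2 c l t)
  have "p \<in> set (cons_if (r \<le> c) p acc)" using 2 by simp
  then show ?case using heavy_paths_subset by simp blast
next
  case (3 k c l t)
  then show ?case by simp
next
  case (4 k c l t)
  then have "brev k (B1 p) \<in> set (heavy_paths r t (B1 p) (cons_if (r \<le> c) p acc))" by simp
  then show ?case using heavy_paths_subset by simp blast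
qed simp

primrec blen :: "bits \<Rightarrow> nat" where
  "blen End = 0" | "blen (B0 x) = Suc (blen x)" | "blen (B1 x) = Suc (blen x)"

lemma blen_enc: "blen (enc n a) = n"
  by (induction n arbitrary: a) simp_all

lemma blen_brev: "blen (brev p q) = blen p + blen q"
  by (induction p arbitrary: q) simp_all

lemma brev_append: "brev p (bapp q r) = bapp (brev p q) r"
proof (induction p arbitrary: q)
  case (B0 p) show ?case using B0[of "B0 q"] by simp
next
  case (B1 p) show ?case using B1[of "B1 q"] by simp
qed simp

lemma split_path_bapp: "split_path (blen p) (bapp p q) r = (brev q End, brev p r)"
  by (induction p arbitrary: r) simp_all

lemma split_path_brev: "split_path (blen p) (brev p q) r = (brev q End, bapp p r)"
  using split_path_bapp[of "brev p End" q r] brev_append[of p End q] brev_bapp[of p End r]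
  by (simp add: blen_brev)

lemma split_paths_map: "split_paths ps = map (\<lambda>p. split_path 7 p End) ps"
  by (induction ps) (simp_all add: eval_nat_numeral)

lemma heavy_complete:
  assumes "0 < r" "r \<le> lookp p t"
  shows "encp p \<in> set (heavy r t)"
proof -
  let ?k = "bapp (e7 (fst p)) (e7 (snd p))"
  have "brev ?k End \<in> set (heavy_paths r t End [])"
    using assms by (intro heavy_paths) (simp_all add: lookp_def look2_bapp)
  moreover have "brev (bapp p q) r = brev q (brev p r)" for p q r
    by (induction p arbitrary: r) simp_all
  then have "split_path 7 (brev ?k End) End = (brev (brev (e7 (fst p)) End) End, bapp (e7 (snd p)) End)"
    using split_path_brev[of "e7 (snd p)"] by (simp add: blen_enc)
  then have "split_path 7 (brev ?k End) End = encp p"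
    by (simp only: brev_bapp brev.simps bapp_End encp_def)
  ultimately show ?thesis unfolding heavy_def split_paths_map by (metis image_eqI image_set)
qed

subsection \<open>Keys of candidate points\<close>

text \<open>A point at location z / 2 with z = (1 + i) c is stored as c, so that the midpoints needed for
  the keys (twice the locations) of the apexes over two such points stay integral.\<close>

definition zk :: "int \<times> int \<Rightarrow> int \<times> int" where
  "zk c = (fst c + - snd c, fst c + snd c)"

definition hl :: "int \<times> int \<Rightarrow> point" where
  "hl k = (of_int (fst k) / 2, of_int (snd k) / 2)"

definition loc :: "int \<times> int \<Rightarrow> point" where
  "loc c = hl (zk c)"

definition kc :: "int \<times> int \<Rightarrow> int \<times> int \<Rightarrow> (int \<times> int) list" where
  "kc c d = (case c of (x, y) \<Rightarrow> case d of (x', y') \<Rightarrow>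
     [(x + x + (- x' + - y'), y + y + (x' + - y')), (- y + - y + (x' + y'), x + x + (y' + - x')),
      (- x + - y + (x' + x'), x + - y + (y' + y')), (x + y + (- y' + - y'), y + - x + (x' + x')),
      (x + - y', y + x'), (- y + x', x + y')])"

primrec allk :: "(int \<times> int) list \<Rightarrow> (int \<times> int) list" where
  "allk [] = []"
| "allk (c # cs) = concat (map (kc c) cs) @ allk cs"

definition vr :: "int \<times> int \<Rightarrow> vrec" where
  "vr c = (case c of (x, y) \<Rightarrow> VR (e7 x) (e7 y) (e7 (- y)) (e7 (x + x)) (e7 (y + y)) (e7 (- y + - y))
     (e7 (x + y)) (e7 (- x + - y)) (e7 (x + - y)) (e7 (y + - x)))"

definition cof :: "int \<times> int \<Rightarrow> int \<times> int" where
  "cof p = (fst p + snd p, snd p + - fst p)"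

lemma mkrec_enc: "mkrec (e7 x) (e7 y) = vr (x, y)"
  by (simp add: mkrec_def mkrec2_def vr_def enc_add enc_neg)

lemma node_recs_enc: "node_recs (map encp ps) = map vr (map cof ps)"
  by (induction ps) (simp_all add: encp_def cof_def mkrec_enc enc_add enc_neg)

lemma pair_keys_enc: "pair_keys (vr c) (map vr cs) = map encp (concat (map (kc c) cs))"
proof (induction cs)
  case (Cons d cs)
  then show ?case
    by (cases c; cases d) (simp add: vr_def kc_def encp_def enc_add)
qed simp

lemma lookp_degree_trie: "lookp p (degree_trie (map vr cs)) = count_list (map encp (allk cs)) (encp p)"
  by (induction cs) (simp_all add: lookp_Lf pair_keys_enc lookp_bumps del: map_concat)

lemma bump_key_enc: "lookp p (bump_key (vr c) t) = lookp p t + of_bool (encp p = encp (zk c))"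
  by (cases c) (simp add: vr_def lookp_bump2 zk_def)

lemma bump_dkey_enc: "lookp p (bump_dkey (vr c) t) = lookp p t + of_bool (encp p = encp (zk c + zk c))"
  by (cases c) (simp add: vr_def lookp_bump2 zk_def enc_add)

definition kmem :: "trie \<Rightarrow> (int \<times> int) list \<Rightarrow> bool" where
  "kmem t cs \<longleftrightarrow> (\<forall>p. lookp p t = count_list (map (\<lambda>c. encp (zk c)) cs) (encp p))"

definition dkmem :: "trie \<Rightarrow> (int \<times> int) list \<Rightarrow> bool" where
  "dkmem t cs \<longleftrightarrow> (\<forall>p. lookp p t = count_list (map (\<lambda>c. encp (zk c + zk c)) cs) (encp p))"

lemma kmem_key_trie: "kmem (key_trie (map vr cs)) cs"
  by (induction cs) (auto simp: kmem_def lookp_Lf bump_key_enc)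

lemma dkmem_dkey_trie: "dkmem (dkey_trie (map vr cs)) cs"
  by (induction cs) (auto simp: dkmem_def lookp_Lf bump_dkey_enc)

lemma kmem_bump: "kmem t cs \<Longrightarrow> kmem (bump_key (vr c) t) (c # cs)"
  by (auto simp: kmem_def bump_key_enc)

lemma dkmem_bump: "dkmem t cs \<Longrightarrow> dkmem (bump_dkey (vr c) t) (c # cs)"
  by (auto simp: dkmem_def bump_dkey_enc)

lemma look_key_enc: "look_key (vr c) t = lookp (zk c) t"
  by (cases c) (simp add: vr_def lookp_def zk_def)

definition uk :: "int \<times> int \<Rightarrow> ukey" where
  "uk u = (case u of (x, y) \<Rightarrow> UK (e7 x) (e7 y) (e7 (- x)) (e7 (- y)) (e7 (x + y)) (e7 (y + - x)) (e7 (x + - y)))"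

lemma mkukey_enc: "mkukey (e7 x) (e7 y) = uk (x, y)"
  by (simp add: mkukey_def mkukey2_def uk_def enc_add enc_neg)

definition irot :: "int \<times> int \<Rightarrow> int \<times> int" where "irot p = (- snd p, fst p)"

lemma codeg_bound_enc:
  "codeg_bound (vr c) (uk u) t1 t2 =
     lookp (zk c + irot (zk c - u)) t1 + (lookp (zk c - irot (zk c - u)) t1 +
     (lookp (u + irot (zk c - u)) t1 + (lookp (u - irot (zk c - u)) t1 +
     (lookp (zk c + u + irot (u - zk c)) t2 + lookp (zk c + u - irot (u - zk c)) t2))))"
  by (cases c; cases u) (simp add: vr_def uk_def lookp_def zk_def irot_def enc_add algebra_simps)

subsection \<open>Degrees from key counts\<close>

lemma hl_inj: "hl a = hl b \<longleftrightarrow> a = b"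
  by (simp add: hl_def prod_eq_iff)

lemma zk_inj: "zk c = zk d \<longleftrightarrow> c = d"
  by (auto simp: zk_def prod_eq_iff)

lemma loc_inj: "loc c = loc d \<longleftrightarrow> c = d"
  by (simp add: loc_def hl_inj zk_inj)

lemma apex_hl: "apex (hl a) (hl b) (hl c) \<longleftrightarrow> a \<noteq> b \<and> c = a + irot (b - a)"
proof -
  have "hl a + rot (hl b - hl a) = hl (a + irot (b - a))"
    by (simp add: hl_def rot_def irot_def field_simps)
  then show ?thesis by (simp add: apex_def hl_inj)
qed

lemma tri_hl: "tri (hl a) (hl b) (hl c) \<longleftrightarrow>
    a \<noteq> b \<and> c = a + irot (b - a) \<or> a \<noteq> c \<and> b = a + irot (c - a) \<or>
    b \<noteq> a \<and> c = b + irot (a - b) \<or> b \<noteq> c \<and> a = b + irot (c - b) \<or>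
    c \<noteq> a \<and> b = c + irot (a - c) \<or> c \<noteq> b \<and> a = c + irot (b - c)"
  unfolding tri_iff apex_hl by blast

lemma count_list_distinct: "distinct xs \<Longrightarrow> count_list xs k = of_bool (k \<in> set xs)"
  by (induction xs) auto

text \<open>An apex relation among three points can hold in six ways. The equations
  \<open>e0\<close> to \<open>e5\<close> solve each of them for \<open>k\<close>, and the solutions
  are the six distinct entries of \<open>kc c d\<close>.\<close>

lemma count_kc:
  assumes "c \<noteq> d"
  shows "count_list (kc c d) k = of_bool (tri (hl k) (loc c) (loc d))"
proof -
  obtain x y x' y' a b where eq: "c = (x, y)" "d = (x', y')" "k = (a, b)" by (metis surj_pair)
  have ne: "x \<noteq> x' \<or> y \<noteq> y'" using assms eq by simp
  have "distinct (kc c d)"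
    using ne unfolding eq kc_def prod.case distinct.simps list.set
    by (intro conjI; simp; linarith)
  moreover have "k \<in> set (kc c d) \<longleftrightarrow> tri (hl k) (loc c) (loc d)"
  proof -
    let ?a = "hl k" and ?zc = "zk c" and ?zd = "zk d"
    have z: "?zc \<noteq> ?zd" using assms by (simp add: zk_inj)
    have "(k \<noteq> ?zc \<and> ?zd = k + irot (?zc - k)) = (?zd = k + irot (?zc - k))"
      using z by (auto simp: irot_def prod_eq_iff)
    also have "\<dots> = (k = (x + - y', y + x'))"
      by (auto simp: eq zk_def irot_def)
    finally have e0: "(k \<noteq> ?zc \<and> ?zd = k + irot (?zc - k)) = (k = (x + - y', y + x'))" .
    have "(k \<noteq> ?zd \<and> ?zc = k + irot (?zd - k)) = (?zc = k + irot (?zd - k))"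
      using z by (auto simp: irot_def prod_eq_iff)
    also have "\<dots> = (k = (- y + x', x + y'))"
      by (auto simp: eq zk_def irot_def)
    finally have e1: "(k \<noteq> ?zd \<and> ?zc = k + irot (?zd - k)) = (k = (- y + x', x + y'))" .
    have "(?zc \<noteq> k \<and> ?zd = ?zc + irot (k - ?zc)) = (?zd = ?zc + irot (k - ?zc))"
      using z by (auto simp: irot_def prod_eq_iff)
    also have "\<dots> = (k = (- y + - y + (x' + y'), x + x + (y' + - x')))"
      by (auto simp: eq zk_def irot_def)
    finally have e2: "(?zc \<noteq> k \<and> ?zd = ?zc + irot (k - ?zc)) = (k = (- y + - y + (x' + y'), x + x + (y' + - x')))" .
    have "(?zc \<noteq> ?zd \<and> k = ?zc + irot (?zd - ?zc)) = (k = ?zc + irot (?zd - ?zc))"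
      using z by (auto simp: irot_def prod_eq_iff)
    also have "\<dots> = (k = (x + x + (- x' + - y'), y + y + (x' + - y')))"
      by (auto simp: eq zk_def irot_def)
    finally have e3: "(?zc \<noteq> ?zd \<and> k = ?zc + irot (?zd - ?zc)) = (k = (x + x + (- x' + - y'), y + y + (x' + - y')))" .
    have "(?zd \<noteq> k \<and> ?zc = ?zd + irot (k - ?zd)) = (?zc = ?zd + irot (k - ?zd))"
      using z by (auto simp: irot_def prod_eq_iff)
    also have "\<dots> = (k = (x + y + (- y' + - y'), y + - x + (x' + x')))"
      by (auto simp: eq zk_def irot_def)
    finally have e4: "(?zd \<noteq> k \<and> ?zc = ?zd + irot (k - ?zd)) = (k = (x + y + (- y' + - y'), y + - x + (x' + x')))" .
    have "(?zd \<noteq> ?zc \<and> k = ?zd + irot (?zc - ?zd)) = (k = ?zd + irot (?zc - ?zd))"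
      using z by (auto simp: irot_def prod_eq_iff)
    also have "\<dots> = (k = (- x + - y + (x' + x'), x + - y + (y' + y')))"
      by (auto simp: eq zk_def irot_def)
    finally have e5: "(?zd \<noteq> ?zc \<and> k = ?zd + irot (?zc - ?zd)) = (k = (- x + - y + (x' + x'), x + - y + (y' + y')))" .
    show ?thesis unfolding loc_def tri_hl e0 e1 e2 e3 e4 e5 by (auto simp: eq kc_def)
  qed
  ultimately show ?thesis
    by (simp add: count_list_distinct)
qed

text \<open>Any real point that forms a triangle with two stored points has a key, so a search over
  keys misses no point of the plane.\<close>

lemma tri_key:
  assumes "tri v (loc c) (loc d)"
  obtains k where "k \<in> set (kc c d)" "v = hl k"
proof -
  obtain x y x' y' a b where eq: "c = (x, y)" "d = (x', y')" "v = (a, b)" by (metis surj_pair)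
  consider "v = loc c + rot (loc d - loc c)" | "loc d = loc c + rot (v - loc c)"
    | "v = loc d + rot (loc c - loc d)" | "loc c = loc d + rot (v - loc d)"
    | "loc d = v + rot (loc c - v)" | "loc c = v + rot (loc d - v)"
    using assms unfolding tri_iff apex_def by blast
  then have "\<exists>k\<in>set (kc c d). v = hl k"
  proof cases
    case 1 then have "v = hl (x + x + (- x' + - y'), y + y + (x' + - y'))"
      by (simp add: eq loc_def zk_def hl_def rot_def field_simps)
    then show ?thesis by (simp add: eq kc_def)
  next
    case 2 then have "v = hl (- y + - y + (x' + y'), x + x + (y' + - x'))"
      by (simp add: eq loc_def zk_def hl_def rot_def field_simps)
    then show ?thesis by (simp add: eq kc_def)
  next
    case 3 then have "v = hl (- x + - y + (x' + x'), x + - y + (y' + y'))"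
      by (simp add: eq loc_def zk_def hl_def rot_def field_simps)
    then show ?thesis by (simp add: eq kc_def)
  next
    case 4 then have "v = hl (x + y + (- y' + - y'), y + - x + (x' + x'))"
      by (simp add: eq loc_def zk_def hl_def rot_def field_simps)
    then show ?thesis by (simp add: eq kc_def)
  next
    case 5 then have "v = hl (x + - y', y + x')"
      by (simp add: eq loc_def zk_def hl_def rot_def field_simps)
    then show ?thesis by (simp add: eq kc_def)
  next
    case 6 then have "v = hl (- y + x', x + y')"
      by (simp add: eq loc_def zk_def hl_def rot_def field_simps)
    then show ?thesis by (simp add: eq kc_def)
  qed
  then show ?thesis using that by blast
qed

lemma count_concat_kc:
  "c \<notin> set cs \<Longrightarrow> count_list (concat (map (kc c) cs)) k = length (filter (\<lambda>y. tri (hl k) (loc c) y) (map loc cs))"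
  by (induction cs) (auto simp: count_kc)

lemma pair_count_allk:
  "distinct cs \<Longrightarrow> pair_count (map loc cs) (hl k) = count_list (allk cs) k"
  by (induction cs) (simp_all add: count_concat_kc)

lemma deg_allk:
  assumes "distinct cs"
  shows "deg (insert (hl k) (loc ` set cs)) (hl k) = count_list (allk cs) k"
  using deg_pair_count[of "map loc cs" "hl k"] assms
  by (simp add: pair_count_allk distinct_map inj_on_def loc_inj)

lemma deg_pos_key:
  assumes "0 < deg (insert v (loc ` set cs)) v" "distinct cs"
  obtains k where "k \<in> set (allk cs)" "v = hl k"
proof -
  have "0 < pair_count (map loc cs) v"
    using deg_pair_count[of "map loc cs" v] assms by (simp add: distinct_map inj_on_def loc_inj)
  then have "\<exists>k\<in>set (allk cs). v = hl k"
  proof (induction cs)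
    case (Cons c cs)
    show ?case
    proof (cases "0 < pair_count (map loc cs) v")
      case False
      then have "filter (\<lambda>y. tri v (loc c) y) (map loc cs) \<noteq> []" using Cons.prems by force
      then obtain d where "d \<in> set cs" "tri v (loc c) (loc d)"
        unfolding filter_empty_conv set_map by blast
      moreover obtain k where "k \<in> set (kc c d)" "v = hl k"
        using tri_key[OF \<open>tri v (loc c) (loc d)\<close>] by blast
      ultimately show ?thesis by auto
    qed (use Cons in auto)
  qed simp
  then show ?thesis using that by blast
qed

subsection \<open>Ranges\<close>

text \<open>The ranges justify words of seven bits. Coordinates up to 4 give keys up to 8 and
  candidates up to 24; after one more insertion candidates reach at most
  \<open>2 * 24 + 8 = 56\<close>, and up to 63 the encoding is injective.\<close>

definition bnd :: "int \<Rightarrow> int \<times> int \<Rightarrow> bool" where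
  "bnd b p \<longleftrightarrow> \<bar>fst p\<bar> \<le> b \<and> \<bar>snd p\<bar> \<le> b"

lemma encp_inj: "bnd 63 p \<Longrightarrow> bnd 63 q \<Longrightarrow> encp p = encp q \<longleftrightarrow> p = q"
  by (auto simp: bnd_def encp_def e7_eq prod_eq_iff)

lemma count_encp:
  "bnd 63 k \<Longrightarrow> \<forall>x\<in>set xs. bnd 63 x \<Longrightarrow> count_list (map encp xs) (encp k) = count_list xs k"
  by (induction xs) (auto simp: encp_inj)

lemma bnd_kc:
  assumes "bnd m (zk c)" "bnd n (zk d)" "2 * m + n \<le> b" "m + 2 * n \<le> b" "0 \<le> m" "0 \<le> n" "k \<in> set (kc c d)"
  shows "bnd b k"
proof -
  obtain x y x' y' where eq: "c = (x, y)" "d = (x', y')" by (metis surj_pair)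
  show ?thesis
    using assms unfolding eq kc_def bnd_def zk_def by (auto simp: abs_le_iff)
qed

lemma bnd_allk:
  "\<forall>c\<in>set cs. bnd m (zk c) \<Longrightarrow> 3 * m \<le> b \<Longrightarrow> 0 \<le> m \<Longrightarrow> \<forall>k\<in>set (allk cs). bnd b k"
proof (induction cs)
  case (Cons c cs)
  then show ?case using bnd_kc[of m c m _ b] by fastforce
qed simp

lemma bnd_mono: "bnd m p \<Longrightarrow> m \<le> n \<Longrightarrow> bnd n p"
  by (auto simp: bnd_def)

subsection \<open>Soundness of the minimality and extension tests\<close>

lemma not_minD:
  "not_min False (map vr cs) (uk u) n t t1 t2 \<Longrightarrow>
    \<exists>c\<in>set cs. lookp (zk c) t + codeg_bound (vr c) (uk u) t1 t2 < n"
proof (induction cs)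
  case (Cons c cs)
  show ?case
  proof (cases "Suc (look_key (vr c) t) \<le> n \<and> Suc (look_key (vr c) t + codeg_bound (vr c) (uk u) t1 t2) \<le> n")
    case True
    then show ?thesis by (auto simp: look_key_enc intro!: bexI[of _ c])
  next
    case False
    then have "small_deg (Suc (look_key (vr c) t) \<le> n) (vr c) (uk u) n t t1 t2 = False"
      by (cases "Suc (look_key (vr c) t) \<le> n") simp_all
    then show ?thesis using Cons by simp
  qed
qed simp

lemma card_le_count:
  assumes "\<And>c. c \<in> set cs \<Longrightarrow> Q c \<Longrightarrow> f c = a" "distinct cs"
  shows "card {c \<in> set cs. Q c} \<le> count_list (map f cs) a"
proof -
  have "card {c \<in> set cs. Q c} = length (filter Q cs)"
    using assms(2) by (simp flip: set_filter add: distinct_card)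
  also have "\<dots> \<le> count_list (map f cs) a"
    using assms(1) by (induction cs) auto
  finally show ?thesis .
qed

text \<open>The key of a third vertex satisfies one of six linear equations, two of them stated for
  the doubled key. Distinct points with equal words only enlarge the counts.\<close>

lemma codeg_le_bound:
  assumes "distinct cs" "kmem t1 cs" "dkmem t2 cs" "hl u \<notin> loc ` set cs" "c \<in> set cs"
  shows "codeg (insert (hl u) (loc ` set cs)) (loc c) (hl u) \<le> codeg_bound (vr c) (uk u) t1 t2"
proof -
  let ?P = "loc ` set cs" and ?z = "zk c"
  have "codeg (insert (hl u) ?P) (loc c) (hl u) = card {y \<in> insert (hl u) ?P. tri (loc c) (hl u) y}"
    using assms(4,5) by (intro codeg_eq) (auto, metis imageI)
  also have "{y \<in> insert (hl u) ?P. tri (loc c) (hl u) y} = loc ` {d \<in> set cs. tri (loc c) (hl u) (loc d)}"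
    using tri_distinct[of "loc c" "hl u" "hl u"] by auto
  also have "card \<dots> = card {d \<in> set cs. tri (loc c) (hl u) (loc d)}"
    by (intro card_image) (auto simp: inj_on_def loc_inj)
  also have "\<dots> \<le> card ({d \<in> set cs. zk d = ?z + irot (?z - u)} \<union> ({d \<in> set cs. zk d = ?z - irot (?z - u)} \<union>
      ({d \<in> set cs. zk d = u + irot (?z - u)} \<union> ({d \<in> set cs. zk d = u - irot (?z - u)} \<union>
      ({d \<in> set cs. zk d + zk d = ?z + u + irot (u - ?z)} \<union> {d \<in> set cs. zk d + zk d = ?z + u - irot (u - ?z)})))))"
    (is "_ \<le> card (?A \<union> (?B \<union> (?C \<union> (?D \<union> (?E \<union> ?F)))))")
  proof (intro card_mono)
    show "{d \<in> set cs. tri (loc c) (hl u) (loc d)} \<subseteq> ?A \<union> (?B \<union> (?C \<union> (?D \<union> (?E \<union> ?F))))"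
    proof
      fix d assume d: "d \<in> {d \<in> set cs. tri (loc c) (hl u) (loc d)}"
      obtain a b x y p q where eq: "zk c = (a, b)" "u = (x, y)" "zk d = (p, q)" by (metis surj_pair)
      from d have "tri (hl (zk c)) (hl u) (hl (zk d))" by (simp add: loc_def)
      then consider "zk d = zk c + irot (u - zk c)" | "u = zk c + irot (zk d - zk c)"
        | "zk d = u + irot (zk c - u)" | "zk c = u + irot (zk d - u)"
        | "u = zk d + irot (zk c - zk d)" | "zk c = zk d + irot (u - zk d)"
        unfolding tri_hl by blast
      then have "zk d = ?z + irot (?z - u) \<or> zk d = ?z - irot (?z - u) \<or> zk d = u + irot (?z - u) \<or>
        zk d = u - irot (?z - u) \<or> zk d + zk d = ?z + u + irot (u - ?z) \<or> zk d + zk d = ?z + u - irot (u - ?z)"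
        by cases (auto simp: eq irot_def)
      then show "d \<in> ?A \<union> (?B \<union> (?C \<union> (?D \<union> (?E \<union> ?F))))"
        using d by auto
    qed
  qed simp
  also have "\<dots> \<le> card ?A + (card ?B + (card ?C + (card ?D + (card ?E + card ?F))))"
    by (intro order.trans[OF card_Un_le] add_left_mono order.refl)
  also have "\<dots> \<le> codeg_bound (vr c) (uk u) t1 t2"
  proof -
    have A: "card {d \<in> set cs. zk d = k} \<le> lookp k t1" for k
      using assms(2) card_le_count[of cs "\<lambda>d. zk d = k" "\<lambda>d. encp (zk d)" "encp k"] assms(1) by (simp add: kmem_def)
    have E: "card {d \<in> set cs. zk d + zk d = k} \<le> lookp k t2" for k
      using assms(3) card_le_count[of cs "\<lambda>d. zk d + zk d = k" "\<lambda>d. encp (zk d + zk d)" "encp k"] assms(1) by (simp add: dkmem_def)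
    show ?thesis unfolding codeg_bound_enc by (intro add_mono A E)
  qed
  finally show ?thesis .
qed

definition rep :: "trie \<Rightarrow> trie \<Rightarrow> trie \<Rightarrow> (int \<times> int) list \<Rightarrow> bool" where
  "rep t t1 t2 cs \<longleftrightarrow> distinct cs \<and> kmem t1 cs \<and> dkmem t2 cs \<and> (\<forall>c\<in>set cs. bnd 63 (zk c)) \<and>
     (\<forall>k\<in>set (allk cs). bnd 63 k) \<and> (\<forall>p. lookp p t = count_list (map encp (allk cs)) (encp p))"

lemma rep_deg:
  assumes "rep t t1 t2 cs" "bnd 63 k"
  shows "deg (insert (hl k) (loc ` set cs)) (hl k) = lookp k t"
  using assms deg_allk[of cs k] count_encp[of k "allk cs"] by (simp add: rep_def)

lemma rep_mem:
  assumes "rep t t1 t2 cs" "bnd 63 k" "Suc 0 \<le> lookp k t1"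
  shows "hl k \<in> loc ` set cs"
proof -
  have "encp k \<in> (\<lambda>c. encp (zk c)) ` set cs"
    using assms by (metis kmem_def rep_def count_list_0_iff list.set_map not_less_eq_eq zero_le)
  then obtain c where "c \<in> set cs" "encp k = encp (zk c)" by auto
  then show ?thesis using assms encp_inj[of k "zk c"] by (auto simp: rep_def loc_def)
qed

lemma rep_not_min:
  assumes "rep t t1 t2 cs" "bnd 63 k" "hl k \<notin> loc ` set cs"
    and "not_min False (map vr cs) (uk k) (lookp k t) t t1 t2"
  shows "\<exists>w\<in>loc ` set cs. deg (insert (hl k) (loc ` set cs)) w < deg (insert (hl k) (loc ` set cs)) (hl k)"
proof -
  let ?P = "loc ` set cs"
  obtain c where c: "c \<in> set cs" "lookp (zk c) t + codeg_bound (vr c) (uk k) t1 t2 < lookp k t"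
    using not_minD[OF assms(4)] by blast
  have "deg (insert (hl k) ?P) (loc c) = deg ?P (loc c) + codeg (insert (hl k) ?P) (loc c) (hl k)"
    using assms(3) by (intro deg_insert) auto
  moreover have "deg ?P (loc c) = lookp (zk c) t"
    using rep_deg[OF assms(1), of "zk c"] c assms(1) by (simp add: rep_def loc_def[symmetric] insert_absorb)
  moreover have "codeg (insert (hl k) ?P) (loc c) (hl k) \<le> codeg_bound (vr c) (uk k) t1 t2"
    using assms c by (intro codeg_le_bound) (auto simp: rep_def)
  ultimately show ?thesis using c rep_deg[OF assms(1,2)] by (intro bexI[of _ "loc c"]) auto
qed

lemma no_extD:
  "no_ext True gs r rs t t1 t2 \<Longrightarrow> encp k \<in> set gs \<Longrightarrow>
    lookp k t < r \<or> Suc 0 \<le> lookp k t1 \<or> not_min False rs (uk k) (lookp k t) t t1 t2"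
proof (induction gs)
  case (Cons g gs)
  obtain x y where g: "g = (x, y)" by (cases g)
  let ?b = "excluded1 (r \<le> look2 x y t) x y rs t t1 t2"
  have *: "no_ext ?b gs r rs t t1 t2"
    using Cons.prems(1) by (simp add: g)
  then have b: ?b by (cases ?b) simp_all
  show ?case
  proof (cases "encp k = g")
    case True
    then have xy: "x = e7 (fst k)" "y = e7 (snd k)" by (simp_all add: g encp_def)
    show ?thesis
    proof (cases "r \<le> lookp k t")
      case True
      then have "excluded2 (Suc 0 \<le> lookp k t1) x y rs t t1 t2"
        using b by (simp add: lookp_def xy)
      then show ?thesis
        by (cases "Suc 0 \<le> lookp k t1") (simp_all add: mkukey_enc lookp_def xy)
    qed simp
  next
    case False
    then show ?thesis using Cons * b by simp
  qed
qed simp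

lemma rep_no_ext:
  assumes "rep t t1 t2 cs" "no_ext True gs r (map vr cs) t t1 t2"
    "encp k \<in> set gs" "bnd 63 k" "r \<le> deg (insert (hl k) (loc ` set cs)) (hl k)" "hl k \<notin> loc ` set cs"
  shows "\<exists>w\<in>loc ` set cs. deg (insert (hl k) (loc ` set cs)) w < deg (insert (hl k) (loc ` set cs)) (hl k)"
  using no_extD[OF assms(2,3)] assms rep_deg[OF assms(1,4)] rep_mem[OF assms(1,4)] rep_not_min[OF assms(1,4,6)]
  by force

subsection \<open>Checking a node of the search\<close>

definition late :: "nat \<Rightarrow> bool" where "late k \<longleftrightarrow> 7 \<le> k"
definition level :: "nat \<Rightarrow> bool" where "level k \<longleftrightarrow> 3 \<le> k \<and> k < 14"
definition th_diff :: "nat \<Rightarrow> nat" where "th_diff k = th (Suc k) - th k"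
definition ub_diff :: "nat \<Rightarrow> nat" where "ub_diff k = ub k - th k"

definition ri :: "int \<times> int \<Rightarrow> point" where
  "ri p = (of_int (fst p), of_int (snd p))"

text \<open>\<open>e\<close> is the excess over the threshold. Distinctness and the number of
  triangles are assumptions inside: they are known for the set to which a node is applied, so that
  no check has to count triangles anew.\<close>

definition node :: "nat \<Rightarrow> nat \<Rightarrow> (bits \<times> bits) list \<Rightarrow> bool" where
  "node k e ws \<longleftrightarrow> (\<exists>ps. ws = map encp ps \<and> (\<forall>p\<in>set ps. bnd 4 p) \<and>
     (length ps = k \<longrightarrow> distinct ps \<longrightarrow> S_rt (ri ` set ps) = th k + e \<longrightarrow> good k (ri ` set ps)))"

definition top_node :: "nat \<Rightarrow> nat \<Rightarrow> (bits \<times> bits) list \<Rightarrow> bool" where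
  "top_node k e ws \<longleftrightarrow> e = ub_diff k \<and> (\<forall>ps. ws = map encp ps \<longrightarrow> (\<forall>p\<in>set ps. bnd 4 p) \<longrightarrow> 10 \<le> k \<longrightarrow>
     (\<exists>E\<in>extremal k. \<exists>f. bsim f \<and> f ` E = ri ` set ps))"

definition spare :: "nat \<Rightarrow> nat" where "spare k = (if k = 5 then 4 else ub_diff k)"

definition final_ok :: "nat \<Rightarrow> nat \<Rightarrow> (bits \<times> bits) list \<Rightarrow> bool" where
  "final_ok k e ws \<longleftrightarrow> Suc e \<le> spare k \<or> top_node k e ws"

text \<open>Where the next threshold is met already, \<open>ext\<close> still asks for a positive
  degree.\<close>

fun pos :: "nat \<Rightarrow> nat" where
  "pos 0 = Suc 0" | "pos (Suc n) = Suc n"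

text \<open>After the insertion of a first point, the candidates for a second one are the
  completions \<open>ks\<close> of pairs with the first point and the keys \<open>gs\<close> that
  had degree at least \<open>r\<close> before. All other points keep their degree, which is too
  small.\<close>

fun stuck3 :: "nat \<Rightarrow> vrec list \<Rightarrow> trie \<Rightarrow> trie \<Rightarrow> trie \<Rightarrow>
    (bits \<times> bits) list \<Rightarrow> (bits \<times> bits) list \<Rightarrow> bool" where
  "stuck3 r rs t t1 t2 gs ks = no_ext (no_ext True ks r rs t t1 t2) gs r rs t t1 t2"

fun stuck2 :: "nat \<Rightarrow> vrec \<Rightarrow> vrec list \<Rightarrow> trie \<Rightarrow> trie \<Rightarrow> trie \<Rightarrow> (bits \<times> bits) list \<Rightarrow> bool" where
  "stuck2 r v rs t t1 t2 ks =
     stuck3 r (v # rs) (bumps ks t) (bump_key v t1) (bump_dkey v t2) (heavy r t) ks"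

fun stuck1 :: "bool \<Rightarrow> nat \<Rightarrow> vrec \<Rightarrow> vrec list \<Rightarrow> trie \<Rightarrow> trie \<Rightarrow> trie \<Rightarrow> bool" where
  "stuck1 False r v rs t t1 t2 = False"
| "stuck1 True r v rs t t1 t2 = stuck2 r v rs t t1 t2 (pair_keys v rs)"

text \<open>Settles a leaf without a node of its own. The side conditions ensure that minimality is
  in force for the next point, that the enlarged set stays below its upper bound and hence is final,
  that the next point needs a positive degree, and that the first one can be stored as a multiple of
  \<open>1 + i\<close>.\<close>

fun stuck :: "nat \<Rightarrow> nat \<Rightarrow> bits \<Rightarrow> bits \<Rightarrow> vrec list \<Rightarrow> trie \<Rightarrow> trie \<Rightarrow> trie \<Rightarrow> bool" where
  "stuck k e x y rs t t1 t2 =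
     stuck1 (late (Suc k) \<and> Suc e \<le> ub_diff (Suc k) \<and> Suc 0 \<le> th_diff (Suc k) - e \<and> beven (badd x y))
       (th_diff (Suc k) - e) (mkrec (bhalf (badd x y)) (bhalf (badd y (bneg x)))) rs t t1 t2"

fun dead :: "bool \<Rightarrow> bits \<Rightarrow> bits \<Rightarrow> vrec list \<Rightarrow> trie \<Rightarrow> trie \<Rightarrow> trie \<Rightarrow> bool" where
  "dead False x y rs t t1 t2 = False"
| "dead True x y rs t t1 t2 = not_min False rs (mkukey x y) (look2 x y t) t t1 t2"

fun disposed :: "nat \<Rightarrow> nat \<Rightarrow> (bits \<times> bits) list \<Rightarrow> vrec list \<Rightarrow> trie \<Rightarrow> trie \<Rightarrow> trie \<Rightarrow>
    bits \<times> bits \<Rightarrow> disp \<Rightarrow> bool" where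
  "disposed k e ws rs t t1 t2 (x, y) DP = (Suc 0 \<le> look2 x y t1)"
| "disposed k e ws rs t t1 t2 (x, y) DR = dead (late k) x y rs t t1 t2"
| "disposed k e ws rs t t1 t2 (x, y) DS = stuck k (e + look2 x y t - th_diff k) x y rs t t1 t2"
| "disposed k e ws rs t t1 t2 (x, y) (DM sc a b c tx ty) =
     (integral sc x y \<and> node (Suc k) (e + look2 x y t - th_diff k)
        (psort (moves a b c tx ty (add_point sc x y ws))))"

fun run :: "bool \<Rightarrow> nat \<Rightarrow> nat \<Rightarrow> (bits \<times> bits) list \<Rightarrow> vrec list \<Rightarrow> trie \<Rightarrow> trie \<Rightarrow> trie \<Rightarrow>
    (bits \<times> bits) list \<Rightarrow> disp list \<Rightarrow> bool" where
  "run False k e ws rs t t1 t2 hs ds = False"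
| "run True k e ws rs t t1 t2 [] ds = True"
| "run True k e ws rs t t1 t2 (h # hs) [] = False"
| "run True k e ws rs t t1 t2 (h # hs) (d # ds) =
     run (disposed k e ws rs t t1 t2 h d) k e ws rs t t1 t2 hs ds"

definition run2 where
  "run2 k e r ws rs t ds = run True k e ws rs t (key_trie rs) (dkey_trie rs) (heavy r t) ds"

definition run1 where
  "run1 k e r ws rs ds = run2 k e r ws rs (degree_trie rs) ds"

definition small_coord :: "bits \<Rightarrow> bool" where "small_coord x \<longleftrightarrow> x \<in> e7 ` {-4..4}"

fun small_coords :: "(bits \<times> bits) list \<Rightarrow> bool" where
  "small_coords [] = True"
| "small_coords ((x, y) # ps) = (small_coord x \<and> small_coord y \<and> small_coords ps)"

definition checks where
  "checks k e ws ds \<longleftrightarrow> level k \<and> small_coords ws \<and> final_ok k e ws \<and>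
     run1 k e (pos (th_diff k - e)) ws (node_recs ws) ds"

text \<open>Lower case letters stand for -5 to 20, with \<open>f\<close> for 0, digits for 21 to 30,
  upper case letters for -31 to -6. The clamping gives the bound 31 for every character at
  once.\<close>

fun letter :: "char \<Rightarrow> bits" where
  "letter c = e7 (max (-31) (min 30 (let n = of_char c in
     if n < 58 then n - 27 else if n < 91 then n - 96 else n - 102)))"

text \<open>The letters of a certificate stand for the candidates in the order of the trie: p for a point already in the
  set, r for a point not of minimum degree after its insertion, s for an insertion whose result does not reach
  the next threshold again; every other letter encodes the linear part of a similarity (after multiplication
  by 1 + i from S on) to a later node, followed by the two letters of its translation part.\<close>

fun op_of :: "char \<Rightarrow> disp" where
  "op_of c = (if c = CHR ''p'' then DP else if c = CHR ''r'' then DR else if c = CHR ''s'' then DS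
     else (let n = of_char c :: nat; m = (if n < 73 then n - 65 else n - 83) in
       DM (73 \<le> n) (odd (m div 4)) (odd (m div 2)) (odd m) End End))"

fun points :: "string \<Rightarrow> (bits \<times> bits) list" where
  "points (a # b # cs) = (letter a, letter b) # points cs"
| "points cs = []"

function parse :: "string \<Rightarrow> disp list" and parse1 :: "disp \<Rightarrow> string \<Rightarrow> disp list" where
  "parse [] = []"
| "parse (c # cs) = parse1 (op_of c) cs"
| "parse1 (DM sc a b c x y) (t # u # cs) = DM sc a b c (letter t) (letter u) # parse cs"
| "parse1 (DM sc a b c x y) [t] = []"
| "parse1 (DM sc a b c x y) [] = []"
| "parse1 DP cs = DP # parse cs"
| "parse1 DR cs = DR # parse cs"
| "parse1 DS cs = DS # parse cs"
  by pat_completeness auto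
termination
  by (relation "Wellfounded.measure (\<lambda>z. case z of Inl cs \<Rightarrow> 2 * length cs | Inr (d, cs) \<Rightarrow> 2 * length cs + 1)") auto

definition check where
  "check k e p c = checks k e (points p) (parse c)"

subsection \<open>Soundness of the check\<close>

lemma loc_cof: "loc (cof p) = ri p"
  by (simp add: loc_def hl_def zk_def cof_def ri_def)

lemma cof_inj: "cof p = cof q \<longleftrightarrow> p = q"
  by (auto simp: cof_def prod_eq_iff)

lemma bnd_zk_cof: "bnd 4 p \<Longrightarrow> bnd 8 (zk (cof p))"
  by (auto simp: bnd_def zk_def cof_def)

lemma ri_inj: "ri p = ri q \<longleftrightarrow> p = q"
  by (simp add: ri_def prod_eq_iff)

lemma rep_node:
  assumes "distinct ps" "\<forall>p\<in>set ps. bnd 4 p"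
  defines "cs \<equiv> map cof ps"
  shows "rep (degree_trie (map vr cs)) (key_trie (map vr cs)) (dkey_trie (map vr cs)) cs"
    "\<forall>c\<in>set cs. bnd 8 (zk c)" "\<forall>k\<in>set (allk cs). bnd 24 k" "loc ` set cs = ri ` set ps"
proof -
  show z: "\<forall>c\<in>set cs. bnd 8 (zk c)" using assms by (auto simp: bnd_zk_cof)
  show k: "\<forall>k\<in>set (allk cs). bnd 24 k" using z by (intro bnd_allk[of _ 8]) auto
  have d: "distinct cs" using assms by (simp add: distinct_map inj_on_def cof_inj)
  show "rep (degree_trie (map vr cs)) (key_trie (map vr cs)) (dkey_trie (map vr cs)) cs"
    unfolding rep_def using z k bnd_mono[of 8 _ 63] bnd_mono[of 24 _ 63] d
    by (simp add: kmem_key_trie dkmem_dkey_trie lookp_degree_trie)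
  show "loc ` set cs = ri ` set ps" by (simp add: cs_def image_image loc_cof)
qed

lemma final_of_final_ok:
  assumes "final_ok k e (map encp ps)" "\<forall>p\<in>set ps. bnd 4 p" "S_rt (ri ` set ps) = th k + e" "3 \<le> k" "k \<le> 14"
  shows "final k (ri ` set ps)"
proof -
  have "k = 3 \<or> k = 4 \<or> k = 5 \<or> k = 6 \<or> k = 7 \<or> k = 8 \<or> k = 9 \<or> k = 10 \<or> k = 11 \<or> k = 12 \<or> k = 13 \<or> k = 14"
    using assms(4,5) by presburger
  then have le: "th k \<le> ub k" by (auto simp: th_def ub_def)
  show ?thesis
  proof (cases "Suc e \<le> spare k")
    case True
    then show ?thesis using le assms(3)
      by (auto simp: final_def spare_def ub_diff_def th_def ub_def split: if_splits)
  next
    case False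
    then have t: "top_node k e (map encp ps)" using assms(1) by (simp add: final_ok_def)
    then have "th k + e = ub k" using le by (simp add: top_node_def ub_diff_def)
    moreover have "k = 5 \<longrightarrow> ub k \<noteq> 7" by (simp add: ub_def)
    ultimately have "S_rt (ri ` set ps) = ub k" "k = 5 \<longrightarrow> S_rt (ri ` set ps) \<noteq> 7" using assms(3) by simp_all
    moreover have "10 \<le> k \<Longrightarrow> \<exists>E\<in>extremal k. \<exists>f. bsim f \<and> f ` E = ri ` set ps"
      using t assms(2) unfolding top_node_def by blast
    ultimately show ?thesis unfolding final_def by simp
  qed
qed

lemma good_of_stuck:
  assumes rep: "rep t t1 t2 cs" and b8: "\<forall>c\<in>set cs. bnd 8 (zk c)" and b24: "bnd 24 (x, y)"
    and new: "hl (x, y) \<notin> loc ` set cs"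
    and st: "stuck k e (e7 x) (e7 y) (map vr cs) t t1 t2"
    and card: "card (insert (hl (x, y)) (loc ` set cs)) = Suc k"
    and S: "S_rt (insert (hl (x, y)) (loc ` set cs)) = th (Suc k) + e"
  shows "good (Suc k) (insert (hl (x, y)) (loc ` set cs))"
proof -
  let ?P = "insert (hl (x, y)) (loc ` set cs)"
  define c where "c = ((x + y) div 2, (y + - x) div 2)"
  define r where "r = th_diff (Suc k) - e"
  have cc: "late (Suc k) \<and> Suc e \<le> ub_diff (Suc k) \<and> Suc 0 \<le> r \<and> beven (badd (e7 x) (e7 y))"
    using st unfolding stuck.simps r_def by (metis (full_types) stuck1.simps(1))
  then have cond: "7 \<le> Suc k" "e < ub_diff (Suc k)" "0 < r" "even (x + y)"
    by (simp_all add: late_def enc_add e7_even)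
  have xy: "\<bar>x\<bar> \<le> 24" "\<bar>y\<bar> \<le> 24" using b24 by (auto simp: bnd_def)
  have zc: "zk c = (x, y)" using cond(4) by (simp add: zk_def c_def) presburger
  then have lc: "loc c = hl (x, y)" by (simp add: loc_def)
  have cn: "c \<notin> set cs" using new lc by (metis imageI)
  have "bhalf (e7 (x + y)) = e7 ((x + y) div 2)" "bhalf (e7 (y + - x)) = e7 ((y + - x) div 2)"
    using xy by (intro e7_half; auto)+
  then have mk: "mkrec (bhalf (badd (e7 x) (e7 y))) (bhalf (badd (e7 y) (bneg (e7 x)))) = vr c"
    by (simp add: enc_add enc_neg mkrec_enc c_def)
  define ks where "ks = concat (map (kc c) cs)"
  define t' t1' t2' where "t' = bumps (map encp ks) t" and "t1' = bump_key (vr c) t1" and "t2' = bump_dkey (vr c) t2"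
  have "stuck2 r (vr c) (map vr cs) t t1 t2 (map encp ks)"
    using st[unfolded stuck.simps mk, folded r_def, unfolded eqTrueI[OF cc]]
    by (simp only: stuck1.simps pair_keys_enc ks_def)
  then have ne: "no_ext (no_ext True (map encp ks) r (map vr (c # cs)) t' t1' t2') (heavy r t) r (map vr (c # cs)) t' t1' t2'"
    by (simp add: t'_def t1'_def t2'_def)
  then have ne1: "no_ext True (map encp ks) r (map vr (c # cs)) t' t1' t2'"
    by (cases "no_ext True (map encp ks) r (map vr (c # cs)) t' t1' t2'") (simp_all only: no_ext.simps)
  with ne have ne2: "no_ext True (heavy r t) r (map vr (c # cs)) t' t1' t2'" by simp
  have kb: "\<forall>k\<in>set ks. bnd 63 k"
    using b8 b24 bnd_kc[of 24 c 8 _ 63] by (auto simp: ks_def zc)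
  have look': "lookp p t' = count_list (map encp ks) (encp p) + lookp p t" for p
    by (simp add: t'_def lookp_bumps)
  have rep': "rep t' t1' t2' (c # cs)"
    unfolding rep_def
  proof (intro conjI ballI allI)
    show "distinct (c # cs)" using rep cn by (simp add: rep_def)
    show "kmem t1' (c # cs)" "dkmem t2' (c # cs)"
      using rep by (simp_all add: rep_def t1'_def t2'_def kmem_bump dkmem_bump)
    show "bnd 63 (zk d)" if "d \<in> set (c # cs)" for d
      using that rep b24 bnd_mono[of 24 "(x, y)" 63] by (auto simp: rep_def zc)
    show "bnd 63 k" if "k \<in> set (allk (c # cs))" for k
      using that rep kb by (auto simp: rep_def ks_def)
    show "lookp p t' = count_list (map encp (allk (c # cs))) (encp p)" for p
      using rep unfolding look' by (simp add: rep_def ks_def)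
  qed
  have P: "?P = loc ` set (c # cs)" by (simp add: lc)
  show ?thesis
  proof (rule goodI)
    show "finite ?P" "card ?P = Suc k" using card by simp_all
    have "S_rt ?P < ub (Suc k)" using S cond(2) by (simp add: ub_diff_def)
    then show "final (Suc k) ?P" using cond(1) by (simp add: final_def)
  next
    fix u assume u: "ext (Suc k) ?P u"
    have "0 < deg (insert u ?P) u" using u by (simp add: ext_def)
    then obtain m where m: "m \<in> set (allk (c # cs))" "u = hl m"
      using deg_pos_key[of u "c # cs"] rep' unfolding P by (auto simp: rep_def)
    have mb: "bnd 63 m" using m rep' by (auto simp: rep_def)
    have un: "u \<notin> ?P" using u by (simp add: ext_def)
    then have "S_rt (insert u ?P) = S_rt ?P + deg (insert u ?P) u" by (intro S_rt_insert) auto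
    moreover have "th (Suc (Suc k)) \<le> S_rt (insert u ?P)" using u by (simp add: ext_def)
    ultimately have rd: "r \<le> deg (insert u ?P) u"
      using S unfolding r_def th_diff_def by linarith
    have "\<exists>w\<in>?P. deg (insert u ?P) w < deg (insert u ?P) u"
    proof (cases "m \<in> set ks")
      case True
      then show ?thesis
        using rep_no_ext[OF rep' ne1, of m] mb rd un m(2) unfolding P by simp
    next
      case False
      have "encp m \<notin> set (map encp ks)" using False kb mb encp_inj[of m] by auto
      then have "count_list (map encp ks) (encp m) = 0" by (metis count_list_0_iff)
      then have "lookp m t' = lookp m t" by (simp add: look')
      moreover have "deg (insert u ?P) u = lookp m t'"
        using rep_deg[OF rep' mb] m(2) unfolding P by simp
      ultimately have "encp m \<in> set (heavy r t)"
        using rd cond(3) by (intro heavy_complete) simp_all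
      then show ?thesis
        using rep_no_ext[OF rep' ne2, of m] mb rd un m(2) unfolding P by simp
    qed
    moreover have "\<forall>w\<in>?P. deg (insert u ?P) u \<le> deg (insert u ?P) w"
      using u cond(1) by (simp add: ext_def)
    ultimately show "good (Suc (Suc k)) (insert u ?P)" by fastforce
  qed
qed

section \<open>Similarities of the plane and their integer counterparts\<close>

lemma bsim_conj: "bsim (\<lambda>z. (fst z, - snd z))"
proof -
  have "similarity (\<lambda>z. (fst z, - snd z))"
    unfolding similarity_def by (intro exI[of _ 1]) (simp add: dist_prod_def dist_real_def abs_minus_commute)
  moreover have "bij (\<lambda>z::point. (fst z, - snd z))" by (rule involuntory_imp_bij) simp
  ultimately show ?thesis by (simp add: bsim_def)
qed

definition turn_real :: "bool \<Rightarrow> point \<Rightarrow> point" where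
  "turn_real sc z = (if sc then (fst z - snd z, fst z + snd z) else z)"

definition move_real :: "bool \<Rightarrow> bool \<Rightarrow> bool \<Rightarrow> int \<Rightarrow> int \<Rightarrow> point \<Rightarrow> point" where
  "move_real a b c s t z = (let w = if a then (snd z, fst z) else z in
     ((if b then - fst w else fst w) + of_int s, (if c then - snd w else snd w) + of_int t))"

lemma bsim_id: "bsim (\<lambda>z. z)"
  using bsim_affine[of 1 0 0 0] by simp

lemma bsim_turn_real: "bsim (turn_real sc)"
  using bsim_affine[of 1 1 0 0] bsim_id by (cases sc) (simp_all add: turn_real_def[abs_def])

lemma bsim_move_real: "bsim (move_real a b c s t)"
proof -
  let ?sw = "\<lambda>z::point. if a then (snd z, fst z) else z"
  let ?ng = "\<lambda>z::point. (if b then - fst z else fst z, if c then - snd z else snd z)"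
  let ?sh = "\<lambda>z::point. (of_int s + fst z, of_int t + snd z)"
  have sw: "bsim ?sw"
    using bsim_comp[OF bsim_affine[of 0 1 0 0] bsim_conj] bsim_id by (cases a) (simp_all add: comp_def)
  have neg: "bsim (\<lambda>z. (- fst z, - snd z))" using bsim_affine[of "-1" 0 0 0] by simp
  then have "bsim (\<lambda>z. (- fst z, snd z))" using bsim_comp[OF neg bsim_conj] by (simp add: comp_def)
  then have ng: "bsim ?ng" using neg bsim_conj bsim_id by (cases b; cases c) simp_all
  have sh: "bsim ?sh" using bsim_affine[of 1 0 "of_int s" "of_int t"] by simp
  have "move_real a b c s t = ?sh \<circ> (?ng \<circ> ?sw)"
    by (auto simp: move_real_def Let_def fun_eq_iff)
  then show ?thesis using bsim_comp[OF sh bsim_comp[OF ng sw]] by simp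
qed

definition turn_int :: "bool \<Rightarrow> int \<times> int \<Rightarrow> int \<times> int" where
  "turn_int sc p = (if sc then (fst p + - snd p, fst p + snd p) else p)"

definition half_int :: "int \<times> int \<Rightarrow> int \<times> int" where
  "half_int p = (fst p div 2, snd p div 2)"

definition move_int :: "bool \<Rightarrow> bool \<Rightarrow> bool \<Rightarrow> int \<Rightarrow> int \<Rightarrow> int \<times> int \<Rightarrow> int \<times> int" where
  "move_int a b c s t z = (let w = if a then (snd z, fst z) else z in
     ((if b then - fst w else fst w) + s, (if c then - snd w else snd w) + t))"

lemma ri_move_int: "ri (move_int a b c s t p) = move_real a b c s t (ri p)"
  by (simp add: ri_def move_int_def move_real_def Let_def)

lemma ri_turn_int: "ri (turn_int sc p) = turn_real sc (ri p)"
  by (simp add: ri_def turn_int_def turn_real_def)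

lemma moves_enc: "moves a b c (e7 s) (e7 t) (map encp ps) = map encp (map (move_int a b c s t) ps)"
proof (induction ps)
  case (Cons p ps)
  then show ?case
    by (cases p; cases a; cases b; cases c) (simp_all add: encp_def move_int_def enc_add enc_neg)
qed simp

lemma turn_enc: "turn (map encp ps) = map encp (map (turn_int True) ps)"
  by (induction ps) (auto simp: encp_def turn_int_def enc_add enc_neg)

lemma add_point_enc:
  assumes "\<bar>x\<bar> \<le> 24" "\<bar>y\<bar> \<le> 24"
  shows "add_point sc (e7 x) (e7 y) (map encp ps) =
    map encp (half_int (turn_int sc (x, y)) # map (turn_int sc) ps)"
proof -
  have "bhalf (e7 (x + y)) = e7 ((x + y) div 2)" "bhalf (e7 (x + - y)) = e7 ((x + - y) div 2)"
    "bhalf (e7 x) = e7 (x div 2)" "bhalf (e7 y) = e7 (y div 2)"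
    using assms by (intro e7_half; auto)+
  then show ?thesis
    by (cases sc) (simp_all add: turn_enc encp_def half_int_def turn_int_def enc_add enc_neg)
qed

lemma ri_half_int: "integral sc (e7 x) (e7 y) \<Longrightarrow> ri (half_int (turn_int sc (x, y))) = turn_real sc (hl (x, y))"
  by (cases sc) (auto simp: e7_even enc_add ri_def half_int_def turn_int_def turn_real_def hl_def
      real_of_int_div field_simps elim!: evenE)

lemma set_psort: "set (psort ps) = set ps"
proof -
  have "set (pinsert p qs) = insert p (set qs)" for p qs
    by (induction p qs rule: pinsert.induct) auto
  then show ?thesis by (induction ps) auto
qed

lemma length_psort: "length (psort ps) = length ps"
proof -
  have "length (pinsert p qs) = Suc (length qs)" for p qs
    by (induction p qs rule: pinsert.induct) auto
  then show ?thesis by (induction ps) auto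
qed

text \<open>Nothing about the certificate is trusted. Whatever similarity it names, the image of the
  enlarged set has the same number of points and triangles; equality of the sorted words identifies
  this image with the set of the node, and \<open>good\<close> is carried back by the
  inverse.\<close>

lemma good_of_move:
  assumes n: "node (Suc k) e (psort (moves a b c (e7 s) (e7 t) (add_point sc (e7 x) (e7 y) (map encp ps))))"
    and int: "integral sc (e7 x) (e7 y)"
    and b24: "bnd 24 (x, y)" and st: "\<bar>s\<bar> \<le> 31" "\<bar>t\<bar> \<le> 31"
    and ps: "distinct ps" "\<forall>p\<in>set ps. bnd 4 p" "length ps = k" "hl (x, y) \<notin> ri ` set ps"
    and S: "S_rt (insert (hl (x, y)) (ri ` set ps)) = th (Suc k) + e"
  shows "good (Suc k) (insert (hl (x, y)) (ri ` set ps))"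
proof -
  let ?P = "insert (hl (x, y)) (ri ` set ps)"
  define f where "f = move_real a b c s t \<circ> turn_real sc"
  have f: "bsim f" unfolding f_def by (intro bsim_comp bsim_move_real bsim_turn_real)
  then have bf: "bij f" by (simp add: bsim_def)
  define qs where "qs = map (move_int a b c s t) (half_int (turn_int sc (x, y)) # map (turn_int sc) ps)"
  have xy: "\<bar>x\<bar> \<le> 24" "\<bar>y\<bar> \<le> 24" using b24 by (auto simp: bnd_def)
  have ws: "moves a b c (e7 s) (e7 t) (add_point sc (e7 x) (e7 y) (map encp ps)) = map encp qs"
    unfolding add_point_enc[OF xy] moves_enc qs_def ..
  have ri_qs: "ri ` set qs = f ` ?P"
    by (simp add: qs_def f_def image_image ri_move_int ri_turn_int ri_half_int[OF int])
  \<comment> \<open>Before the shift coordinates are at most 24 in absolute value, and the shift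
    adds at most 31.\<close>
  have bq: "bnd 63 q" if q: "q \<in> set qs" for q
  proof -
    obtain p where p: "q = move_int a b c s t p" "p = half_int (turn_int sc (x, y)) \<or> p \<in> turn_int sc ` set ps"
    proof -
      have "q \<in> move_int a b c s t ` insert (half_int (turn_int sc (x, y))) (turn_int sc ` set ps)"
        using q by (simp add: qs_def image_image)
      then show ?thesis using that by blast
    qed
    have "bnd 8 (turn_int sc p')" if "p' \<in> set ps" for p'
      using ps(2) that by (cases sc) (auto simp: bnd_def turn_int_def)
    moreover have "bnd 24 (half_int (turn_int sc (x, y)))"
      using xy by (cases sc) (auto simp: bnd_def half_int_def turn_int_def)
    ultimately have "bnd 24 p" using p(2) bnd_mono[of 8 p 24] by fastforce
    then show ?thesis using st unfolding p(1) by (auto simp: bnd_def move_int_def Let_def)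
  qed
  obtain rs where rs: "psort (map encp qs) = map encp rs" "\<forall>p\<in>set rs. bnd 4 p"
    "length rs = Suc k \<longrightarrow> distinct rs \<longrightarrow> S_rt (ri ` set rs) = th (Suc k) + e \<longrightarrow> good (Suc k) (ri ` set rs)"
    using n unfolding node_def ws by blast
  have "encp ` set rs = encp ` set qs"
    using set_psort[of "map encp qs"] by (simp add: rs(1))
  moreover have "bnd 63 r" if "r \<in> set rs" for r using rs(2) that bnd_mono[of 4 r 63] by simp
  ultimately have seteq: "set rs = set qs"
    using bq encp_inj by (intro inj_on_image_eq_iff[of encp "set rs \<union> set qs", THEN iffD1]) (auto simp: inj_on_def)
  have len: "length rs = Suc k"
    using length_psort[of "map encp qs"] ps(3) by (simp add: rs(1)) (simp add: qs_def)
  have "card ?P = Suc k"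
    using ps by (simp add: card_image inj_on_def ri_inj distinct_card)
  then have "card (ri ` set rs) = Suc k"
    unfolding seteq ri_qs using card_image[OF inj_on_subset[OF bij_is_inj[OF bf] subset_UNIV]]
    by (simp del: image_insert)
  then have "card (set rs) = length rs"
    using len by (simp add: card_image inj_on_def ri_inj)
  then have "distinct rs" by (rule card_distinct)
  moreover have "S_rt (ri ` set rs) = th (Suc k) + e"
    unfolding seteq ri_qs deg_image(2)[OF f] by (rule S)
  ultimately have "good (Suc k) (f ` ?P)" using rs(3) len unfolding seteq ri_qs by blast
  then have "good (Suc k) (inv f ` (f ` ?P))" by (rule good_image) (rule bsim_inv[OF f])
  then show ?thesis unfolding inv_image[OF bf] .
qed

definition shift_ok :: "disp \<Rightarrow> bool" where
  "shift_ok d \<longleftrightarrow> (\<forall>sc a b c x y. d = DM sc a b c x y \<longrightarrow>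
     (\<exists>s t. x = e7 s \<and> y = e7 t \<and> \<bar>s\<bar> \<le> 31 \<and> \<bar>t\<bar> \<le> 31))"

lemma letter_bound: "\<exists>s. letter c = e7 s \<and> \<bar>s\<bar> \<le> 31"
proof -
  have "\<bar>max (- 31) (min 30 z)\<bar> \<le> 31" for z :: int by auto
  then show ?thesis unfolding letter.simps by blast
qed

lemma parse_shift_ok: "\<forall>d\<in>set (parse cs). shift_ok d" "\<forall>d\<in>set (parse1 op cs). shift_ok d"
proof (induction cs and op cs rule: parse_parse1.induct)
  case (3 sc a b c x y t u cs)
  then show ?case using letter_bound[of t] letter_bound[of u] by (auto simp: shift_ok_def)
qed (auto simp: shift_ok_def)

lemma runD: "run True k e ws rs t t1 t2 hs ds \<Longrightarrow> h \<in> set hs \<Longrightarrow> \<exists>d\<in>set ds. disposed k e ws rs t t1 t2 h d"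
proof (induction hs arbitrary: ds)
  case (Cons g hs)
  obtain d ds' where ds: "ds = d # ds'" using Cons.prems(1) by (cases ds) simp_all
  then have "run (disposed k e ws rs t t1 t2 g d) k e ws rs t t1 t2 hs ds'" using Cons.prems(1) by simp
  then have d: "disposed k e ws rs t t1 t2 g d" by (cases "disposed k e ws rs t t1 t2 g d") simp_all
  then have "run True k e ws rs t t1 t2 hs ds'" using Cons.prems(1) ds by simp
  then show ?case using Cons d ds by auto
qed simp

lemma small_coordsD: "small_coords ws \<Longrightarrow> \<exists>ps. ws = map encp ps \<and> (\<forall>p\<in>set ps. bnd 4 p)"
proof (induction ws rule: small_coords.induct)
  case (2 x y ws)
  then obtain a b ps where "x = e7 a" "y = e7 b" "\<bar>a\<bar> \<le> 4" "\<bar>b\<bar> \<le> 4" "ws = map encp ps" "\<forall>p\<in>set ps. bnd 4 p"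
    by (auto simp: small_coord_def)
  then show ?case by (intro exI[of _ "(a, b) # ps"]) (auto simp: encp_def bnd_def)
qed simp

text \<open>An extension point has positive degree, so it has a key; reaching the next threshold
  makes this key heavy, and \<open>run\<close> has matched every heavy key with an entry. Entries
  \<open>DP\<close> and \<open>DR\<close> contradict \<open>ext\<close>; \<open>DS\<close> and
  \<open>DM\<close> give \<open>good\<close> for the enlarged set.\<close>

lemma node_of_checks:
  assumes "checks k e ws ds" "\<forall>d\<in>set ds. shift_ok d"
  shows "node k e ws"
proof -
  obtain ps where ps: "ws = map encp ps" "\<forall>p\<in>set ps. bnd 4 p"
    using assms(1) small_coordsD by (auto simp: checks_def)
  have k: "3 \<le> k" "k < 14" using assms(1) by (auto simp: checks_def level_def)
  have "good k (ri ` set ps)" if len: "length ps = k" and d: "distinct ps" and S: "S_rt (ri ` set ps) = th k + e"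
  proof (rule goodI)
    show "finite (ri ` set ps)" by simp
    show "card (ri ` set ps) = k" using len d by (simp add: card_image inj_on_def ri_inj distinct_card)
    show "final k (ri ` set ps)"
      using assms(1) ps S k by (intro final_of_final_ok[of _ e]) (auto simp: checks_def)
  next
    fix v assume v: "ext k (ri ` set ps) v"
    define cs where "cs = map cof ps"
    define t t1 t2 where "t = degree_trie (map vr cs)" and "t1 = key_trie (map vr cs)" and "t2 = dkey_trie (map vr cs)"
    have rep: "rep t t1 t2 cs" and b8: "\<forall>c\<in>set cs. bnd 8 (zk c)" and b24: "\<forall>k\<in>set (allk cs). bnd 24 k"
      and img: "loc ` set cs = ri ` set ps"
      using rep_node[OF d ps(2)] by (simp_all add: cs_def t_def t1_def t2_def)
    let ?P = "ri ` set ps"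
    have dist: "distinct cs" using rep by (simp add: rep_def)
    have vn: "v \<notin> ?P" and dpos: "0 < deg (insert v ?P) v" using v by (auto simp: ext_def)
    have "0 < deg (insert v (loc ` set cs)) v" using dpos by (simp add: img)
    then obtain m where m: "m \<in> set (allk cs)" "v = hl m"
      using deg_pos_key dist by blast
    obtain x y where xy: "m = (x, y)" by (cases m)
    have mb: "bnd 24 m" "bnd 63 m" using m b24 bnd_mono[of 24 m 63] by auto
    have D: "deg (insert v ?P) v = lookp m t"
      using rep_deg[OF rep mb(2)] m(2) by (simp add: img)
    have Si: "S_rt (insert v ?P) = th k + e + lookp m t"
      using S_rt_insert[of ?P v] vn S D by simp
    moreover have "th (Suc k) \<le> S_rt (insert v ?P)" using v by (simp add: ext_def)
    ultimately have th: "th (Suc k) \<le> th k + e + lookp m t" by simp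
    have th_le: "th k \<le> th (Suc k)"
    proof -
      have "k = 3 \<or> k = 4 \<or> k = 5 \<or> k = 6 \<or> k = 7 \<or> k = 8 \<or> k = 9 \<or> k = 10 \<or> k = 11 \<or> k = 12 \<or> k = 13"
        using k by presburger
      then show ?thesis by (auto simp: th_def)
    qed
    define e' where "e' = e + lookp m t - th_diff k"
    have Se: "S_rt (insert v ?P) = th (Suc k) + e'"
      using Si th th_le by (simp add: e'_def th_diff_def)
    have "pos (th_diff k - e) \<le> lookp m t"
      using th dpos D by (cases "th_diff k - e") (auto simp: th_diff_def)
    moreover have "0 < pos (th_diff k - e)"
      by (cases "th_diff k - e") auto
    ultimately have "encp m \<in> set (heavy (pos (th_diff k - e)) t)" by (intro heavy_complete)
    moreover have "run True k e ws (map vr cs) t t1 t2 (heavy (pos (th_diff k - e)) t) ds"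
      using assms(1) by (simp add: checks_def run1_def run2_def ps(1) node_recs_enc cs_def t_def t1_def t2_def)
    ultimately obtain dd where dd: "dd \<in> set ds" "disposed k e ws (map vr cs) t t1 t2 (encp m) dd"
      using runD by blast
    have enc: "encp m = (e7 x, e7 y)" by (simp add: encp_def xy)
    have lk: "look2 (e7 x) (e7 y) t' = lookp m t'" for t' by (simp add: lookp_def xy)
    show "good (Suc k) (insert v ?P)"
    proof (cases dd)
      case DP
      then have "Suc 0 \<le> lookp m t1" using dd(2) unfolding enc by (simp add: lk)
      then have "v \<in> ?P" using rep_mem[OF rep mb(2)] m(2) by (simp add: img)
      then show ?thesis using vn by simp
    next
      case DR
      then have "dead (late k) (e7 x) (e7 y) (map vr cs) t t1 t2" using dd(2) unfolding enc by simp
      then have "late k" "not_min False (map vr cs) (uk m) (lookp m t) t t1 t2"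
        by (cases "late k"; simp add: mkukey_enc lk xy)+
      then have "\<exists>w\<in>?P. deg (insert v ?P) w < deg (insert v ?P) v"
        using rep_not_min[OF rep mb(2)] vn m(2) by (simp add: img)
      then show ?thesis using v \<open>late k\<close> by (fastforce simp: ext_def late_def)
    next
      case DS
      then have "stuck k e' (e7 x) (e7 y) (map vr cs) t t1 t2"
        using dd(2) unfolding enc by (simp add: lk e'_def del: stuck.simps)
      moreover have "card (insert v ?P) = Suc k"
        using vn len d by (simp add: card_image inj_on_def ri_inj distinct_card)
      ultimately show ?thesis
        using good_of_stuck[OF rep b8, of x y k e'] mb(1) vn Se unfolding img m(2) xy by blast
    next
      case (DM sc a b c tx ty)
      then obtain s t' where st: "tx = e7 s" "ty = e7 t'" "\<bar>s\<bar> \<le> 31" "\<bar>t'\<bar> \<le> 31"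
        using dd(1) assms(2) unfolding shift_ok_def by blast
      have "integral sc (e7 x) (e7 y)"
        "node (Suc k) e' (psort (moves a b c (e7 s) (e7 t') (add_point sc (e7 x) (e7 y) (map encp ps))))"
        using dd(2) unfolding enc DM by (simp_all add: lk e'_def st ps(1))
      then show ?thesis
        using good_of_move[of k e' a b c s t' sc x y ps] mb(1) st ps d len vn Se unfolding m(2) xy by blast
    qed
  qed
  then show ?thesis unfolding node_def using ps by blast
qed

lemma node_of_check: "check k e p c \<Longrightarrow> node k e (points p)"
  unfolding check_def using node_of_checks parse_shift_ok(1) by blast

lemma good_of_node:
  assumes "node k e (map encp ps)" "\<forall>p\<in>set ps. bnd 4 p" "distinct ps" "length ps = k" "S_rt (ri ` set ps) = th k + e"
  shows "good k (ri ` set ps)"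
proof -
  obtain qs where qs: "map encp ps = map encp qs" "\<forall>p\<in>set qs. bnd 4 p"
    "length qs = k \<longrightarrow> distinct qs \<longrightarrow> S_rt (ri ` set qs) = th k + e \<longrightarrow> good k (ri ` set qs)"
    using assms(1) unfolding node_def by blast
  have "inj_on encp (set ps \<union> set qs)"
    using assms(2) qs(2) bnd_mono[of 4 _ 63] encp_inj unfolding inj_on_def by auto
  then have "ps = qs" using qs(1) map_inj_on by blast
  then show ?thesis using assms qs(3) by blast
qed

subsection \<open>Rewrite rules for the evaluation of checks\<close>

lemma enc7: "e7 z = enc (Suc (Suc (Suc (Suc (Suc (Suc (Suc 0))))))) z"
  by (simp add: eval_nat_numeral)

lemma letter_code:
  "letter CHR ''A'' = B1 (B0 (B0 (B0 (B0 (B1 (B1 End))))))"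
  "letter CHR ''B'' = B0 (B1 (B0 (B0 (B0 (B1 (B1 End))))))"
  "letter CHR ''C'' = B1 (B1 (B0 (B0 (B0 (B1 (B1 End))))))"
  "letter CHR ''D'' = B0 (B0 (B1 (B0 (B0 (B1 (B1 End))))))"
  "letter CHR ''E'' = B1 (B0 (B1 (B0 (B0 (B1 (B1 End))))))"
  "letter CHR ''F'' = B0 (B1 (B1 (B0 (B0 (B1 (B1 End))))))"
  "letter CHR ''G'' = B1 (B1 (B1 (B0 (B0 (B1 (B1 End))))))"
  "letter CHR ''H'' = B0 (B0 (B0 (B1 (B0 (B1 (B1 End))))))"
  "letter CHR ''I'' = B1 (B0 (B0 (B1 (B0 (B1 (B1 End))))))"
  "letter CHR ''J'' = B0 (B1 (B0 (B1 (B0 (B1 (B1 End))))))"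
  "letter CHR ''K'' = B1 (B1 (B0 (B1 (B0 (B1 (B1 End))))))"
  "letter CHR ''L'' = B0 (B0 (B1 (B1 (B0 (B1 (B1 End))))))"
  "letter CHR ''M'' = B1 (B0 (B1 (B1 (B0 (B1 (B1 End))))))"
  "letter CHR ''N'' = B0 (B1 (B1 (B1 (B0 (B1 (B1 End))))))"
  "letter CHR ''O'' = B1 (B1 (B1 (B1 (B0 (B1 (B1 End))))))"
  "letter CHR ''P'' = B0 (B0 (B0 (B0 (B1 (B1 (B1 End))))))"
  "letter CHR ''Q'' = B1 (B0 (B0 (B0 (B1 (B1 (B1 End))))))"
  "letter CHR ''R'' = B0 (B1 (B0 (B0 (B1 (B1 (B1 End))))))"
  "letter CHR ''S'' = B1 (B1 (B0 (B0 (B1 (B1 (B1 End))))))"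
  "letter CHR ''T'' = B0 (B0 (B1 (B0 (B1 (B1 (B1 End))))))"
  "letter CHR ''U'' = B1 (B0 (B1 (B0 (B1 (B1 (B1 End))))))"
  "letter CHR ''V'' = B0 (B1 (B1 (B0 (B1 (B1 (B1 End))))))"
  "letter CHR ''W'' = B1 (B1 (B1 (B0 (B1 (B1 (B1 End))))))"
  "letter CHR ''X'' = B0 (B0 (B0 (B1 (B1 (B1 (B1 End))))))"
  "letter CHR ''Y'' = B1 (B0 (B0 (B1 (B1 (B1 (B1 End))))))"
  "letter CHR ''Z'' = B0 (B1 (B0 (B1 (B1 (B1 (B1 End))))))"
  "letter CHR ''a'' = B1 (B1 (B0 (B1 (B1 (B1 (B1 End))))))"
  "letter CHR ''b'' = B0 (B0 (B1 (B1 (B1 (B1 (B1 End))))))"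
  "letter CHR ''c'' = B1 (B0 (B1 (B1 (B1 (B1 (B1 End))))))"
  "letter CHR ''d'' = B0 (B1 (B1 (B1 (B1 (B1 (B1 End))))))"
  "letter CHR ''e'' = B1 (B1 (B1 (B1 (B1 (B1 (B1 End))))))"
  "letter CHR ''f'' = B0 (B0 (B0 (B0 (B0 (B0 (B0 End))))))"
  "letter CHR ''g'' = B1 (B0 (B0 (B0 (B0 (B0 (B0 End))))))"
  "letter CHR ''h'' = B0 (B1 (B0 (B0 (B0 (B0 (B0 End))))))"
  "letter CHR ''i'' = B1 (B1 (B0 (B0 (B0 (B0 (B0 End))))))"
  "letter CHR ''j'' = B0 (B0 (B1 (B0 (B0 (B0 (B0 End))))))"
  "letter CHR ''k'' = B1 (B0 (B1 (B0 (B0 (B0 (B0 End))))))"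
  "letter CHR ''l'' = B0 (B1 (B1 (B0 (B0 (B0 (B0 End))))))"
  "letter CHR ''m'' = B1 (B1 (B1 (B0 (B0 (B0 (B0 End))))))"
  "letter CHR ''n'' = B0 (B0 (B0 (B1 (B0 (B0 (B0 End))))))"
  "letter CHR ''o'' = B1 (B0 (B0 (B1 (B0 (B0 (B0 End))))))"
  "letter CHR ''p'' = B0 (B1 (B0 (B1 (B0 (B0 (B0 End))))))"
  "letter CHR ''q'' = B1 (B1 (B0 (B1 (B0 (B0 (B0 End))))))"
  "letter CHR ''r'' = B0 (B0 (B1 (B1 (B0 (B0 (B0 End))))))"
  "letter CHR ''s'' = B1 (B0 (B1 (B1 (B0 (B0 (B0 End))))))"
  "letter CHR ''t'' = B0 (B1 (B1 (B1 (B0 (B0 (B0 End))))))"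
  "letter CHR ''u'' = B1 (B1 (B1 (B1 (B0 (B0 (B0 End))))))"
  "letter CHR ''v'' = B0 (B0 (B0 (B0 (B1 (B0 (B0 End))))))"
  "letter CHR ''w'' = B1 (B0 (B0 (B0 (B1 (B0 (B0 End))))))"
  "letter CHR ''x'' = B0 (B1 (B0 (B0 (B1 (B0 (B0 End))))))"
  "letter CHR ''y'' = B1 (B1 (B0 (B0 (B1 (B0 (B0 End))))))"
  "letter CHR ''z'' = B0 (B0 (B1 (B0 (B1 (B0 (B0 End))))))"
  "letter CHR ''0'' = B1 (B0 (B1 (B0 (B1 (B0 (B0 End))))))"
  "letter CHR ''1'' = B0 (B1 (B1 (B0 (B1 (B0 (B0 End))))))"
  "letter CHR ''2'' = B1 (B1 (B1 (B0 (B1 (B0 (B0 End))))))"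
  "letter CHR ''3'' = B0 (B0 (B0 (B1 (B1 (B0 (B0 End))))))"
  "letter CHR ''4'' = B1 (B0 (B0 (B1 (B1 (B0 (B0 End))))))"
  "letter CHR ''5'' = B0 (B1 (B0 (B1 (B1 (B0 (B0 End))))))"
  "letter CHR ''6'' = B1 (B1 (B0 (B1 (B1 (B0 (B0 End))))))"
  "letter CHR ''7'' = B0 (B0 (B1 (B1 (B1 (B0 (B0 End))))))"
  "letter CHR ''8'' = B1 (B0 (B1 (B1 (B1 (B0 (B0 End))))))"
  "letter CHR ''9'' = B0 (B1 (B1 (B1 (B1 (B0 (B0 End))))))"
  by (simp_all add: enc7)

lemma op_code:
  "op_of CHR ''p'' = DP"
  "op_of CHR ''r'' = DR"
  "op_of CHR ''s'' = DS"
  "op_of CHR ''A'' = DM False False False False End End"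
  "op_of CHR ''S'' = DM True False False False End End"
  "op_of CHR ''B'' = DM False False False True End End"
  "op_of CHR ''T'' = DM True False False True End End"
  "op_of CHR ''C'' = DM False False True False End End"
  "op_of CHR ''U'' = DM True False True False End End"
  "op_of CHR ''D'' = DM False False True True End End"
  "op_of CHR ''V'' = DM True False True True End End"
  "op_of CHR ''E'' = DM False True False False End End"
  "op_of CHR ''W'' = DM True True False False End End"
  "op_of CHR ''F'' = DM False True False True End End"
  "op_of CHR ''X'' = DM True True False True End End"
  "op_of CHR ''G'' = DM False True True False End End"
  "op_of CHR ''Y'' = DM True True True False End End"
  "op_of CHR ''H'' = DM False True True True End End"
  "op_of CHR ''Z'' = DM True True True True End End"
  by simp_all

lemma small_coord_enc: "- 4 \<le> z \<Longrightarrow> z \<le> 4 \<Longrightarrow> small_coord (e7 z)"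
  by (simp add: small_coord_def)

lemmas small_code =
  small_coord_enc[of "-4", unfolded enc7, simplified]
  small_coord_enc[of "-3", unfolded enc7, simplified]
  small_coord_enc[of "-2", unfolded enc7, simplified]
  small_coord_enc[of "-1", unfolded enc7, simplified]
  small_coord_enc[of "0", unfolded enc7, simplified]
  small_coord_enc[of "1", unfolded enc7, simplified]
  small_coord_enc[of "2", unfolded enc7, simplified]
  small_coord_enc[of "3", unfolded enc7, simplified]
  small_coord_enc[of "4", unfolded enc7, simplified]

text \<open>A marker on numerals: \<open>un_code\<close> rewrites marked ones to \<open>Suc\<close>
  form, on which the unary arithmetic of \<open>nat_code\<close> operates.\<close>

definition un :: "nat \<Rightarrow> nat" where "un n = n"

lemma un_code:
  "un 0 = 0"
  "un 1 = Suc 0"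
  "un 2 = Suc (Suc 0)"
  "un 3 = Suc (Suc (Suc 0))"
  "un 4 = Suc (Suc (Suc (Suc 0)))"
  "un 5 = Suc (Suc (Suc (Suc (Suc 0))))"
  "un 6 = Suc (Suc (Suc (Suc (Suc (Suc 0)))))"
  "un 7 = Suc (Suc (Suc (Suc (Suc (Suc (Suc 0))))))"
  "un 8 = Suc (Suc (Suc (Suc (Suc (Suc (Suc (Suc 0)))))))"
  "un 9 = Suc (Suc (Suc (Suc (Suc (Suc (Suc (Suc (Suc 0))))))))"
  "un 10 = Suc (Suc (Suc (Suc (Suc (Suc (Suc (Suc (Suc (Suc 0)))))))))"
  "un 11 = Suc (Suc (Suc (Suc (Suc (Suc (Suc (Suc (Suc (Suc (Suc 0))))))))))"
  "un 12 = Suc (Suc (Suc (Suc (Suc (Suc (Suc (Suc (Suc (Suc (Suc (Suc 0)))))))))))"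
  "un 13 = Suc (Suc (Suc (Suc (Suc (Suc (Suc (Suc (Suc (Suc (Suc (Suc (Suc 0))))))))))))"
  "un 14 = Suc (Suc (Suc (Suc (Suc (Suc (Suc (Suc (Suc (Suc (Suc (Suc (Suc (Suc 0)))))))))))))"
  by (simp_all add: un_def)

lemma level_code:
  "level (Suc (Suc (Suc 0))) = True"
  "th_diff (Suc (Suc (Suc 0))) = Suc 0"
  "late (Suc (Suc (Suc 0))) = False"
  "ub_diff (Suc (Suc (Suc 0))) = 0"
  "spare (Suc (Suc (Suc 0))) = 0"
  "top_node (Suc (Suc (Suc 0))) (0) ws = True"
  "level (Suc (Suc (Suc (Suc 0)))) = True"
  "th_diff (Suc (Suc (Suc (Suc 0)))) = Suc 0"
  "late (Suc (Suc (Suc (Suc 0)))) = False"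
  "ub_diff (Suc (Suc (Suc (Suc 0)))) = Suc (Suc 0)"
  "spare (Suc (Suc (Suc (Suc 0)))) = Suc (Suc 0)"
  "top_node (Suc (Suc (Suc (Suc 0)))) (Suc (Suc 0)) ws = True"
  "level (Suc (Suc (Suc (Suc (Suc 0))))) = True"
  "th_diff (Suc (Suc (Suc (Suc (Suc 0))))) = Suc (Suc 0)"
  "late (Suc (Suc (Suc (Suc (Suc 0))))) = False"
  "ub_diff (Suc (Suc (Suc (Suc (Suc 0))))) = Suc (Suc (Suc (Suc (Suc 0))))"
  "spare (Suc (Suc (Suc (Suc (Suc 0))))) = Suc (Suc (Suc (Suc 0)))"
  "top_node (Suc (Suc (Suc (Suc (Suc 0))))) (Suc (Suc (Suc (Suc (Suc 0))))) ws = True"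
  "level (Suc (Suc (Suc (Suc (Suc (Suc 0)))))) = True"
  "th_diff (Suc (Suc (Suc (Suc (Suc (Suc 0)))))) = Suc (Suc (Suc (Suc 0)))"
  "late (Suc (Suc (Suc (Suc (Suc (Suc 0)))))) = False"
  "ub_diff (Suc (Suc (Suc (Suc (Suc (Suc 0)))))) = Suc (Suc (Suc (Suc (Suc (Suc 0)))))"
  "spare (Suc (Suc (Suc (Suc (Suc (Suc 0)))))) = Suc (Suc (Suc (Suc (Suc (Suc 0)))))"
  "top_node (Suc (Suc (Suc (Suc (Suc (Suc 0)))))) (Suc (Suc (Suc (Suc (Suc (Suc 0)))))) ws = True"
  "level (Suc (Suc (Suc (Suc (Suc (Suc (Suc 0))))))) = True"
  "th_diff (Suc (Suc (Suc (Suc (Suc (Suc (Suc 0))))))) = Suc (Suc (Suc (Suc 0)))"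
  "late (Suc (Suc (Suc (Suc (Suc (Suc (Suc 0))))))) = True"
  "ub_diff (Suc (Suc (Suc (Suc (Suc (Suc (Suc 0))))))) = Suc (Suc (Suc (Suc (Suc (Suc 0)))))"
  "spare (Suc (Suc (Suc (Suc (Suc (Suc (Suc 0))))))) = Suc (Suc (Suc (Suc (Suc (Suc 0)))))"
  "top_node (Suc (Suc (Suc (Suc (Suc (Suc (Suc 0))))))) (Suc (Suc (Suc (Suc (Suc (Suc 0)))))) ws = True"
  "level (Suc (Suc (Suc (Suc (Suc (Suc (Suc (Suc 0)))))))) = True"
  "th_diff (Suc (Suc (Suc (Suc (Suc (Suc (Suc (Suc 0)))))))) = Suc (Suc (Suc (Suc (Suc (Suc 0)))))"
  "late (Suc (Suc (Suc (Suc (Suc (Suc (Suc (Suc 0)))))))) = True"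
  "ub_diff (Suc (Suc (Suc (Suc (Suc (Suc (Suc (Suc 0)))))))) = Suc (Suc (Suc (Suc (Suc (Suc (Suc 0))))))"
  "spare (Suc (Suc (Suc (Suc (Suc (Suc (Suc (Suc 0)))))))) = Suc (Suc (Suc (Suc (Suc (Suc (Suc 0))))))"
  "top_node (Suc (Suc (Suc (Suc (Suc (Suc (Suc (Suc 0)))))))) (Suc (Suc (Suc (Suc (Suc (Suc (Suc 0))))))) ws = True"
  "level (Suc (Suc (Suc (Suc (Suc (Suc (Suc (Suc (Suc 0))))))))) = True"
  "th_diff (Suc (Suc (Suc (Suc (Suc (Suc (Suc (Suc (Suc 0))))))))) = Suc (Suc (Suc (Suc (Suc (Suc (Suc 0))))))"
  "late (Suc (Suc (Suc (Suc (Suc (Suc (Suc (Suc (Suc 0))))))))) = True"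
  "ub_diff (Suc (Suc (Suc (Suc (Suc (Suc (Suc (Suc (Suc 0))))))))) = Suc (Suc (Suc (Suc (Suc (Suc (Suc (Suc (Suc 0))))))))"
  "spare (Suc (Suc (Suc (Suc (Suc (Suc (Suc (Suc (Suc 0))))))))) = Suc (Suc (Suc (Suc (Suc (Suc (Suc (Suc (Suc 0))))))))"
  "top_node (Suc (Suc (Suc (Suc (Suc (Suc (Suc (Suc (Suc 0))))))))) (Suc (Suc (Suc (Suc (Suc (Suc (Suc (Suc (Suc 0))))))))) ws = True"
  "level (Suc (Suc (Suc (Suc (Suc (Suc (Suc (Suc (Suc (Suc 0)))))))))) = True"
  "th_diff (Suc (Suc (Suc (Suc (Suc (Suc (Suc (Suc (Suc (Suc 0)))))))))) = Suc (Suc (Suc (Suc (Suc (Suc (Suc (Suc (Suc 0))))))))"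
  "late (Suc (Suc (Suc (Suc (Suc (Suc (Suc (Suc (Suc (Suc 0)))))))))) = True"
  "ub_diff (Suc (Suc (Suc (Suc (Suc (Suc (Suc (Suc (Suc (Suc 0)))))))))) = Suc (Suc (Suc (Suc (Suc (Suc (Suc (Suc (Suc 0))))))))"
  "spare (Suc (Suc (Suc (Suc (Suc (Suc (Suc (Suc (Suc (Suc 0)))))))))) = Suc (Suc (Suc (Suc (Suc (Suc (Suc (Suc (Suc 0))))))))"
  "level (Suc (Suc (Suc (Suc (Suc (Suc (Suc (Suc (Suc (Suc (Suc 0))))))))))) = True"
  "th_diff (Suc (Suc (Suc (Suc (Suc (Suc (Suc (Suc (Suc (Suc (Suc 0))))))))))) = Suc (Suc (Suc (Suc (Suc (Suc (Suc (Suc (Suc (Suc (Suc 0))))))))))"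
  "late (Suc (Suc (Suc (Suc (Suc (Suc (Suc (Suc (Suc (Suc (Suc 0))))))))))) = True"
  "ub_diff (Suc (Suc (Suc (Suc (Suc (Suc (Suc (Suc (Suc (Suc (Suc 0))))))))))) = Suc (Suc (Suc (Suc (Suc (Suc (Suc (Suc 0)))))))"
  "spare (Suc (Suc (Suc (Suc (Suc (Suc (Suc (Suc (Suc (Suc (Suc 0))))))))))) = Suc (Suc (Suc (Suc (Suc (Suc (Suc (Suc 0)))))))"
  "level (Suc (Suc (Suc (Suc (Suc (Suc (Suc (Suc (Suc (Suc (Suc (Suc 0)))))))))))) = True"
  "th_diff (Suc (Suc (Suc (Suc (Suc (Suc (Suc (Suc (Suc (Suc (Suc (Suc 0)))))))))))) = Suc (Suc (Suc (Suc (Suc (Suc (Suc (Suc (Suc (Suc (Suc (Suc (Suc 0))))))))))))"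
  "late (Suc (Suc (Suc (Suc (Suc (Suc (Suc (Suc (Suc (Suc (Suc (Suc 0)))))))))))) = True"
  "ub_diff (Suc (Suc (Suc (Suc (Suc (Suc (Suc (Suc (Suc (Suc (Suc (Suc 0)))))))))))) = Suc (Suc (Suc (Suc (Suc (Suc 0)))))"
  "spare (Suc (Suc (Suc (Suc (Suc (Suc (Suc (Suc (Suc (Suc (Suc (Suc 0)))))))))))) = Suc (Suc (Suc (Suc (Suc (Suc 0)))))"
  "level (Suc (Suc (Suc (Suc (Suc (Suc (Suc (Suc (Suc (Suc (Suc (Suc (Suc 0))))))))))))) = True"
  "th_diff (Suc (Suc (Suc (Suc (Suc (Suc (Suc (Suc (Suc (Suc (Suc (Suc (Suc 0))))))))))))) = Suc (Suc (Suc (Suc (Suc (Suc (Suc (Suc (Suc (Suc (Suc (Suc (Suc (Suc (Suc 0))))))))))))))"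
  "late (Suc (Suc (Suc (Suc (Suc (Suc (Suc (Suc (Suc (Suc (Suc (Suc (Suc 0))))))))))))) = True"
  "ub_diff (Suc (Suc (Suc (Suc (Suc (Suc (Suc (Suc (Suc (Suc (Suc (Suc (Suc 0))))))))))))) = Suc (Suc (Suc (Suc (Suc 0))))"
  "spare (Suc (Suc (Suc (Suc (Suc (Suc (Suc (Suc (Suc (Suc (Suc (Suc (Suc 0))))))))))))) = Suc (Suc (Suc (Suc (Suc 0))))"
  "late (Suc (Suc (Suc (Suc (Suc (Suc (Suc (Suc (Suc (Suc (Suc (Suc (Suc (Suc 0)))))))))))))) = True"
  "ub_diff (Suc (Suc (Suc (Suc (Suc (Suc (Suc (Suc (Suc (Suc (Suc (Suc (Suc (Suc 0)))))))))))))) = 0"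
  "spare (Suc (Suc (Suc (Suc (Suc (Suc (Suc (Suc (Suc (Suc (Suc (Suc (Suc (Suc 0)))))))))))))) = 0"
  by (simp_all add: level_def late_def th_diff_def ub_diff_def spare_def top_node_def th_def ub_def)

lemma nat_code: "0 + n = (n::nat)" "Suc m + n = Suc (m + n)" "m - 0 = (m::nat)" "0 - n = (0::nat)"
  "Suc m - Suc n = m - n" "(0::nat) \<le> n" "Suc m \<le> Suc n \<longleftrightarrow> m \<le> n" "Suc m \<le> 0 \<longleftrightarrow> False"
  by simp_all

lemma bool_code: "(True \<and> P) = P" "(False \<and> P) = False" "(True \<or> P) = True" "(False \<or> P) = P"
  "(if True then a else b) = a" "(if False then a else b) = b"
  by simp_all

lemma check_code: "check k e p c = checks (un k) (un e) (points p) (parse c)"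
  by (simp add: check_def un_def)

lemma node_fact: "check k e p c \<Longrightarrow> node (un k) (un e) (points p)"
  unfolding un_def by (rule node_of_check)

lemmas code = nat_code bool_code check_code un_code level_code small_code op_code letter_code
  badd.simps badd1.simps bcompl.simps bneg.simps bsext.simps bhalf.simps beven.simps bump.simps
  bump2.simps look.simps look2.simps bumps.simps brev.simps split_path.simps cons_if.simps
  heavy_paths.simps split_paths.simps node_recs.simps pair_keys.simps degree_trie.simps
  bump_key.simps bump_dkey.simps key_trie.simps dkey_trie.simps codeg_bound.simps look_key.simps
  small_deg.simps not_min.simps excluded2.simps excluded1.simps no_ext.simps turn.simps
  add_point.simps integral.simps bneg_if.simps swap_if.simps flip_shift.simps moves.simps
  bless.simps bless2.simps pinsert.simps psort.simps pos.simps stuck3.simps stuck2.simps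
  stuck1.simps stuck.simps dead.simps disposed.simps run.simps small_coords.simps points.simps
  parse.simps parse1.simps
  heavy_def mkrec2_def mkrec_def mkukey2_def mkukey_def run2_def run1_def checks_def final_ok_def

lemmas node_code = un_code points.simps letter_code

subsection \<open>The extremal sets\<close>

text \<open>One list of small points suffices, because within the range the words determine the
  points.\<close>

lemma top_nodeI:
  assumes "e = ub_diff k" "\<forall>q\<in>set qs. bnd 4 q" "E \<in> extremal k" "bsim f" "f ` E = ri ` set qs"
  shows "top_node k e (map encp qs)"
  unfolding top_node_def
proof (intro conjI allI impI)
  fix ps assume ps: "map encp qs = map encp ps" "\<forall>p\<in>set ps. bnd 4 p"
  have "inj_on encp (set qs \<union> set ps)"
    using assms(2) ps(2) bnd_mono[of 4 _ 63] encp_inj unfolding inj_on_def by auto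
  then have "qs = ps" using ps(1) map_inj_on by blast
  then show "\<exists>E\<in>extremal k. \<exists>f. bsim f \<and> f ` E = ri ` set ps" using assms by blast
qed (rule assms(1))

lemma E13a_explicit: "E13a = {(0, 0), (0, 2), (0, -2), (0, 1), (0, -1), (2, 0), (-2, 0), (1, 0), (1, 1),
  (1, -1), (-1, 0), (-1, 1), (-1, -1)}"
proof
  show "E13a \<subseteq> {(0, 0), (0, 2), (0, -2), (0, 1), (0, -1), (2, 0), (-2, 0), (1, 0), (1, 1),
    (1, -1), (-1, 0), (-1, 1), (-1, -1)}"
  proof
    fix p assume "p \<in> E13a"
    then obtain x y where p: "p = (x, y)" "x \<in> \<int>" "y \<in> \<int>" "\<bar>x\<bar> + \<bar>y\<bar> \<le> 2"
      unfolding E13a_def by blast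
    then obtain i j where ij: "x = of_int i" "y = of_int j" by (auto elim!: Ints_cases)
    then have b: "\<bar>i\<bar> + \<bar>j\<bar> \<le> 2" using p(4) by linarith
    then have "i \<in> {-2, -1, 0, 1, 2}" "j \<in> {-2, -1, 0, 1, 2}" by (auto; presburger)+
    then show "p \<in> {(0, 0), (0, 2), (0, -2), (0, 1), (0, -1), (2, 0), (-2, 0), (1, 0), (1, 1),
      (1, -1), (-1, 0), (-1, 1), (-1, -1)}"
      using b by (elim insertE emptyE) (simp_all add: p(1) ij)
  qed
qed (auto simp: E13a_def)

lemma E12b_explicit: "E12b = {(0, 1), (0, 2), (1, 0), (1, 1), (1, 2), (1, 3), (2, 0), (2, 1), (2, 2),
  (2, 3), (3, 1), (3, 2)}"
proof
  show "E12b \<subseteq> {(0, 1), (0, 2), (1, 0), (1, 1), (1, 2), (1, 3), (2, 0), (2, 1), (2, 2), (2, 3), (3, 1), (3, 2)}"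
  proof
    fix p assume "p \<in> E12b"
    then obtain x y where p: "p = (x, y)" "x \<in> {0, 1, 2, 3}" "y \<in> {0, 1, 2, 3}"
      "p \<notin> {(0, 0), (0, 3), (3, 0), (3, 3)}"
      unfolding E12b_def by blast
    from p(2,3,4) show "p \<in> {(0, 1), (0, 2), (1, 0), (1, 1), (1, 2), (1, 3), (2, 0), (2, 1), (2, 2), (2, 3), (3, 1), (3, 2)}"
      unfolding p(1) by (elim insertE emptyE) simp_all
  qed
qed (simp add: E12b_def)

text \<open>The search stores a turned and shifted copy of \<open>E10\<close>; the connecting map
  has the shape required by \<open>bsim_affine\<close>.\<close>

lemma top_E10: "top_node (un 10) (un 9) (points ''fffhfgfegfgggeefegee'')"
proof -
  have "points ''fffhfgfegfgggeefegee'' = map encp [(0, 0), (0, 2), (0, 1), (0, -1), (1, 0), (1, 1), (1, -1), (-1, 0), (-1, 1), (-1, -1)]"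
    by (simp add: letter_code encp_def enc7)
  moreover have "top_node 10 9 (map encp [(0, 0), (0, 2), (0, 1), (0, -1), (1, 0), (1, 1), (1, -1), (-1, 0), (-1, 1), (-1, -1)])"
    by (rule top_nodeI[of _ _ _ E10 "\<lambda>z. (1 + 0 * fst z - 1 * snd z, -1 + 1 * fst z + 0 * snd z)"])
      (rule bsim_affine | force simp: E10_def extremal_def ri_def ub_diff_def ub_def th_def bnd_def)+
  ultimately show ?thesis by (simp add: un_def)
qed

lemma top_E11: "top_node (un 11) (un 8) (points ''fffhfgfehfgfgggeefegee'')"
proof -
  have "points ''fffhfgfehfgfgggeefegee'' = map encp [(0, 0), (0, 2), (0, 1), (0, -1), (2, 0), (1, 0), (1, 1), (1, -1), (-1, 0), (-1, 1), (-1, -1)]"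
    by (simp add: letter_code encp_def enc7)
  moreover have "top_node 11 8 (map encp [(0, 0), (0, 2), (0, 1), (0, -1), (2, 0), (1, 0), (1, 1), (1, -1), (-1, 0), (-1, 1), (-1, -1)])"
    by (rule top_nodeI[of _ _ _ E11 "\<lambda>z. (1 + 0 * fst z - 1 * snd z, -1 + 1 * fst z + 0 * snd z)"])
      (rule bsim_affine | force simp: E11_def extremal_def ri_def ub_diff_def ub_def th_def bnd_def)+
  ultimately show ?thesis by (simp add: un_def)
qed

lemma top_E12a: "top_node (un 12) (un 6) (points ''fffhfdfgfehfgfgggeefegee'')"
proof -
  have "points ''fffhfdfgfehfgfgggeefegee'' = map encp [(0, 0), (0, 2), (0, -2), (0, 1), (0, -1), (2, 0), (1, 0), (1, 1), (1, -1), (-1, 0), (-1, 1), (-1, -1)]"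
    by (simp add: letter_code encp_def enc7)
  moreover have "top_node 12 6 (map encp [(0, 0), (0, 2), (0, -2), (0, 1), (0, -1), (2, 0), (1, 0), (1, 1), (1, -1), (-1, 0), (-1, 1), (-1, -1)])"
    by (rule top_nodeI[of _ _ _ E12a "\<lambda>z. (1 + 0 * fst z - 1 * snd z, -1 + 1 * fst z + 0 * snd z)"])
      (rule bsim_affine | force simp: E12a_def extremal_def ri_def ub_diff_def ub_def th_def bnd_def)+
  ultimately show ?thesis by (simp add: un_def)
qed

lemma top_E12b: "top_node (un 12) (un 6) (points ''fffhfgfehfhggfghgggeefeg'')"
proof -
  have "points ''fffhfgfehfhggfghgggeefeg'' = map encp [(0, 0), (0, 2), (0, 1), (0, -1), (2, 0), (2, 1), (1, 0), (1, 2), (1, 1), (1, -1), (-1, 0), (-1, 1)]"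
    by (simp add: letter_code encp_def enc7)
  moreover have "top_node 12 6 (map encp [(0, 0), (0, 2), (0, 1), (0, -1), (2, 0), (2, 1), (1, 0), (1, 2), (1, 1), (1, -1), (-1, 0), (-1, 1)])"
    by (rule top_nodeI[of _ _ _ E12b "\<lambda>z. (-1 + 1 * fst z - 0 * snd z, -1 + 0 * fst z + 1 * snd z)"])
      (rule bsim_affine | force simp: E12b_explicit extremal_def ri_def ub_diff_def ub_def th_def bnd_def)+
  ultimately show ?thesis by (simp add: un_def)
qed

lemma top_E13a: "top_node (un 13) (un 5) (points ''fffhfdfgfehfdfgfgggeefegee'')"
proof -
  have "points ''fffhfdfgfehfdfgfgggeefegee'' = map encp [(0, 0), (0, 2), (0, -2), (0, 1), (0, -1), (2, 0), (-2, 0), (1, 0), (1, 1), (1, -1), (-1, 0), (-1, 1), (-1, -1)]"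
    by (simp add: letter_code encp_def enc7)
  moreover have "top_node 13 5 (map encp [(0, 0), (0, 2), (0, -2), (0, 1), (0, -1), (2, 0), (-2, 0), (1, 0), (1, 1), (1, -1), (-1, 0), (-1, 1), (-1, -1)])"
    by (rule top_nodeI[of _ _ _ E13a "\<lambda>z. (0 + 1 * fst z - 0 * snd z, 0 + 0 * fst z + 1 * snd z)"])
      (rule bsim_affine | force simp: E13a_explicit extremal_def ri_def ub_diff_def ub_def th_def bnd_def)+
  ultimately show ?thesis by (simp add: un_def)
qed

lemma top_E13b: "top_node (un 13) (un 5) (points ''fffgfehghedgdegfghgdefehed'')"
proof -
  have "points ''fffgfehghedgdegfghgdefehed'' = map encp [(0, 0), (0, 1), (0, -1), (2, 1), (2, -1), (-2, 1), (-2, -1), (1, 0), (1, 2), (1, -2), (-1, 0), (-1, 2), (-1, -2)]"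
    by (simp add: letter_code encp_def enc7)
  moreover have "top_node 13 5 (map encp [(0, 0), (0, 1), (0, -1), (2, 1), (2, -1), (-2, 1), (-2, -1), (1, 0), (1, 2), (1, -2), (-1, 0), (-1, 2), (-1, -2)])"
    by (rule top_nodeI[of _ _ _ E13b "\<lambda>z. (0 + 1 * fst z - 0 * snd z, 0 + 0 * fst z + 1 * snd z)"])
      (rule bsim_affine | force simp: E13b_def extremal_def ri_def ub_diff_def ub_def th_def bnd_def)+
  ultimately show ?thesis by (simp add: un_def)
qed

lemma top_E14: "top_node (un 14) (un 0) (points ''fffgfifehghedgdegfghgdefehed'')"
proof -
  have "points ''fffgfifehghedgdegfghgdefehed'' = map encp [(0, 0), (0, 1), (0, 3), (0, -1), (2, 1), (2, -1), (-2, 1), (-2, -1), (1, 0), (1, 2), (1, -2), (-1, 0), (-1, 2), (-1, -2)]"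
    by (simp add: letter_code encp_def enc7)
  moreover have "top_node 14 0 (map encp [(0, 0), (0, 1), (0, 3), (0, -1), (2, 1), (2, -1), (-2, 1), (-2, -1), (1, 0), (1, 2), (1, -2), (-1, 0), (-1, 2), (-1, -2)])"
    by (rule top_nodeI[of _ _ _ E14 "\<lambda>z. (0 + 0 * fst z - 1 * snd z, 0 + 1 * fst z + 0 * snd z)"])
      (rule bsim_affine | force simp: E14_def E13b_def extremal_def ri_def ub_diff_def ub_def th_def bnd_def)+
  ultimately show ?thesis by (simp add: un_def)
qed

lemmas top_code =
  top_E10[unfolded node_code]
  top_E11[unfolded node_code]
  top_E12a[unfolded node_code]
  top_E12b[unfolded node_code]
  top_E13a[unfolded node_code]
  top_E13b[unfolded node_code]
  top_E14[unfolded node_code]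

text \<open>At fourteen points \<open>ext\<close> has no instance, so that only \<open>final\<close>
  remains.\<close>

lemma node_14:
  assumes "top_node 14 e ws" "small_coords ws"
  shows "node 14 e ws"
proof -
  obtain qs where qs: "ws = map encp qs" "\<forall>q\<in>set qs. bnd 4 q" using small_coordsD assms(2) by blast
  have "good 14 (ri ` set qs)" if "length qs = 14" "distinct qs" "S_rt (ri ` set qs) = th 14 + e"
  proof (rule goodI)
    show "card (ri ` set qs) = 14" using that by (simp add: card_image inj_on_def ri_inj distinct_card)
    show "final 14 (ri ` set qs)"
      using assms(1) qs that by (intro final_of_final_ok[of _ e]) (simp_all add: final_ok_def)
  qed (simp_all add: ext_def)
  then show ?thesis unfolding node_def using qs by blast
qed

lemma node_E14: "node (un 14) (un 0) (points ''fffgfifehghedgdegfghgdefehed'')"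
  unfolding un_def
  by (rule node_14, rule top_E14[unfolded un_def], simp only: points.simps letter_code small_coords.simps small_code bool_code)

lemmas nodes14 = node_E14[unfolded node_code]

subsection \<open>The nodes of the search\<close>

text \<open>A check lists the number of points, the excess, the points with two letters each, and
  the certificate. Sizes are treated from the largest down, so that every move ends in an
  established node, which rewrites to \<open>True\<close>. Of the two extremal sets here only
  \<open>E13b\<close> extends: its four moves all lead to \<open>E14\<close>.\<close>

lemma level13:
  "check 13 5 ''fffgfehghedgdegfghgdefehed'' ''ppBffAffppppppppFffEffppp''"
  "check 13 5 ''fffhfdfgfehfdfgfgggeefegee'' ''ppppppppppppp''"
  by (simp_all only: code top_code nodes14)

lemmas nodes13 =
  level13[THEN node_fact, unfolded node_code]

text \<open>The two entries with excess 6 are \<open>E12b\<close> and \<open>E12a\<close>. The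
  centre of \<open>E12b\<close> is half-integral; adding it and multiplying by \<open>1 + i\<close>
  gives \<open>E13b\<close>. \<open>E12a\<close> extends to \<open>E13a\<close> without a
  move.\<close>

lemma level12:
  "check 12 5 ''fffgfehedgdegfghgdefehed'' ''ppsprppppppssspppss''"
  "check 12 6 ''fffhfgfehfhggfghgggeefeg'' ''pppppspspppppspsSfessss''"
  "check 12 6 ''fffhfdfgfehfgfgggeefegee'' ''ppppppssssAffpsspppppssss''"
  "check 12 5 ''fffhfgfehfgfghgggeefegee'' ''pprpppsrrpppppsppss''"
  "check 12 5 ''fffhfdhfdfdhddgggeefegee'' ''pppssprrpppppssppp''"
  "check 12 4 ''fffhfgfegfghgggeefehegee'' ''pppprrrrppppppppss''"
  "check 12 4 ''fffhfdfghfdfddgggeefegee'' ''ppprpprrppsppp''"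
  "check 12 5 ''fffhfdfehfdfddgggeefegee'' ''pppsppspspspspssppsp''"
  "check 12 4 ''fffgfifehgdgdegfghgdefeh'' ''ppppprppppspprr''"
  "check 12 5 ''fffhfdfgfehfdfgggeefegee'' ''ppppppsspssrppppp''"
  by (simp_all only: code top_code nodes13)

lemmas nodes12 =
  level12[THEN node_fact, unfolded node_code]

text \<open>The entry with excess 8 is \<open>E11\<close>, at the upper bound 43.\<close>

lemma level11_1:
  "check 11 5 ''fffgfehghedgdegfghefed'' ''ppssppppppprssssprpss''"
  "check 11 4 ''fffgfehghedgdegfefehed'' ''ppsspppppprrspppss''"
  "check 11 6 ''fffhfdfgfehfgfgggeegee'' ''ppppppssssrsspsspsspssrppssss''"
  "check 11 5 ''fffgfehghegfghgdggefed'' ''ppspspprspppprrprps''"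
  "check 11 4 ''fffgfehedgdegfefehedee'' ''pprpsrppprrrppprp''"
  "check 11 5 ''fffhfdfehfgfgggeefegee'' ''ppprppsrssrspsppspppsss''"
  "check 11 5 ''fffhfghfhggfgggeefegee'' ''ppsprpspsrprpspspsppsss''"
  "check 11 4 ''fffhfghfgfghgggeefegee'' ''pprprprrrppppsppss''"
  "check 11 4 ''fffhfdhfdfdhddgeefegee'' ''pppsrrprrppprprspp''"
  "check 11 4 ''fffhfdfehfdfdhddgeegee'' ''ppprprrppprsprsrpp''"
  "check 11 6 ''fffgfehghegfghgdgeefed'' ''pspspspspsspppsprspspss''"
  "check 11 5 ''fffhfghfhhgfgggeefegee'' ''pprprppsrspsprprpspspss''"
  "check 11 4 ''fffgfehghegfgdgeefehed'' ''pprpppsrprprprppr''"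
  "check 11 4 ''fffgfehedgdegfghefedee'' ''pprprppppprssprpsp''"
  "check 11 5 ''fffhfdfehfdfddgeefegee'' ''pppsppspspssrspsspspsp''"
  "check 11 4 ''fffhfdfgfehfgggeefegee'' ''ppppppssrrppppp''"
  "check 11 4 ''fffhfdfghfhhgggigeegee'' ''pppppsrrrrppprsprp''"
  "check 11 6 ''fffgfehgdgdegfgdefehed'' ''ppssppEffpsppBffpssrsspppss''"
  "check 11 5 ''fffgfehedgdegfgdefehed'' ''pprprpppprpssrpppsr''"
  "check 11 6 ''fffgfehghegfghgdefehed'' ''ppsspppDffCffpppsssrsspppss''"
  "check 11 4 ''fffgfifehgdgdegfgdefeh'' ''ppppprpspprpsspprr''"
  "check 11 4 ''fffhfdfgfehfgfgggeefee'' ''ppppprsrsprppprpsr''"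
  "check 11 5 ''fffhfghfhggfghgggeegee'' ''ppsprprpsspppspsrspprss''"
  "check 11 6 ''fffhfgfehfgfghgggeefeg'' ''ppspppsAffsssppspspspsprWefssss''"
  "check 11 4 ''fffhfgfehggfghggefegee'' ''pppprprssppprprprs''"
  "check 11 4 ''fgfehghegfghgdgeefehed'' ''rpsppprrppprrsppp''"
  "check 11 4 ''fffhfghggfghgggeefegee'' ''ppprrspsppppprpprs''"
  "check 11 4 ''fffhfgfehfgfghggefegee'' ''pppppsrssppprprpprs''"
  "check 11 7 ''fffhfdfgfegfgggeefegee'' ''ppppprssssrsssspssppsssspssppssss''"
  "check 11 8 ''fffhfgfehfgfgggeefegee'' ''ppAffpppssEffsEffsssspAffspsspsssspsspsspYffsssssssss''"
  by (simp_all only: code top_code nodes12)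

lemma level11_2:
  "check 11 6 ''fffhfgfehggfgggeefegee'' ''pprpprspsrspsspppsspprsrs''"
  "check 11 4 ''fffgfehfgfgggeefehegee'' ''prrppprrrsprppppprrrr''"
  "check 11 6 ''fffhfgfegfgggeefehegee'' ''pprpprsssrssspAffppsppspprsrss''"
  "check 11 4 ''fffhfgfegfgggeefedegee'' ''pprpprrrrspsppprpprrrr''"
  "check 11 7 ''fffhfdhfdfddgggeefegee'' ''psppAffAffsspssrssprpssspsspEfgsssppssp''"
  "check 11 6 ''fffhfdfghfdfddgggeegee'' ''pppprprrprprspsspssssrspssp''"
  "check 11 4 ''fffgfehggfghgggeefegee'' ''prspprpsspppppsppsss''"
  "check 11 4 ''fffgfegfghgggeefehegee'' ''prspprsrsppppppppss''"
  "check 11 7 ''fffhfdfehfdfgggeefegee'' ''pppAffppsFffsspBffAffssEffsspsspsssspsspsspssss''"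
  "check 11 5 ''fffhfdhfdfgfgggeefegee'' ''ppprrprrssprrsspppppp''"
  "check 11 4 ''fffgfehghedegfghgdifef'' ''ppspppsppprrprrprr''"
  "check 11 4 ''fgfehghedegfghgdgeifef'' ''rpsprppsppppprrprr''"
  by (simp_all only: code top_code nodes12)

lemmas nodes11 =
  level11_1[THEN node_fact, unfolded node_code]
  level11_2[THEN node_fact, unfolded node_code]

lemma level10_1:
  "check 10 3 ''fffgfehgdegfgdefehee'' ''pppprrpprpspprs''"
  "check 10 2 ''fffehghegfghgdefehed'' ''rppsrppprrpp''"
  "check 10 2 ''fffgfehghedgdeghefed'' ''prrpppprsprp''"
  "check 10 2 ''fffehgdgdegfgdefehed'' ''prprppsprpppr''"
  "check 10 3 ''fffgfehgdgdegdefehed'' ''ppssppspprspspppss''"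
  "check 10 3 ''fffgfehedgdegfghgdef'' ''pprprppppppsssprrss''"
  "check 10 4 ''fffhfdfehfgfgggeefee'' ''ppprppsrsrrprppspsrpsrs''"
  "check 10 6 ''fffgfehfhggfghggefeg'' ''prspsppsspsrssssppspsrssssprspssWefssssssss''"
  "check 10 4 ''fffhfdfgfehfgfgggeee'' ''ppppppsrsrrpsrppssrrpsr''"
  "check 10 3 ''fffgfehegfghgdgeefee'' ''prpprrprpprprpsrrr''"
  "check 10 5 ''fffgfehggfghgggeefeg'' ''prspsprsprsssppsppsprsprWefsssss''"
  "check 10 4 ''fffgfehggfghggefegee'' ''prpsprprssppsprprpprsss''"
  "check 10 5 ''fffgfehegfghgdefehed'' ''ppssprprEffpppsrrssrsspppss''"
  "check 10 4 ''fgfehegfghgdgeefehed'' ''rspspsrprrpppprrssppp''"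
  "check 10 3 ''fffgfehggfghgdggefed'' ''ppprprsspppprrprs''"
  "check 10 5 ''fffhfdfehfdfgeefegee'' ''pppsppsspsrssssrspsspspspss''"
  "check 10 3 ''fffgfehedegfefehedee'' ''prprpsrrppsrrrpprp''"
  "check 10 7 ''fffhfdfehfgfgggeegee'' ''pppAffpsssspDgfrssrsssspsspsspsssssAefAffsspsspsssssssss''"
  "check 10 7 ''fffhfghfgfgggeefegee'' ''ppBffpssrprsAffssEffsssspAffspsspssssspsspsspYffsssssssYffss''"
  "check 10 8 ''fffhfghfhhgfgggeegee'' ''psspDgfpssEffsssssspsspDgfDggssHgfsHgfssspsHggspssAfepssssssssEfessEfeAffsspssAfepsssssssssssss''"
  "check 10 5 ''fffgfehghegfghggefed'' ''prspsrprpprspprprrsprprssss''"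
  "check 10 6 ''fffhfghfgfghgggeegee'' ''pprpsrprsrsrssppspsspssssrspspssssssss''"
  "check 10 4 ''fffgfehggfghggefehee'' ''prprprprsrrpprprrpprrr''"
  "check 10 4 ''fffdfehfgfghgggeegee'' ''prprpprrsrrprprprrppr''"
  "check 10 4 ''fffdfehfgfgggigeegee'' ''prprpprrrrprprpsrrpp''"
  "check 10 6 ''fffgfehegfghgdgeefed'' ''prprpssrspsFffrpsppsspsssAefssspspsrsssssss''"
  "check 10 4 ''fffgfehegfgdgeefehed'' ''prprprrprrprprpsrppr''"
  "check 10 5 ''fffhfdhfdfdhddefegee'' ''pssppssrrrprrpppssrrrrppssp''"
  "check 10 5 ''fffhfdfehfdfdhddegee'' ''pssppsprrrprrppprsrsrrsspsp''"
  "check 10 3 ''fffgfegfghgdefehedee'' ''ppprrrrpppsrrppps''"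
  by (simp_all only: code top_code nodes11)

lemma level10_2:
  "check 10 2 ''fffhfgfehggfghgeefeg'' ''pppsprprprrr''"
  "check 10 3 ''fffhfdhfdfddgggeefeg'' ''ppprsprrprpppspr''"
  "check 10 2 ''fffggfghgggeefehegee'' ''prprrrrrppppss''"
  "check 10 4 ''fffhfdfehfdfggefegee'' ''ppprppssprsssprsppp''"
  "check 10 2 ''fffgfehedegfghgdifef'' ''psprprppprprr''"
  "check 10 2 ''fgfehedegfghgdgeifef'' ''rpsprpppppprr''"
  "check 10 3 ''fffhfdfgfehfdfefegee'' ''ppppppprrsssrrppp''"
  "check 10 4 ''fffhfdfgfehfgggeegee'' ''pppppprrrssrsspsspssrpp''"
  "check 10 3 ''fffhhfdfddgfgggeegee'' ''pprrrprrprpsprrpp''"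
  "check 10 4 ''fffhhfdfddgggeefegee'' ''pprrrprsprpsspsprsppssp''"
  "check 10 4 ''fffhfdfghfgggigeegee'' ''ppppsprrrrrspppsrsrprp''"
  "check 10 3 ''fgfehghedegfghgdgeif'' ''rpsprrprpppppprrrsr''"
  "check 10 4 ''fgfehedgdegfefehedee'' ''rsprspsrprppprrrspppsp''"
  "check 10 5 ''fffhfdfehfgggeefegee'' ''pppAffppsrssrssrsspsspsssspspsspsss''"
  "check 10 6 ''fgfehgdgdegfghefeheg'' ''rsspssrpsspssrsspssppspsssrssspspsps''"
  "check 10 4 ''fgfehghegfgdgeefehed'' ''rrprprprpsrprppsrrpp''"
  "check 10 7 ''fffgfehghegfghgdefed'' ''psspAfgspsssspsspCffssCffpsppAffsrsssssrssssspssAffpsssssssss''"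
  "check 10 5 ''fffgfehghegfgdefehed'' ''pprsppspsrprpsrsrsspppss''"
  "check 10 5 ''fffhfghfhhgggeefegee'' ''pprpsppssrsrspsrpsrspspspss''"
  "check 10 4 ''fffgfehghegfghgdefee'' ''ppspspprrppprrrprrs''"
  "check 10 4 ''fffhfghfdfddgggeegee'' ''pprpsprsprrpsrpssrprp''"
  "check 10 4 ''fffhfdhfgfgggigeegee'' ''ppprrprrsrsppprrpsp''"
  "check 10 3 ''fgfehfhghedegfghgdif'' ''psprpppppprrprrrr''"
  "check 10 5 ''fffgfehedgdegfefehed'' ''pprspsAffspspsspprrssrssppprr''"
  "check 10 4 ''fffhfdhfgfgggeefegee'' ''ppprrprrssrssppprrpp''"
  "check 10 3 ''fgfifehggfghggefehed'' ''rrpppprrrrpprpsrrpp''"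
  "check 10 3 ''fffgfehgdgdegfghefed'' ''pprprpppprssrprprr''"
  "check 10 3 ''fffgfehghegfghefedeg'' ''ppppprspprrrrpr''"
  "check 10 3 ''fffhhfhggfgggeefegee'' ''pprrrprprppprpps''"
  "check 10 6 ''fffgfehedgdegfghefed'' ''pspBffspsAffsspspssppsprsssssssssprpssAff''"
  by (simp_all only: code top_code nodes11)

lemma level10_3:
  "check 10 4 ''fffgfehegfghgdggefed'' ''pspspsrprrpppprrprpss''"
  "check 10 3 ''fffdfehfdfdhddgeegee'' ''prppsprpprrprrprp''"
  "check 10 4 ''fffgfehegfghgdefedee'' ''prprpsrprrpppsrsrprpsp''"
  "check 10 5 ''fffhfgfehfgggeefegee'' ''ppAffpppsssrsssrsspsspssspspspssss''"
  "check 10 3 ''fffhfghfhggggeefegee'' ''pprprprrrsprpppps''"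
  "check 10 4 ''fffgfehghegfghgeefed'' ''ppsprpprspprrprprpss''"
  "check 10 3 ''fffhfghfghgggeefegee'' ''pprprprsrrrprpspps''"
  "check 10 3 ''fffdfghfgfgggigeegee'' ''prprprrrsppprrrpp''"
  "check 10 3 ''fffgfehggfghefehegee'' ''prprprrrrpprrsppp''"
  "check 10 3 ''fffhfdhfdfdhddgeefee'' ''ppprrprrpprpssrp''"
  "check 10 3 ''fffghgdgdegfghefeheg'' ''prprrpppsrppsp''"
  "check 10 3 ''fffgfehedgdeefehedee'' ''pprpsrpprssrpprp''"
  "check 10 5 ''fffhfdfgfegggeefegee'' ''pppppAffssssrssssrssppsssspssppssss''"
  "check 10 3 ''fffhfgfehggggeefegee'' ''pprpprrrsppprppr''"
  "check 10 3 ''fffghfgfghgggeefegee'' ''prrprprrppppspprr''"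
  "check 10 3 ''fffhfgfeghgggeefegee'' ''pprpprsrrppprpprr''"
  "check 10 3 ''fffehegfghgdgeefedee'' ''prrrprpsrppprpp''"
  "check 10 4 ''fffhfgfegggeefehegee'' ''pprpprsrssrsppsppppssss''"
  "check 10 4 ''fffhfdhfdfddgggeefee'' ''pppssprrprpsppssprsp''"
  "check 10 4 ''fffhfdhfdfddggefegee'' ''ppprsprrprpssprssppsp''"
  "check 10 4 ''fffhfdfghfdfddggegee'' ''ppppsprrprpsprssrpp''"
  "check 10 3 ''fffhfghfhhgfggefegee'' ''ppsprpprrsprprrsps''"
  "check 10 3 ''fffgfehggfghgdgeefed'' ''pppprsrpprprprpr''"
  "check 10 3 ''fffgfehgdgdeghefeheg'' ''psprpsrpsprsrppsp''"
  "check 10 3 ''fffgfehggfgdgeefehed'' ''pppprsrprpspssppr''"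
  "check 10 5 ''fffhfdfegfgggeefegee'' ''ppprprssssrsssspsppsssspsppsrsr''"
  "check 10 4 ''fffhfghhgfgggeefegee'' ''pprprrrrsrprpspsprpsprr''"
  "check 10 5 ''fffhfghggfgggeefegee'' ''ppsprrspsrssprpspsspspprssrss''"
  "check 10 5 ''fffgfegfghggefehegee'' ''prspspsrsrrsppsprssppspprssrss''"
  "check 10 3 ''fffgfegfgdgeefehedee'' ''prpprrrrrpsprprpprprr''"
  by (simp_all only: code top_code nodes11)

lemma level10_4:
  "check 10 4 ''fffgfehgdfdgdeefeheg'' ''prpspprpprssrrrpprprrr''"
  "check 10 6 ''fffhfdhfdfddgeefegee'' ''psppssAffssspssrspsrpsssrspEfgspspssp''"
  "check 10 4 ''fffhfdfghfdfddgeegee'' ''ppprprrprpsrrprrrsprp''"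
  "check 10 3 ''fffhfgfehgdgdeefeheg'' ''pprprpprsrpppr''"
  "check 10 4 ''fffhfdfehfdfddefegee'' ''pppsppsprpsssrsspspsp''"
  "check 10 3 ''fffgfehedgdeghefedee'' ''pprpprpprsspspsp''"
  "check 10 4 ''fffhfghggfghgggeegee'' ''pppsrrpspppspsrspprss''"
  "check 10 3 ''fffgfegfghgeefehegee'' ''prsppssrrspprppppsss''"
  "check 10 3 ''fgfifehgdgdegfefedeg'' ''rpppprppprrsspr''"
  "check 10 3 ''fffgfifehgdgdegfefed'' ''pppprppprrsprrr''"
  "check 10 3 ''fgfifehgdgdegfefedee'' ''rpsppprppprrsprp''"
  "check 10 3 ''fffgfifehgdgdegdefeh'' ''pppppsprprrsppsr''"
  "check 10 3 ''fffhfdfghfdfddefegee'' ''ppprpprprrsppp''"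
  "check 10 3 ''fffhfdhfdfdddeefegee'' ''ppprpprprrsrppp''"
  "check 10 3 ''fffgfifehgdgdegfgdef'' ''ppppprppprsprrrs''"
  "check 10 4 ''fffhfgfehfhggfggefeg'' ''pppppspsssprprprprrssss''"
  "check 10 3 ''fffhfgfehfdfgfggefeg'' ''ppspprrrrprprprprrr''"
  "check 10 4 ''fffhfdfgfegfgeefegee'' ''pppprsrssrprrppsrppsrrr''"
  "check 10 5 ''fffhfgfehfgfggefegee'' ''ppspppssssrsrsprspsrprpsprssrs''"
  "check 10 4 ''fffhfgfehggfggefegee'' ''pppprsrrprprprpprsrr''"
  "check 10 7 ''fffhfgfehfgfgggeefeg'' ''ppBffpsppDggsEffsFfgFffsssspAffspsspssssssspBfgspssrYgfssZgfssssYgfss''"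
  "check 10 4 ''fffhfghfhggfghggegee'' ''ppprprpsppprrsrrprrr''"
  "check 10 6 ''fffhfgfehggfgggeefeg'' ''ppspsprspFfgsssssprspspssspBfgsprrsssssss''"
  "check 10 4 ''fffhfghggfghggefegee'' ''ppprrrrpssppprprprrrs''"
  "check 10 6 ''fffhfgfegfghggefegee'' ''ppspspAffssrsrsDfgssppspsrssssprspsprssssrss''"
  "check 10 3 ''fffhfgfegfgggeefedeg'' ''pppprrrprsppprprrrr''"
  "check 10 3 ''fffgfehgdfdgefehegee'' ''prpspprprrrpppprr''"
  "check 10 6 ''fffhfgfegfggefehegee'' ''ppspspssssssrsrsprspsrssppspspssssrss''"
  "check 10 3 ''fffhfgfegfggefedegee'' ''pprpprrrprsprprpprr''"
  "check 10 3 ''fffdfgfegfgeefehedee'' ''pppprrrrprrpspprprr''"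
  by (simp_all only: code top_code nodes11)

text \<open>The entry with excess 9 is \<open>E10\<close>, at the upper bound 35.\<close>

lemma level10_5:
  "check 10 4 ''fhfgfehgdgdegfghefeh'' ''rprppsrprppprrsrsspprrs''"
  "check 10 5 ''fgfehghegfghgdggefed'' ''rssprspssspsprrpppprsrssprp''"
  "check 10 3 ''fffhfghfhggfgggeefee'' ''ppsprprprprppprr''"
  "check 10 4 ''fffgfehfgfghggefegee'' ''prsppprsssppsprprpprsss''"
  "check 10 3 ''fffhfgfehfgfgeefegee'' ''prppsrrpsrrppppsrrr''"
  "check 10 3 ''fffhfgfehggfgeefegee'' ''pprppssrrpsrppsppssrr''"
  "check 10 3 ''fffhfgfegfgeefehegee'' ''pprppsrrprrppppsrr''"
  "check 10 3 ''fffhfehfdfddgggeegee'' ''pprrprsprrpsprsrpp''"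
  "check 10 9 ''fffhfgfegfgggeefegee'' ''ppAffpsspssAffssAffsEffCffssCffsFffpCffCffpsspsssssssssspAffAffpsspYffssYffssssssTffssTff''"
  "check 10 6 ''fffgfegfgggeefehegee'' ''prrpsprsssrsCffspAffspspsssppspprsrssrsr''"
  "check 10 4 ''fffdfegfgdgeefehedee'' ''pprrprrrpprpsppprrrr''"
  "check 10 8 ''fffhfdhfdfgggeefegee'' ''pssppBffssAffsssssspssrrsssspssrrssssAffsspsspBgfssAgfsssspsspEgfGgfpssssssssssss''"
  by (simp_all only: code top_code nodes11)

lemmas nodes10 =
  level10_1[THEN node_fact, unfolded node_code]
  level10_2[THEN node_fact, unfolded node_code]
  level10_3[THEN node_fact, unfolded node_code]
  level10_4[THEN node_fact, unfolded node_code]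
  level10_5[THEN node_fact, unfolded node_code]

lemma level9_1:
  "check 9 5 ''fffgfehgdegfgdefeh'' ''psspsssspssssspssrsrssppsrpDffsFffsssssssssssspsprGffsAffssssssss''"
  "check 9 2 ''fffgfehegfghefedeg'' ''ppprprrpprrrprs''"
  "check 9 2 ''fffgfehegfghefedee'' ''prpprprrprrrprps''"
  "check 9 3 ''fffghgdgdegfghefeh'' ''psprrpspsppprrssppsr''"
  "check 9 3 ''fffhfdgfgggeefegee'' ''ppprrrssssrsssspppsssspppssss''"
  "check 9 3 ''fffgfehedgdeefehed'' ''pprspsspspssprrsrppprr''"
  "check 9 4 ''fffhfehfgggeefegee'' ''pprrppsssrssrspsspssssppsspssss''"
  "check 9 2 ''fffhfehggggeefegee'' ''pprrrrrppppps''"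
  "check 9 2 ''fffghfhhgggeefegee'' ''prrprprrprprpsp''"
  "check 9 3 ''fffehegfghgdefedee'' ''prrrpsprrppprrspspps''"
  "check 9 2 ''fffehegfgdefehedee'' ''prrrpsprprprsppp''"
  "check 9 2 ''fgfehgdfdgdeefehee'' ''rprpsppprrpprr''"
  "check 9 2 ''fdfehegfgdefehedee'' ''rprrpprpsprsppp''"
  "check 9 2 ''fffhfdhfdfddgggeef'' ''pppprrprpppsrr''"
  "check 9 3 ''fffhfdfghfdfddggeg'' ''ppppsprrprprsprrspr''"
  "check 9 2 ''fffhhggfgggeefegee'' ''pprrrrrppppps''"
  "check 9 2 ''fgfehfgfghgdefedee'' ''rppsrrpprrprpp''"
  "check 9 2 ''fffgfifehgdgdegdeh'' ''pppprprpssprp''"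
  "check 9 2 ''fgfehggfgdgeefehed'' ''rprprrrprprrspp''"
  "check 9 2 ''fffehghegfgdefehed'' ''prrppprprprsrspps''"
  "check 9 2 ''fffhfdhfdfddgeefeg'' ''pppssprrprprpspr''"
  "check 9 3 ''fffdfghfgggigeegee'' ''prpprpsrrrrspsppssrrrpsp''"
  "check 9 3 ''fffehghegfghgdefed'' ''prsppprspppsrrspAffps''"
  "check 9 4 ''fffgfehedgdeghefed'' ''pprspsAffpspssprpEffsssssspBffpssr''"
  "check 9 3 ''fffdfehfdfdhddegee'' ''psrpprspsrpppsrrssrrspsp''"
  "check 9 3 ''fffehegfghgdefehed'' ''prspAffprsppprrsrsrppps''"
  "check 9 1 ''fffgfehedgdegfghed'' ''pprprpppssrp''"
  "check 9 1 ''fffehedgdegfghefed'' ''prpppprspspr''"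
  "check 9 1 ''fffgfehgdegdefehee'' ''ppppsrprpppr''"
  "check 9 3 ''fffhfgfehfggefegee'' ''ppspppsrssrspsrprpspssrs''"
  by (simp_all only: code top_code nodes10)

lemma level9_2:
  "check 9 3 ''fffhfghfhggfggegee'' ''ppspsprsprsprspsrsrspprssss''"
  "check 9 3 ''fffghfgfghgggeefeg'' ''prsprpsrsppppspsprrssss''"
  "check 9 2 ''fffghggfghggefegee'' ''prprrpsppprprprr''"
  "check 9 3 ''fffhfgfeghggefegee'' ''ppppssrssrpprprpspssrss''"
  "check 9 4 ''fffhfgfegfefehegee'' ''ppspspssssrsrsprsrrssppsppssssrss''"
  "check 9 3 ''fgfehgdgdegfghefeg'' ''rspsrpsprspspppsssprrp''"
  "check 9 2 ''fgfehfhggfghgdefed'' ''rppprrppprrrrprpss''"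
  "check 9 2 ''fgfehggfghgdefedeg'' ''rppsprrrppprrprp''"
  "check 9 4 ''fffgfehggfghgdefed'' ''ppsspsprFffrppprrsssrsssprpss''"
  "check 9 2 ''fgfehggfghgdefedee'' ''rprpsrrrppprrprp''"
  "check 9 3 ''fgfehggfghgdggefed'' ''rspsspsprsrppppssrsprp''"
  "check 9 2 ''fffhfghfghggefegee'' ''ppprrrrrprrrpsrr''"
  "check 9 2 ''fffgfehegfefehedee'' ''prpprrrprrsrrpprp''"
  "check 9 6 ''fffgfehggfghggefeg'' ''psrspsAfepssAffssspssrsssHgfsspspBffpsAffssssssspsrspsAffUfessssssssUfesss''"
  "check 9 5 ''fffhfdfehfgfgggeee'' ''ppprpssspDgfrsrCffssspsrpsspssssAefrsrspsssssssss''"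
  "check 9 4 ''fffgfehggfghggefee'' ''prsprprsprsrspprprrprsrprsssssss''"
  "check 9 3 ''fffgfehggfghggefed'' ''prprprprrspprprrprrrr''"
  "check 9 8 ''fffhfghfgfgggeegee'' ''psspBffpssEffssspsAffCgfEffsFfgFffGgfsFffspAffBffpBffAfepsFffssssEfessEfeAffBfgspsAfepYffssZffssssYffss''"
  "check 9 5 ''fffgfegfghgdefehed'' ''psspsspsrrsrrpssppDffCffsrssrssspssppBffAffssss''"
  "check 9 4 ''fgfegfghgdefehedee'' ''rsspsspsrrsrrpppssrrrrrrpppsp''"
  "check 9 3 ''fffhfdfehfgfgeegee'' ''pppsppsrsrsprrspsrppss''"
  "check 9 3 ''fffhfghfgfgggeefee'' ''pprprprsrsssspssppsprprss''"
  "check 9 2 ''fffghghegfghggefed'' ''prprrppspprprrprr''"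
  "check 9 4 ''fffhfdfghfgfgggeee'' ''pppprprrssrssspsspsspssssrpsssss''"
  "check 9 3 ''fffgfehegfghggefed'' ''pssppsrprspprprsprprsss''"
  "check 9 2 ''fffdfehfgfghgeegee'' ''pprpprrrprrprpps''"
  "check 9 3 ''fffgfehegfghgeefed'' ''pspspsrprrpprrpsprpsrss''"
  "check 9 2 ''fffghgdgdegfefeheg'' ''prprrrppprsrrpprp''"
  "check 9 3 ''fffdhfdfdhddefegee'' ''psrpsrrspsrpppsrrrrrppsp''"
  "check 9 2 ''fffdfghfdfdhddegee'' ''prprprppprsrrrrpp''"
  by (simp_all only: code top_code nodes10)

lemma level9_3:
  "check 9 2 ''fffhfgfehfdfggefeg'' ''pprprprrrrprprprsr''"
  "check 9 2 ''fffgfegfggefehedee'' ''prppsrrrprrrrprrr''"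
  "check 9 1 ''fffghghegfghgdefed'' ''prppsppprrpr''"
  "check 9 3 ''fffgfehggfghgdefee'' ''pppsprssppprrrprrspss''"
  "check 9 3 ''fffgfehegfghgdefee'' ''pspspsrpsrppprrrprrspss''"
  "check 9 3 ''fffgfehgdegfefehed'' ''ppsspprrpprrssrppprr''"
  "check 9 3 ''fffgfehedegfefehed'' ''pprprprpprrsrrppprr''"
  "check 9 3 ''fffhfgfehfgggeefeg'' ''ppsppprsrsrBfgpsppsprYgfss''"
  "check 9 3 ''fffhfdfehfgggeefee'' ''pppsppsrssrssrspspspsrpss''"
  "check 9 3 ''fffgfehfhggfghefeg'' ''pspsppprrppsrEffsprpsrss''"
  "check 9 2 ''fffhfghfddgggeefeg'' ''pprprprrrppsppr''"
  "check 9 2 ''fffgfehggfghgeefed'' ''pppprrsprrprprrr''"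
  "check 9 3 ''fffgfehggfghgeefeg'' ''pAffpspEffprrspprrpsprsprssss''"
  "check 9 2 ''fffgfehggfghefedeg'' ''pppprrspprrrprpr''"
  "check 9 3 ''fffgfehggfghefegee'' ''pspspsprrrsppsrrprsppssrr''"
  "check 9 2 ''fehegfghgdefehedee'' ''rsrrpprrppprrrppp''"
  "check 9 3 ''fehegfghgdgeefehed'' ''rrrrpsspsspppprsrsrppp''"
  "check 9 2 ''fgfehghedfdgdeefeh'' ''prrppprprrpprrs''"
  "check 9 1 ''fffhfgfehggeefegee'' ''ppprrrpppps''"
  "check 9 1 ''fffhfehfdfddggegee'' ''pprprpsrrpp''"
  "check 9 1 ''fffgfehfghggefegee'' ''prpprrrppps''"
  "check 9 1 ''fffhhfdfddgggeefeg'' ''pprrprrppspr''"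
  "check 9 2 ''fffgfehggfgeefehed'' ''ppprrrprrrprpsr''"
  "check 9 2 ''fffgfehegfggefehee'' ''prpprrrsprrprpsrrrr''"
  "check 9 2 ''fffehedgdeghefedee'' ''psrppsppspssppp''"
  "check 9 3 ''fffhfgfehggfgeefeg'' ''ppppsprsspAffsrppssprrsss''"
  "check 9 5 ''fffgfehfgggeefegee'' ''prrpppssssrssssrsspsspsssssspsspsspZffssVffssssss''"
  "check 9 3 ''fffggfgggeefehegee'' ''prrprrsrspAffppppprrrr''"
  "check 9 2 ''fffdfegfghgdefedee'' ''pprrprrpprsppprr''"
  "check 9 2 ''fffegfgdgeefehedee'' ''prrrprrpppsppprr''"
  by (simp_all only: code top_code nodes10)

lemma level9_4:
  "check 9 2 ''fdfegfgdgeefehedee'' ''rprrprrpppsppprr''"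
  "check 9 3 ''fffgfegggeefehegee'' ''prrpprrssrsppppprrrr''"
  "check 9 2 ''fffdfegfgdefehedee'' ''pprrprrpprsppprr''"
  "check 9 4 ''fffhfdhfdfgggeefee'' ''pppsrprrssprrsrpspssssprssp''"
  "check 9 5 ''fffhfdhfdfgeefegee'' ''psppBffAffssssspsssrsspssrrssssrsspssAgfssspspEgfspsssss''"
  "check 9 2 ''fffghggfghgggeegee'' ''prprrsppppprppr''"
  "check 9 4 ''fffhfdfehfdfefegee'' ''pppAffppssprrssssrrsspspspsssss''"
  "check 9 3 ''fffhfdhfdfdeefegee'' ''ppprrpssprrspsrrsspppss''"
  "check 9 3 ''fffhfdfgfegggeegee'' ''ppppprssrssrssppssssrsspp''"
  "check 9 3 ''fghgdgdegfghefeheg'' ''rrprrpssspspppssrrpspsp''"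
  "check 9 3 ''fgfehedgdeefehedee'' ''rsprspssprpssprssrspppsp''"
  "check 9 6 ''fffhfdfehfgggeegee'' ''pssppAffpsssssspssrrssrGffEffssrsspBffspsssssAgfssssssAefAffsspsspsssssssssss''"
  "check 9 4 ''fffhhfgfgggeefegee'' ''pprrrprrrsrssspspsrpsrsppsspssss''"
  "check 9 7 ''fffhfghfhhgggeegee'' ''psspHfgpssssssspsspDgfssHgfsHgfssrsHggspssAfepssssssssAefssEfeAffsspssAfepssssssssss''"
  "check 9 4 ''fgfehghegfghggefed'' ''rrspsrpssrspssprsspprpssrrsprps''"
  "check 9 3 ''fffhfghfhggggeegee'' ''pprprprrrrrrrprprrrrpps''"
  "check 9 7 ''fffhfdhfgfgggeegee'' ''psspprssrsssssspssDgfCgfDgfssCgfrGffEffsspsspBffAffpBgfssAgfBefssAefAffsspAfgBfgpssssssssss''"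
  "check 9 5 ''fffgfehghegfghefed'' ''psspsspssspssprsDffpsprrsrsssrsssspsrpAffsssssss''"
  "check 9 5 ''fffhfghfghgggeegee'' ''psprpsEffssprsssrGgfssrpspsrpsssssrspsspsssssss''"
  "check 9 4 ''fffdfehfghgggeegee'' ''prpsppsrsrsrrprprspssrrspssps''"
  "check 9 4 ''fffdfehfgggigeegee'' ''prpsppsrrsrrsrprppssrsrrspssp''"
  "check 9 6 ''fffgfehegfghgdefed'' ''psspAfgsspssssssrsspsFffssrpsppAffsrssssssssrssEfessspssAffpsssAffssssssssss''"
  "check 9 4 ''fffdhfgfgggigeegee'' ''prprrprrsrrssspprppssrsrspssp''"
  "check 9 3 ''fgfihggfghggefehed'' ''rrpprrrprrrrprprpsrrrprpr''"
  "check 9 5 ''fgfehgdgdegfefeheg'' ''rsspssrpsssspssrrspssppsrsssrssspsprpssssss''"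
  "check 9 4 ''fgfehegfgdgeefehed'' ''rrprprsrrpsssrpsrpsprsrsspspps''"
  "check 9 6 ''fffhfghfgggeefegee'' ''psspBffpssAffssspsrsAffsssrGgfssssrAffspsAfepsFffsssssssspBfgspsspYffssssssssssss''"
  "check 9 4 ''fffgfehggfghefehee'' ''psprpspsrsrrpsprrsrssrsppsrpssss''"
  "check 9 3 ''fhfgfihggfghefehed'' ''ppprprrrrprprrrrsrrrprpr''"
  "check 9 4 ''fffgfehegfgdefehed'' ''psprprsprrpsrprsrrsrsspsppsr''"
  by (simp_all only: code top_code nodes10)

lemma level9_5:
  "check 9 3 ''fffhfdhfdfdhddefee'' ''prppsrrrprrpppsrrsrrrp''"
  "check 9 3 ''fffhfdhfdfdhdddeee'' ''prpprrrprrppprrssrrp''"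
  "check 9 3 ''fffhfdfehfdfdhddee'' ''prpprrrprrppprrrssrrp''"
  "check 9 3 ''fffhfdhfhddfdddeee'' ''prpprprrpprrprrssrrp''"
  "check 9 3 ''fffgfehghegfefehed'' ''ppssppprrprrrrsspppss''"
  "check 9 3 ''fffhfghfhhggefegee'' ''ppspspprrrrprrspspsps''"
  "check 9 3 ''fgfehgdgdeghefeheg'' ''rsprppsrsprprpsrsppsp''"
  "check 9 3 ''fffgfehegfghefehee'' ''ppsprprspprrssspprrpss''"
  "check 9 4 ''fffgfehggfgdefehed'' ''ppsspprEffrprpssrrssssspppss''"
  "check 9 5 ''fffhfdfegggeefegee'' ''ppprpssrssssrsEfgssrsspsspsCefsspsspsspssssssss''"
  "check 9 6 ''fffhfgfegggeefegee'' ''ppAffpsspssAffssAffsrssFffssrAffspsspssFfessssssspAffspsspYffssssssssTffssTff''"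
  "check 9 4 ''fffhfghhgggeefegee'' ''pprprrpsrrsrspssprsssprpsprrss''"
  "check 9 4 ''fffhfghggggeefegee'' ''pprprrsprrsrspsprssprpsprssrss''"
  "check 9 5 ''fffhfghhgfgggeegee'' ''pspHfgpsrsrpsssrsspHggpsAfepsssAefsrspsAfepsssssss''"
  "check 9 4 ''fffhfghggfgggeegee'' ''pprprrrspsrssprpspsrsrspsprsssrs''"
  "check 9 7 ''fffhfggfgggeefegee'' ''ppBffpssrssrAffsAffssrCffsCffsspDfgspsCfepsCefsssAefsspBfgspsAfepYffssYffssssssTffssTff''"
  "check 9 4 ''fffhfgghgggeefegee'' ''pprpsrrssrrsrppsprsprpsprsrss''"
  "check 9 3 ''fhfgfigfghggefehed'' ''rppprrrrrppsprsrrpprrr''"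
  "check 9 4 ''fffgfegfghgdefedee'' ''prprpssrsrrpppsrrssrsprprprssr''"
  "check 9 5 ''fffgfehgdgdeefeheg'' ''pAffpssAfepssspsssrspssprAffBffsssrssppBffprsssssssss''"
  "check 9 3 ''fffehegfgdgeefehed'' ''prrrprrprprprpsrrpprrr''"
  "check 9 4 ''fgfehgdfdgdeefeheg'' ''rspsrprpsprpssprsssrrspprprrssr''"
  "check 9 3 ''fgfehedfdgdeefeheg'' ''rpsrprrprprprrrrrpprprrr''"
  "check 9 5 ''fffgfegfghefehegee'' ''prspspsssrsDfgsrsEfgpspsrAffDegsssspspsppUefsssssUefsUef''"
  "check 9 3 ''fhfgfigfghefehedeg'' ''rppprrrrppsrsrrppprrr''"
  "check 9 4 ''fffgfegfgdefehedee'' ''prprpssrsrrprpsrrssssppprpsrssr''"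
  "check 9 5 ''fffhfdhfdfddgeefee'' ''psppssEffsssssspsssrsspssrpssssrspEfgspsrAfgspssss''"
  "check 9 3 ''fffhfdhfdfddgfegee'' ''ppprrrrprrprpsrrrrrrpp''"
  "check 9 3 ''fffhfdhfdfdddgegee'' ''ppprrrprrprpsrrrrrpp''"
  "check 9 5 ''fffhfdhfdfddefegee'' ''pssppAffAffssssspsssrpssrpsAffsrsrEfgEfgpspsspssss''"
  by (simp_all only: code top_code nodes10)

lemma level9_6:
  "check 9 4 ''fffhfdhfdfdddeegee'' ''psppsrrrspsrrpsrppsrsrsrrspsp''"
  "check 9 4 ''fffhfdfghfdfddegee'' ''psppprrrspsrrpsrpsssrsrsrrsspsp''"
  "check 9 2 ''fffhfghgghgggeegee'' ''ppprrrrpprprrppsr''"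
  "check 9 3 ''fffgfegfghgdefedeg'' ''pppsrrrrpppsrsrprpprss''"
  "check 9 3 ''fffgfehghegfefegee'' ''psspsspsppsssprrrrpssppssss''"
  "check 9 3 ''fhfgfehgdgdeefeheg'' ''rpprppsrspsprsrsppsps''"
  "check 9 3 ''fffgfegfghefehedee'' ''pspprrsrrpprrsrsppprps''"
  "check 9 2 ''fgfifehgdgdeefedeg'' ''sppprprsprprrpr''"
  "check 9 2 ''fgfifehgdfdgdeefed'' ''ppprprprprrprsr''"
  "check 9 2 ''fffgfifehgdgdeefed'' ''pppprprprsrprsr''"
  "check 9 3 ''fgfifehgdgdeefedee'' ''spsppsspsrspsrprssprpp''"
  "check 9 2 ''fffhfdfehfdfddefee'' ''pppprprpsrssrsp''"
  "check 9 2 ''fffhfdhfdfdddeefee'' ''pppsprprprrsrsp''"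
  "check 9 2 ''fffhfdhfdfdddeedee'' ''pppsprprprrsrrp''"
  "check 9 2 ''fffhfdfgfegfefegee'' ''pppsrrrprrprrpprr''"
  "check 9 2 ''fffhfgfehfgfefegee'' ''pspprrprrrrprpprrr''"
  "check 9 3 ''fffhfgfegfghefegee'' ''ppppssrrsppsrrprppsrr''"
  "check 9 3 ''fgfehghegfghgeefed'' ''rspssprpsprrpprrprsprp''"
  "check 9 5 ''fffhfgfehfgfggefeg'' ''ppspsppHggsAffssAffssssprspssrssprspsrrssssssrss''"
  "check 9 4 ''fffhfghggfghggegee'' ''ppprrrrspsssssppprrsrrpsprrsssss''"
  "check 9 7 ''fffhfgfegfggefegee'' ''ppBffpsspsAffssAffssCffGggsCffsEfgpAffCffpssrssCefsssssspAffAffpAfepYfgssYfgssssssTgfssTgf''"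
  "check 9 3 ''fffhfgfegfggefedeg'' ''pppprrrrrrprsprprprrrr''"
  "check 9 4 ''fffhhfhhgggeefegee'' ''psprrsspprssrrsrspsrpsrrppsrp''"
  "check 9 3 ''fgfehghegfghefehee'' ''rrprrprsprprrpprrrrrppr''"
  "check 9 3 ''fffhfdfegfgeefegee'' ''pprprsrrsrprrpsprppsrsr''"
  "check 9 4 ''fffhfghfgfggefegee'' ''ppsprprssrsrprspsrssprpsprssrss''"
  "check 9 3 ''fffhfghhgfggefegee'' ''ppspsrrsrrrprpsrprpsprsr''"
  "check 9 2 ''fffghfhghegfghgged'' ''prprprppsppprrrrrr''"
  "check 9 3 ''fffhfghggfggefegee'' ''ppprrsrrrprprprpprssrs''"
  "check 9 4 ''fffhfghfgfghggegee'' ''ppspsrprsrsssppspsrsrrpsprrsssss''"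
  by (simp_all only: code top_code nodes10)

text \<open>The entry with excess 9 is the three by three grid with its 28 triangles.\<close>

lemma level9_7:
  "check 9 5 ''fffgfehfgfghggefeg'' ''psrspspspssrCgfsssssppspssrssssssprspsAffrssssssss''"
  "check 9 3 ''fffhfghfdfdgefegee'' ''pprprprprrrrrprpsprr''"
  "check 9 2 ''fffghgdfdgdeefeheg'' ''prprprpprsrrppprrr''"
  "check 9 3 ''fffgfegfgeefehedee'' ''prppsrrrrpsrrprpprpsrr''"
  "check 9 3 ''fgfehgdfdgdegfefeh'' ''rprrpsprpsrpprrsrspprrr''"
  "check 9 3 ''fhfgfehgdgdegfefeh'' ''rprrppsrprpprrssrspprrs''"
  "check 9 3 ''fgfehegfghgdefedee'' ''rrprpsrsprrppprrrrprp''"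
  "check 9 3 ''fgfehegfghgdggefed'' ''rsprpsrprrppprrrsrprp''"
  "check 9 3 ''fffgfehfgfghefegee'' ''psspppssrrsppsrrprpprsrr''"
  "check 9 2 ''fffgfehegfghefegee'' ''ppprrrrrprrrprsprrr''"
  "check 9 3 ''fffgfegfgggeefehed'' ''psspprrrsssprrppssppprrrrss''"
  "check 9 2 ''fffhfghgdgdeefeheg'' ''ppprrrrprrrsrppprr''"
  "check 9 2 ''fffgfegfghefedegee'' ''prpprsrrrprrrrprpprr''"
  "check 9 5 ''fffhfgfegfgeefegee'' ''pprpspAffssAffsrssFffspssrpsssspAffspspTffssrsssrssr''"
  "check 9 3 ''fffhfdfegfgeefedee'' ''pprrprrrrrsrprrppprprrrr''"
  "check 9 4 ''fffgfegfghgeefegee'' ''prrpprssrrrpprrpssprrpprrrr''"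
  "check 9 4 ''fffgfegfgeefehegee'' ''prrpprsssrrrprrrpspprpprrssrr''"
  "check 9 3 ''fffhfghfhggfghggee'' ''ppprprprsppsprrrrrrrrrr''"
  "check 9 5 ''fffgfegfghggefegee'' ''prspspAffssrsrssssppsprsssprspsprssssssrsr''"
  "check 9 5 ''fffgfegfggefehegee'' ''prspspssssssrsrsprspsrsssppspsprssssrsr''"
  "check 9 9 ''fffgfegfgggeefegee'' ''pAffBffpsspEffssGffEffFffssHffFffpCffDffpDfeCfepsHfeFfesGfeEfepAffBffpBfeAfepYffssUffssssSffssWff''"
  "check 9 3 ''fffdfegfgeefehedee'' ''pprrprrrrprrpspprprrrr''"
  "check 9 5 ''fffhfdhfgggeefegee'' ''ppprrssssprrssrGffEffssrsspsspssssssppsspssss''"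
  "check 9 2 ''fffgfehggfefehegee'' ''prpprrrrprsrrprprr''"
  "check 9 3 ''fffhfdfehfgfgeefee'' ''ppprpprsrrsprrpprrpssrr''"
  "check 9 3 ''fffgfegfefehedegee'' ''prrppssrrrprrrrrpppppssrr''"
  "check 9 3 ''fgfehegfgdefehedee'' ''rrprpsrprrprprrrsspsppp''"
  "check 9 3 ''fffhhfhggggeefegee'' ''pprrrprsprsrpspsssppsps''"
  "check 9 1 ''fffehgdgdegdefehed'' ''prppprpspppr''"
  "check 9 1 ''fffehghedegfgdifeh'' ''rppppprsp''"
  by (simp_all only: code top_code nodes10)

lemma level9_8:
  "check 9 2 ''fffhfgfehfgfggefee'' ''psppsrsrprrprprprrr''"
  "check 9 2 ''fffhfgfehfgfgeefeg'' ''psppsrrsprrpprprrrr''"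
  by (simp_all only: code top_code nodes10)

lemmas nodes9 =
  level9_1[THEN node_fact, unfolded node_code]
  level9_2[THEN node_fact, unfolded node_code]
  level9_3[THEN node_fact, unfolded node_code]
  level9_4[THEN node_fact, unfolded node_code]
  level9_5[THEN node_fact, unfolded node_code]
  level9_6[THEN node_fact, unfolded node_code]
  level9_7[THEN node_fact, unfolded node_code]
  level9_8[THEN node_fact, unfolded node_code]

lemma level8_1:
  "check 8 1 ''fffhfdfeggefegee'' ''prsrrprppp''"
  "check 8 1 ''fffhfghfgeefegee'' ''psprrrrppp''"
  "check 8 2 ''fffhfggfgeefegee'' ''ppsprssrrprpprppsrs''"
  "check 8 1 ''fffhfehggeefegee'' ''prrrrrppps''"
  "check 8 1 ''fffehegfghefedee'' ''prrprrprrpsp''"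
  "check 8 1 ''fffehegfefehedee'' ''prrprpsrrrppp''"
  "check 8 1 ''fffhfehfdfddggeg'' ''pprprprpsrpr''"
  "check 8 1 ''fffgfihgdgdegdeh'' ''prprpsprp''"
  "check 8 3 ''fffhfdfehfgeegee'' ''pppsppsrrsrrsrrrpssrspsp''"
  "check 8 2 ''fffhhfgfgggeefee'' ''pprrrprrrrrppprrps''"
  "check 8 2 ''fghghegfghggefed'' ''rrprrrppspprprrpr''"
  "check 8 4 ''fffgfehegfghefed'' ''pspsspssrspBffrpsprrsrssssssssprpAffAffssssss''"
  "check 8 3 ''fffdfehfghgeegee'' ''psppprrrrprrrprspsps''"
  "check 8 2 ''fghgdgdegfefeheg'' ''rrprrrprpprsrrpprp''"
  "check 8 3 ''fffgfehggfefehee'' ''pspspprsrrprrrsrspprrpsssr''"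
  "check 8 3 ''fffgfehegfefehed'' ''ppsprprrprrrsrrssppprr''"
  "check 8 2 ''fffdhfdfdhddefee'' ''prrprrrrpprsrrrrp''"
  "check 8 5 ''fffhfdgggeefegee'' ''ppprssrssssssrssssrGfgEfgssssAffsspsspDefssCefsssspsspsspssssssssss''"
  "check 8 5 ''fffhfegggeefegee'' ''pprrsspssAffssAffsrFffssssrsspsspssFfesFfessAefsEfepsspsspYffssssssssssTff''"
  "check 8 3 ''fffhhhgggeefegee'' ''pprrrrrrrrpsrprrspprp''"
  "check 8 4 ''fffhhggggeefegee'' ''pprrsrsrssprssssAffsspsAfeprssssspspsspTfgssss''"
  "check 8 4 ''fffghfhhgggeegee'' ''psrrpssppsssrsrsspsrpsssrEferspsAfepssss''"
  "check 8 3 ''fffgfehghegfghed'' ''ppsrprrpsrprspprrsrrrrrs''"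
  "check 8 3 ''fffghfghgggeegee'' ''prrprprsrsrrprrprrrpspss''"
  "check 8 4 ''fffhgfgggeefegee'' ''pprrssrrssAffsrssCffspspssprsrspspsspYffsTffs''"
  "check 8 3 ''fgfigfghggefehed'' ''rrpprrrsrrsprprprrsrprpr''"
  "check 8 4 ''fgfegfghgdefedee'' ''rsrprpAffrsrsCffsrpsppssrssrsspsrpspsss''"
  "check 8 5 ''fffehegfghgdefed'' ''psrAfgsspssssAffspFffssFffpsppssrssssssssrssEfessspssAffpsssAffssssssssss''"
  "check 8 3 ''fffehegfgdefehed'' ''prrrprpsrprrpsrrrsrsrpspr''"
  "check 8 4 ''fgfehgdfdgdeefeh'' ''rspssrprsspssrppsrprssssrssspprrrsss''"
  by (simp_all only: code top_code nodes9)

lemma level8_2: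
  "check 8 3 ''fgfehedfdgdeefeh'' ''rprrprsrsppsrprsrrrpprrr''"
  "check 8 3 ''fgfigfghefehedeg'' ''rrpprrrrrsprprrrrsrprpp''"
  "check 8 4 ''fgfegfgdefehedee'' ''rsrprpsssrsrsrpsrpssrssrsspsppspsss''"
  "check 8 3 ''fffhfdhfdfddgeef'' ''prppssrrprrrsprrprprrr''"
  "check 8 3 ''fffhfdhfdfddefeg'' ''pppssrrrprrrprrpsrrrspr''"
  "check 8 3 ''fffhfdfghfdfddeg'' ''ppprrrprrrprrprrrssspr''"
  "check 8 2 ''fffgfehgdegdefeh'' ''ppsppCffrprspppEffsAff''"
  "check 8 1 ''fffehegfghefehed'' ''rprpprrpps''"
  "check 8 3 ''fffhfdfegeefegee'' ''pprprssrrrrrrpsrprprpsrrr''"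
  "check 8 5 ''fffhfgfeggefegee'' ''ppspspsAffssssrGggsFffsEfgrAffspssrssssssssspBfgspspYfgsTgfTgfssssTgfsTgfTgf''"
  "check 8 4 ''fffhfghfggefegee'' ''ppsprprssrrsrAffspsAferssprpAfepssssrss''"
  "check 8 3 ''fffhfghhggefegee'' ''ppsprrrrrrrprrrprprprrr''"
  "check 8 7 ''fffgfehggfghggef'' ''pHggspsAfepssDggDggspsDggCgfssHgfsEffpspDgfpsEffssEfeHggssspsBfgAffAffsAffSfeTfgUfeVfgssSfess''"
  "check 8 5 ''fffhfghfgfggegee'' ''psspBffpssEffsspsrCgfAffssEffGgfsssprBffpsAfersssssAefsssrspspYffssYffssssYffss''"
  "check 8 4 ''fffhfgfehggfggef'' ''pppsprspsrssDfgsspsrspsrssprsrsrsssssUfess''"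
  "check 8 4 ''fffhfgghggefegee'' ''ppspsrAffsssrrssrpspsrssprpAfeprrsssrrs''"
  "check 8 3 ''fffgfegfghefedee'' ''prpprrrrrprrrrsprprprrr''"
  "check 8 4 ''fffhfdfehfgfgeee'' ''pppspsspsrsrrsssprrspssrsrspssrssssss''"
  "check 8 4 ''fffgfegfefehedee'' ''psrpspssAffEfgrrprrAffrrsssssppprpsssssssr''"
  "check 8 3 ''fgfehedfdgdegfef'' ''rprrprrpprrpprrssrprrrr''"
  "check 8 3 ''fgfehfgfghgdefed'' ''rprprrrrpppsrrrrrsrprpsr''"
  "check 8 3 ''fgfegfghgdefedeg'' ''rsprpsrrrrppprrrrrrprpr''"
  "check 8 3 ''fgfegfghefehedee'' ''rssprprrsrrpprrrrrrrpppr''"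
  "check 8 1 ''fffhfehfggefegee'' ''psrrrrprpp''"
  "check 8 2 ''fffhfegfggefegee'' ''ppsrpsrspprpppsTgfr''"
  "check 8 3 ''fgfehggfghggefeg'' ''rrprprrprrsspprpsrprssss''"
  "check 8 4 ''fffhfdfehfgggeee'' ''pppspsssprrssrssrsrprspsssssrsrspssss''"
  "check 8 3 ''fgfehggfghggefed'' ''rrprprrprrsspprpssrsprs''"
  "check 8 5 ''fffhfdhfgfgggeee'' ''psppAffsrsssssspssDgfrDgfssCgfrsssspsspsspsssAefssAefssrsspsssssssss''"
  "check 8 3 ''fffhfghfddgggeeg'' ''pprpsprsrsrrpsrpsrsrrpr''"
  by (simp_all only: code top_code nodes9)

lemma level8_3:
  "check 8 3 ''fffgfehggfghefed'' ''pprpprrspprrrsrsprrr''"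
  "check 8 5 ''fffgfehggfghefeg'' ''psBfgspsAfepssAffssspssrssHgfBfgEffpspBffrsAffssssssspsrAffpsAffUfessUfessssUfessXef''"
  "check 8 4 ''fffgfehggfghefee'' ''psspsspspssrsrsspprrrsssssprsrpssssss''"
  "check 8 3 ''fffegfghgdefehed'' ''rrpsrsrpppsrrrrrrppps''"
  "check 8 3 ''fegfghgdefehedee'' ''ssrrprsrppprrrrrrppp''"
  "check 8 3 ''fgfehghedfdgdeef'' ''prrpprrpprrprrprrss''"
  "check 8 2 ''fffhfdhfgfgeegee'' ''pppsrpDgfrrsprppp''"
  "check 8 1 ''fffghegfghgdefed'' ''rrrpppsrprp''"
  "check 8 3 ''fffhfgfegeefegee'' ''pprppsAffrssssrrpsspssppTffssrr''"
  "check 8 3 ''fffgfehfgeefegee'' ''psrppprsssrsBffrssppspspsVffrr''"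
  "check 8 2 ''fffhfghfgfghggee'' ''ppprprrsppprrrrrrr''"
  "check 8 3 ''fffggfghggefegee'' ''prspsrsrrsppsprprpsprssrss''"
  "check 8 3 ''fffggfggefehegee'' ''prspsrssrsrsprprsspppprsssrss''"
  "check 8 2 ''fffhfegfgeefedee'' ''prrprsrprrpprprr''"
  "check 8 3 ''fffgfeggefehegee'' ''prsppssrsrsrsprssppppsssrsr''"
  "check 8 3 ''fffhfdhfgggeefee'' ''pppsrprrssrsEffrpspsssprsp''"
  "check 8 3 ''fffhfdfghfgggeee'' ''pppprprrrGffsrsspsspssssrp''"
  "check 8 3 ''fffhfdfegggeefee'' ''pprprrsrrsrrrprpsssprrprrr''"
  "check 8 4 ''fffghfgfgggeefee'' ''prrpsrpssrsssspsspsspsspssrssprssrssss''"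
  "check 8 4 ''fffhfghhgfggegee'' ''pspspssrpssrHgfsprprrsssrBfgpAfeprrssrs''"
  "check 8 3 ''fffghghegfghgged'' ''prprrrprpDffppspsrrrrrrsrrr''"
  "check 8 3 ''fffhfghggfggegee'' ''ppprrrsrrrprpsrrrprprrsrs''"
  "check 8 4 ''fffhfghfghggegee'' ''pspspssprssrGgfsrpspsrrsssAffrpBfgprrssss''"
  "check 8 4 ''fffgfehfgfghefeg'' ''pssspspspsrsssrssppsrsEffsssssprspsrrsssrss''"
  "check 8 3 ''fffgfegfghefedeg'' ''prpprrrsrrpprrrssprprrsrr''"
  "check 8 3 ''fffhhfdfdgefegee'' ''pprrrsprsprrrrrrprpsprrr''"
  "check 8 3 ''fffghgdgdeefeheg'' ''prpsrrrprprrBffsrrrppsprrrr''"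
  "check 8 4 ''fffgfegfggefehee'' ''psspspssrsAffFffsrEfgprsprsssppAffrprsrsrr''"
  "check 8 4 ''fffgfegfgeefehed'' ''psspspsAffsrsrrprrrprssssspppBffrssrssr''"
  "check 8 3 ''fhfgfehgdgdeefeh'' ''rprrprprrprrprrrsrspprrs''"
  by (simp_all only: code top_code nodes9)

lemma level8_4:
  "check 8 3 ''fehegfghgdefedee'' ''rrrrpsrsprrprpprrrrrpsrp''"
  "check 8 1 ''fffhfdfehfggegee'' ''pprprrrrprspp''"
  "check 8 1 ''fffhfdhfgeefegee'' ''ppsrrrrrpp''"
  "check 8 6 ''fffgfegggeefegee'' ''prrpsspAffssssrssHffFffrsspBfeAfepsHfeFfesGfeEfepAffBffpBfeAfepYffssUffssssSffssWff''"
  "check 8 3 ''fffghhgfgggeegee'' ''prrpsrrsrpspspsssrpsprsrsr''"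
  "check 8 3 ''fffggggeefehegee'' ''prrprrrsCffrspspsppprsrsr''"
  "check 8 3 ''fffegfghgdefedee'' ''prrrprsrpprssrspspsprrr''"
  "check 8 3 ''fdfegfghgdefedee'' ''rprrprrpprssrspspprrr''"
  "check 8 3 ''fffegfgdefehedee'' ''prrrpsrssrpsprrsssppprrr''"
  "check 8 3 ''fdfegfgdefehedee'' ''rprrprrpsprrsssppprrr''"
  "check 8 3 ''fffhfdhfdfgfegee'' ''ppprrprrprrssrrrpp''"
  "check 8 4 ''fffhfdhfdfgeefee'' ''psppsrsssspssrrsspssrrssssrspsspsrsspsss''"
  "check 8 3 ''fffhfdhfdfdeegee'' ''ppprrsprrprrsrrssrpp''"
  "check 8 5 ''fffhfdhfdfefegee'' ''pssppBffAffssssspssHffFffsssspssrrBffssAffsssrssrsssssssspsspsspssssssssss''"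
  "check 8 1 ''fffhfdfghfgfggee'' ''pppprsrpprr''"
  "check 8 1 ''fffghegfghggefed'' ''pprrrppsppr''"
  "check 8 1 ''fffegfghefehedee'' ''rpssrprrp''"
  "check 8 2 ''fgfehfgfghgdefee'' ''rppprrppprprrsps''"
  "check 8 2 ''fffhfgfehfdfggeg'' ''pprpprprrrprrrprss''"
  "check 8 2 ''fffdhddfdhddefee'' ''prrprrrrpprsrrrrp''"
  "check 8 2 ''fghgdegfghefeheg'' ''rrprrprpprrsppr''"
  "check 8 2 ''fffgfigfghefehed'' ''rprrsrpprrrrrrppr''"
  "check 8 3 ''fehegfgdefehedee'' ''rrrrpsspsrpsrprrsrsrpsppp''"
  "check 8 2 ''fffhfgfehggfefee'' ''ppprrprrrrprrpsrr''"
  "check 8 5 ''fffhfdfegggeegee'' ''pppAffpssssssrsFfgssrsEfgssrsspsspsssssCefsssssAefrsspsspssssssssss''"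
  "check 8 4 ''ffhfgfgggeefegee'' ''prrrssrprrrrrsssspssprrpssrrppsspssssssss''"
  "check 8 3 ''fgfedgdeifefeheg'' ''rrprprrsrrprrprrrrpprp''"
  "check 8 7 ''fffhfghfgggeegee'' ''psspBffpEffssspsAffCgfAffsEffGgfssAffAffBffpBffAfepsFffsEfgssAefssEfeAffBfgspAfgAfepYffYffssssYffTffs''"
  "check 8 5 ''fffhfghhgggeegee'' ''pspHfgpssssssrsspsssrsGgfssrsHggspssAfepsssssssAefssrBfgspssAfepsssssssss''"
  "check 8 7 ''fffhfggggeefegee'' ''ppBffpssAffssAffAffsAffsCffCffsCffssAffAffspCfgAfepsCefsFfesAefsAefpBfgspAfgAfepYffsTffTffsssTffsTffTff''"
  by (simp_all only: code top_code nodes9)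

lemma level8_5:
  "check 8 5 ''fffgfegfghefehee'' ''psspsspssssssssrssAffDfgssrsEfgpspBffrsEffDegssssssspspAffrspUefssUefssssssUefssUef''"
  "check 8 4 ''fhfgfigfghefehed'' ''sppprsrrsrrsprpsrrsrsrssrsprpprrssss''"
  "check 8 5 ''fffgfegfgdefehed'' ''psspsspssssAffssrsCffsrpssrpCffssrsrsssssAefssssssspsppBffsrssssssssss''"
  "check 8 5 ''fgfehgdgdeefeheg'' ''rAffspssrspssssssssspsssEffrsspssAfeprsAffssssrssssssspspBffpsssssssssss''"
  "check 8 3 ''fffdhhdfddefegee'' ''prrprrrrrprprrrrrrspprp''"
  "check 8 4 ''fehegfgdgeefehed'' ''rrrrprrrrpsssrprrpsprsrsrpsppsssss''"
  "check 8 4 ''fffhfdhfdfddefee'' ''prppsAffssrrrpsrrrpsrrpsAffsrsrpsrrpss''"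
  "check 8 4 ''fffhfdhfdfdddeee'' ''prppsssrrrpsrrrpsrrppssssrssrAffAffrrpss''"
  "check 8 3 ''fffhfdfghfdfddee'' ''prpprrrprrrprrpsrrrrrrrp''"
  "check 8 3 ''fffhfdhfdfdddgee'' ''prpprrrprrrprrpsrrrrrrrp''"
  "check 8 3 ''fffgfehegfefehee'' ''pspspsrpsrrprrrrspprrpsssr''"
  "check 8 3 ''fffhfgfehggfefeg'' ''pppspsprsrsprsrrprsprrssrs''"
  "check 8 3 ''fffhfdfehfgeefee'' ''pppsppsrsrsrrrspprrspssssr''"
  "check 8 2 ''fffehggfgdefehed'' ''prsprrprprrsspppr''"
  "check 8 2 ''fffhfdhfdfggefee'' ''pppsrprrprrrrp''"
  "check 8 3 ''fffhfdfehfdfefee'' ''pppsppsspsrsssrspsrsps''"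
  "check 8 2 ''fffhfdhfdfdeefee'' ''ppprprprrrprps''"
  "check 8 2 ''fffgfeghefehegee'' ''prppsrrrrrsppppsrr''"
  "check 8 2 ''fffhfgfehfefegee'' ''pspprsrrsrrprppsrr''"
  "check 8 3 ''fffhfgfegfghggge'' ''pppprsrsssppppssrsrssssss''"
  "check 8 2 ''fgfehggfghefedeg'' ''rprprprrrpprrsrpr''"
  "check 8 2 ''fgfehggfghgeefed'' ''rrppprrrpprrrspr''"
  "check 8 3 ''fffhfghggfgggeef'' ''ppprrspsprpppsrsrssss''"
  "check 8 2 ''fffhfgfehfgfefeg'' ''pppsrrrprrrprprrr''"
  "check 8 2 ''fhfghggfghggegee'' ''rpprrrppppsrrrr''"
  "check 8 3 ''fffhfgfehfgfggef'' ''ppspppDggrrssprsprprrrrsrsr''"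
  "check 8 2 ''fffhhfhhgggeefee'' ''pprrspprrrrrprprr''"
  "check 8 2 ''fffhhfhhggefegee'' ''pprrspprrrprrrpr''"
  "check 8 5 ''fffhfgfegfefegee'' ''ppAffpsspsAffsssssrssrsrpAffsrrsssssssspAffspspTgfssssssssrssr''"
  "check 8 3 ''fffhfdfegeefedee'' ''pprrprrsrrrrrrrprpprrprrrr''"
  by (simp_all only: code top_code nodes9)

lemma level8_6:
  "check 8 4 ''fffgfehfgfefegee'' ''prrpppssssrssrrprrrssrsprrpprssrssrr''"
  "check 8 3 ''fffgfehhgfefegee'' ''prrpsprrrrrprrrrprrpprrrr''"
  "check 8 4 ''fffgfehegfefegee'' ''prrpsspssrprrrprrrrsprrpprsrssrsr''"
  "check 8 7 ''fffhfgfegfggefeg'' ''ppspspAffHggsBfgsFfgCffGggsDfgsEfgpDfgCffpDfgCffsssssssspBfgAffpBfgAffUffYggUffSgfssVfgssTggTggXff''"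
  "check 8 6 ''fffhfggfggefegee'' ''ppBffpssrsAffAffCgfAffssrGggDfgssprspssrsDegssAefsprspAfeprsYfgYfgsssssrTgfTgf''"
  "check 8 5 ''fffgfegfghefegee'' ''psAffspsspsssAffssAffsAffrsssrsrppCffrrDegssssssspsrAffpspUffssssssssrsssr''"
  "check 8 7 ''fffgfegfgeefegee'' ''pAffBffpBfespEffssEffEffFffsAggFffFffpAffBffAffsspFfesFfesspAffBffpBfepYffssZffssssYffssYff''"
  "check 8 4 ''fffhfdfegfgeefee'' ''ppprsprrsrrrsrprrspssssprrspsrrsrr''"
  "check 8 3 ''fffhfggfggefedeg'' ''ppprrrrrrrprsprprprrrrrr''"
  "check 8 5 ''fffgfegfefehegee'' ''pAffspsspssssssAffssrssrrpsrBffrsrFfessssssppAffppZfesssssssrssr''"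
  "check 8 5 ''fffhhfgggeefegee'' ''pssprrssAffssspsrsAffsssrGgfssssrsspsrpFffssrssspspsAfepsssssssssss''"
  "check 8 4 ''fffhhfghgggeegee'' ''psprrrssprrssrrssrpprrprsrsrrpsrpss''"
  "check 8 1 ''fffgfihgdeghgdeh'' ''pprsprpp''"
  "check 8 1 ''fffhfgheghggedeg'' ''pppsppp''"
  "check 8 2 ''fffhfdfehggeefee'' ''ppprrrrrrpprrpsr''"
  "check 8 1 ''fffhfghgdeggeheg'' ''ppprrsprrpp''"
  "check 8 1 ''ffhgdfdeefehegee'' ''prrprpsrppp''"
  "check 8 2 ''fffehedgdeghefed'' ''prspppspAffpEffCffppr''"
  "check 8 1 ''fffhfghgdeefeheg'' ''ppprrrsrppp''"
  "check 8 2 ''fffgfehfghefegee'' ''psppprsrsrrpsppYgfrr''"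
  "check 8 1 ''fffdfeheghefedee'' ''pppsrrrrppp''"
  "check 8 2 ''fffhhfddgggeefeg'' ''pprrsprrrsrppBgfpr''"
  "check 8 2 ''fffhfehfgggeefeg'' ''pprrprrrsrrppprs''"
  "check 8 3 ''fgfehfhggfghefeg'' ''rspspppsrsssppsrssssprsps''"
  "check 8 4 ''fffhfgfegfggefee'' ''ppsppAffssssCffsCffsprsprssspssrprsrssrsr''"
  "check 8 3 ''fhfghfhggfghggee'' ''rpprrprprrsppsprrrrrrrrrrrr''"
  "check 8 2 ''fffgfehedgdeghed'' ''pprprppspAffprp''"
  "check 8 1 ''fffehgdegdefehee'' ''prpsprpppr''"
  "check 8 1 ''ffhgdfdegdefehee'' ''psppppsp''"
  by (simp_all only: code top_code nodes9)

lemmas nodes8 =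
  level8_1[THEN node_fact, unfolded node_code]
  level8_2[THEN node_fact, unfolded node_code]
  level8_3[THEN node_fact, unfolded node_code]
  level8_4[THEN node_fact, unfolded node_code]
  level8_5[THEN node_fact, unfolded node_code]
  level8_6[THEN node_fact, unfolded node_code]

lemma level7_1:
  "check 7 1 ''fffhfdgeefegee'' ''pprrrssrrsrpsrpprp''"
  "check 7 2 ''fffhfggeefegee'' ''ppBffprAffssrsssAffrpsssprpspssrss''"
  "check 7 2 ''fffhfegeefegee'' ''pprrpsAffrssssrrpFfeFfespspspTffsssssr''"
  "check 7 1 ''fffhhggeefegee'' ''ppsrrprrpspppTfg''"
  "check 7 4 ''fffhfghfggegee'' ''psspBffpEffsspsrCgfsrGgfssrrBffpsAfersssssAefsssrBfgpAfepYffssssss''"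
  "check 7 0 ''fffghfghggegee'' ''prpsrprrpr''"
  "check 7 0 ''fffhgfgeefegee'' ''prrrrsrppps''"
  "check 7 5 ''fffhgggeefegee'' ''ppAffrssAffssrAffsAffsrFffAgfFffssAffspCfgAfepFfesFfeAefsAefpspAfgAfepYffssssTffssTff''"
  "check 7 1 ''fffehegfghefed'' ''prpspEffspprsrssspAffpr''"
  "check 7 0 ''fffhhfdfddefeg'' ''pprrprrsrpr''"
  "check 7 5 ''fffhfgggefegee'' ''ppBffpsAffsAffAffsssAgfGggHgfssrAffspsAfersHgessssprpAfepVefZfeTgfTgfssrTgfUef''"
  "check 7 2 ''fffhfeggefegee'' ''ppAffrpAffssrsssAffspsrssspsspspsssssr''"
  "check 7 1 ''fffhhhggefegee'' ''ppsrrrrrrprrrprp''"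
  "check 7 5 ''fffgfehggfghef'' ''pHggpsAfepssDggspsDggrHgfBfgEffpspDgfAffsEffssEfeHggFfgsspsrAffAffsAffSfesUfessSfesWef''"
  "check 7 2 ''fffhhfgfggegee'' ''ppBffrsprssrsspspssrssspspsss''"
  "check 7 1 ''fhfgfehggfggef'' ''rprprprrprprprsVfgs''"
  "check 7 1 ''fffhgfggefegee'' ''ppsrrrrrrrprrprpsTgfs''"
  "check 7 2 ''fffhfdhfgfgeee'' ''pppsrsspsrssrssspsrspsssAffspsss''"
  "check 7 2 ''fgfegfefehedee'' ''rsspspssssrrprrssrssssspppspss''"
  "check 7 1 ''fffegfghefehed'' ''rpAffDffrpprsrrrrpppr''"
  "check 7 1 ''fegfghefehedee'' ''rsrpssrpprrrrrppp''"
  "check 7 4 ''fffgfegeefegee'' ''pAffrpspAffsssrsAggFffEfgrssrsspFfesssspsBffpspYffsYffsssrssr''"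
  "check 7 1 ''fffehfggefegee'' ''prrrprrspsrppsprr''"
  "check 7 5 ''fffhfggfggegee'' ''ppDffpssEffsAffAffCgfAffsDfgGggDfgsprspsDfgrsDegssAefsrBfgpAfeprsYfgYfgsssTgfTgfs''"
  "check 7 1 ''fffggfghefegee'' ''prprrrrpsrrprprrr''"
  "check 7 2 ''fffegfggefegee'' ''pAffBffrspsssrsspssprspsspspVffUffsUffr''"
  "check 7 5 ''fffegggeefegee'' ''pAffrAffsspEffsssrsDffsFffEffsspBfeAfepsFfeFfesEfeEfepsBffpBfeAfepWffsUffsWffsSffXffsWff''"
  "check 7 1 ''fffegfgeefehed'' ''prrprrpsrsprpprrr''"
  "check 7 1 ''fffggeefehegee'' ''prrprrrrrpppsrrr''"
  "check 7 1 ''fdfegfefehedee'' ''rprrpsrpsrrrppprr''"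
  by (simp_all only: code top_code nodes8)

lemma level7_2:
  "check 7 1 ''fffhfdhfgeefee'' ''ppprprrsrrrrprsp''"
  "check 7 3 ''fffhfdfehfgeee'' ''psppspsssssspsssrssrsssrsrrrspssssssssssrrrspssssssss''"
  "check 7 2 ''fffhhgdfefegee'' ''pprrrrsprrrsrsrrrrpsppsrrrr''"
  "check 7 2 ''fhfegfgdefedee'' ''rrrrpsrsrprrprrrrrsprrppssrr''"
  "check 7 2 ''fffhfghfgfggee'' ''ppAffpsprCgfrEffGgfsprspsrssrprsssss''"
  "check 7 2 ''fffggfefehegee'' ''prspsrssrsrsprsrsssppsppssssrss''"
  "check 7 1 ''fdfeghgdefedee'' ''rprprrrprrspppr''"
  "check 7 2 ''fffegfefehedee'' ''prrspAffsBgfrpAffrsrrssspppspssssssr''"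
  "check 7 2 ''fffhfehfdfggeg'' ''psprrppsrCffpsrAffsHgfpssrsGgfpssrss''"
  "check 7 2 ''fgfegfgeefehed'' ''rsspspsssCffrrprrsprssssspppssss''"
  "check 7 4 ''fffgfegfefehed'' ''psspsspssBffssAffEfgrrpssrrrssrrsssssssssppprrssssssZeeVee''"
  "check 7 2 ''fffhfdfegeegee'' ''ppspsrsrrsrrrrrpsrssrrprprrrr''"
  "check 7 4 ''ffhfgggeefegee'' ''pssrrrssrpssssssrBfgAfgssrssprrpGfgEfgrssrppBfeAfepssssssssss''"
  "check 7 2 ''fffhfggggeedeg'' ''ppprrssrrrrprpssrrrprrrrrrs''"
  "check 7 2 ''ffhegggeefegee'' ''prrrsrrrrprrprrsrrpprrpssrsr''"
  "check 7 2 ''ffhfgfgggeefee'' ''prrrsrprrrrsspsprprrrssprsrrrss''"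
  "check 7 2 ''fffhdfigefegee'' ''pprrrrspsrrrrsrsrrsrppsprrrr''"
  "check 7 3 ''fffhfghhggegee'' ''pspspsssssrsspsssrsrsrsrspssrrssssssssrrpsrpssssssss''"
  "check 7 2 ''fghghegfghgged'' ''rrprrrsrrprpsppspssrsrrrrrrr''"
  "check 7 2 ''fffhfgfehggfef'' ''pprpspsrrsrpsrrrrsprrrrrsrrr''"
  "check 7 4 ''fffgfegfghefee'' ''psspsspsssEffsrsEffsssrsrpprrrsssssspsrrrspTfgsrsssssrssr''"
  "check 7 2 ''fhfgfigfghehed'' ''pppsrrrrprprrsssrsrrprrrrrr''"
  "check 7 3 ''fffgfegfghefed'' ''psspsspsssrsrsrsrpsprrsrsssssssssssspsrprsrssssssss''"
  "check 7 6 ''fffhfggggeegee'' ''ppBffpEffAefCefAffAffssCffCffssCffDfgspCfgCfepsCefCeeFfesAefAeeEfeAffBfgspAfgAfepYffYffYffTffYffTffTffTff''"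
  "check 7 2 ''fffhfghfddggeg'' ''psprpssprsrrrrspsrrrrprrrrrr''"
  "check 7 2 ''fghggfghggefed'' ''rrprrrrprrsspprpsssrrspsrsrrrr''"
  "check 7 2 ''fghgdgdeefeheg'' ''rrpssrrrssrrprprrsrrppsprrrr''"
  "check 7 2 ''fghedgdeefeheg'' ''rrspsrrrsssrrprprrrrppspsrrrr''"
  "check 7 4 ''fffgfegfefehee'' ''psspsspssssssAffsAffFffsrrpsrrrsrFfessssspprrpZfessrsssrsr''"
  "check 7 3 ''fegfgdefehedee'' ''rssrrrpssssssssrssssrpssrpsssrssrrssrssspspppssssssssss''"
  by (simp_all only: code top_code nodes8)

lemma level7_3:
  "check 7 3 ''fgfehedfdgdeef'' ''sspsrrspsssssrsssppprrsprssssssrssssssspsrrrssrssssssssss''"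
  "check 7 2 ''fhfgfehgdgdeef'' ''rprrprrprrrprrprsssrprrrrs''"
  "check 7 2 ''fegfghgdefedeg'' ''rrrrpssrssrprpprrrrrrprrprs''"
  "check 7 3 ''fffegfgdefehed'' ''psrrpsAffsrssrpssrpsssrsrssrssrssrsssspsppssrssssssssss''"
  "check 7 3 ''fegfghgdefedee'' ''rssrrrpsssssssrssssssrpsppssssrssrrssrspssrpspssssssssss''"
  "check 7 0 ''fffhfdfghfggee'' ''ppprrrsrprr''"
  "check 7 2 ''fffghhgggeegee'' ''prrprrrsrsprrprrsrrrsprrprsr''"
  "check 7 0 ''fffghegfghefed'' ''pprrrpprrspr''"
  "check 7 2 ''fffggfghefehee'' ''prprrrssrsprprrsrrrrprprrrssrs''"
  "check 7 3 ''ffgfgggeefegee'' ''prrrssrrssssrsssspsspsspsssspsspsspZffssVffssssSffssWff''"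
  "check 7 2 ''fffhfdfghfdfee'' ''ppprrrrrprrrrprrrrssrsrsrsrps''"
  "check 7 2 ''fffhfdhfdfdeee'' ''ppprrrrrprrrrprrrrssrrssrsrsps''"
  "check 7 3 ''fffhfdhfdfefee'' ''psppsAffssssspssrrsssspssrrsssAffssAffsrssssspsrsspssssssssss''"
  "check 7 2 ''fffhfdhfdfdeeg'' ''ppprrrsrrprrrrprrrrsrsrssrsprs''"
  "check 7 0 ''fhfghfgggeegee'' ''rssrprprpp''"
  "check 7 0 ''fffhfghfhhegee'' ''pprprrrsrrp''"
  "check 7 0 ''fffhfghfgeegee'' ''prsrrsrrpp''"
  "check 7 1 ''fffhfghfefegee'' ''ppsprsrrrrsrrprppr''"
  "check 7 0 ''fffehfgfghefeg'' ''rppsrpprr''"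
  "check 7 1 ''fffhfgfehfefeg'' ''ppppsrrrsrsprprrr''"
  "check 7 1 ''fffegfghefegee'' ''prrpsrsrpsrrpsrppsrr''"
  "check 7 0 ''fhfggggeefegee'' ''rpspprrp''"
  "check 7 1 ''fffegfghefehee'' ''prpssssppsrsspprspr''"
  "check 7 2 ''fffgfeheefegee'' ''prrpsprsrrrrssrrrprrpprrrrrsr''"
  "check 7 1 ''fgfehgdgdeeheg'' ''ssprprprsprrpssrrp''"
  "check 7 3 ''fffhfgfegfggge'' ''ppsppsrAefsrsrCffsssspAffspspssssssssrssrrrssrsYgfssYgfss''"
  "check 7 0 ''fffghfgfgeefee'' ''prprpsrprr''"
  "check 7 2 ''fffhfggfefegee'' ''ppsprssssrsBggspssrAffssprppssssrss''"
  "check 7 1 ''fffhfegfefegee'' ''prrprsrprrprppsrr''"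
  "check 7 0 ''fffhfghggfgeef'' ''prspprrppsrr''"
  by (simp_all only: code top_code nodes8)

lemma level7_4:
  "check 7 0 ''fffhfggggeefee'' ''prrrsrpprr''"
  "check 7 4 ''fffhfgfegfefeg'' ''ppspspAffHggAffssCffssrsrprsrrsssssssprspsrrYggssssssrTggr''"
  "check 7 1 ''fffghfgfggefee'' ''prsprprsprsprprrrs''"
  "check 7 1 ''fgfehegfefehee'' ''rpspsrprrprrrsppr''"
  "check 7 2 ''fffhhhgfggegee'' ''pspsrssrpssrsspsprrssssspspsss''"
  "check 7 6 ''fffgfegfefegee'' ''pAffBffpBfeAfepAffAffBffBffAffEfgssGfgEfgpAffBffBffAffFfeGfgEfgpAffBffppZffssVffZffVffZffssVff''"
  "check 7 1 ''fffhfggfggefee'' ''ppprrrsssprprprrrsr''"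
  "check 7 1 ''fffhhfgggeefee'' ''pprrrprrrrsrppsrrrp''"
  "check 7 1 ''fffhhfghggegee'' ''pprrrprrrrprrspr''"
  "check 7 2 ''fffgfeghefegee'' ''prrpprssrrsrrsrrrprrpprrrrrsr''"
  "check 7 1 ''fffehfghefegee'' ''psrpprspsrpppVfgr''"
  "check 7 3 ''fhfghggfghggee'' ''rsppsrrssssrrCgfpsrrssHgfpsspspsrsssssrrAefssrrrsprssrsssrssrsss''"
  "check 7 3 ''fffhfgfegfefee'' ''pprpspsssFfgrsrrsrsrprrrrssssssAefsprrrprssrsssssrssr''"
  "check 7 1 ''fffgfehfghefeg'' ''psppprrpsprprWefr''"
  "check 7 3 ''fffgfehfefegee'' ''pssAffBffpppssssssrBfgAfgrrrAffBffrBfeAferssssssspsspsspZffssVffssssrssr''"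
  "check 7 1 ''fffghghegfghed'' ''pprprpDffppsrssrrrr''"
  "check 7 2 ''fgfehggfghefee'' ''rrpsrprpsrrrrrpprrrssrrrprrrs''"
  "check 7 3 ''fgfehggfghefeg'' ''rsBfgspsrpssAffssspssrssrBfgEffpsprrsssrsspsrAffpsssssssssss''"
  "check 7 3 ''fffhfdfegeefee'' ''ppprspssssssrsrAffsrsrsssrrrrrpssssssssprrrpsrrssssssrr''"
  "check 7 5 ''fffgfegfggefee'' ''pAffDffpsspEffCggHfgEffHffBggHffEfgpDfgDffpsrsssspAffAfgrsprssUffssssSffssr''"
  "check 7 3 ''fffhhggggeegee'' ''psprrrsssrsrsprrssrssssprrpsrsrsrsrrsssprrpsssssssssss''"
  "check 7 3 ''fgfegfghefehee'' ''rrspsrpssssssssrssrsssrsrprprrsrrsrrsprprrpsssssssssss''"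
  "check 7 1 ''fffghgdgdeefeh'' ''pprrprprrBffsrrppr''"
  "check 7 1 ''fffhfdgggeefee'' ''ppsrrssrrsrsprpsprp''"
  "check 7 2 ''fgfehfgfghefeg'' ''rsspspsprsssssppBffssssssssprspsWefss''"
  "check 7 1 ''fffghfgggeefee'' ''prrprprssrrpprrpsss''"
  "check 7 1 ''ffhegfghgdefed'' ''Affrsprprppssrrrsprp''"
  "check 7 0 ''fffhfegfggefeg'' ''prrrprprss''"
  "check 7 0 ''fffhhggggeefee'' ''pprrrspprr''"
  "check 7 1 ''fffehgdegdefeh'' ''pAffspspFffprsrrpEffrAff''"
  by (simp_all only: code top_code nodes8)

lemma level7_5:
  "check 7 1 ''fffehedgdeghed'' ''prBffppspsrrrAffprs''"
  "check 7 1 ''fffgfihgdegdeh'' ''pspsAffspsAffprrrpr''"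
  "check 7 1 ''ffhgdfdegdehee'' ''ppspprrrAffpsr''"
  "check 7 1 ''fffghedgdeghed'' ''psrppsprrrsspr''"
  "check 7 1 ''ffhgdegdefehee'' ''psAffpAffpprrrpsr''"
  "check 7 1 ''ffhedgdeghefed'' ''psAffpppsrHffrrsprs''"
  "check 7 1 ''ffhgdegfgdefeh'' ''pGffFffpprprsrsrprr''"
  by (simp_all only: code top_code nodes8)

lemmas nodes7 =
  level7_1[THEN node_fact, unfolded node_code]
  level7_2[THEN node_fact, unfolded node_code]
  level7_3[THEN node_fact, unfolded node_code]
  level7_4[THEN node_fact, unfolded node_code]
  level7_5[THEN node_fact, unfolded node_code]

text \<open>Below seven points the letter \<open>r\<close> cannot occur, as minimality is not yet
  imposed on the new point. The letter \<open>s\<close> still can at six points, since it concerns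
  extensions of the resulting seven-point set.\<close>

lemma level6_1:
  "check 6 2 ''fffhgeefegee'' ''ppAffAffAffsAffFffssFffAffAffpFfessppspsTffs''"
  "check 6 3 ''fffhggefegee'' ''ppBffAffsAffssAffsssAgfGggHgfssAffspssAffHgesssspspAfepsssssUefsUef''"
  "check 6 3 ''fffeggefegee'' ''pAffBffBffspAffssHffsssEfgAffspssAffsHfessspsBffpAfepsUffsssUffssUff''"
  "check 6 1 ''fhfegfefedee'' ''ssspsEfgpAffppp''"
  "check 6 4 ''fffegeefegee'' ''pAffBffAffspEffsFffAggsEfgEffssAffsAfepssFfeEfepAfgpBfepTffsZefsYefYefZefYef''"
  "check 6 1 ''ffhfgeefegee'' ''pssBffEffEffAffppsp''"
  "check 6 1 ''ffhggeefegee'' ''pAffsssHffBffpppp''"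
  "check 6 5 ''fffhfgggegee'' ''ppBffpEffDegAffAffCgfDfgGggHgfAffDfgCffpCfgAfeAffDegHgeGggEfgAefAefAffBfgpAfepVefZfeYfgTgfVefTgf''"
  "check 6 1 ''fffhfghfggee'' ''ppAffppHggsGgfAffsspsEffAff''"
  "check 6 1 ''fffggfghefee'' ''ppAffsDfgpsspAffAffs''"
  "check 6 1 ''fffggfefehee'' ''ppAffBggpAffsspAffss''"
  "check 6 1 ''ffgfgeefegee'' ''pAffBffBffEffCffAffpppZffs''"
  "check 6 5 ''ffgggeefegee'' ''pAffBffBffBfeAfeAffAffBffAffFffFffHffGfgEfgAffpBfeAfepHfeFfeBefAefppBfeAfepSffWffSffWffSffXffTffWff''"
  "check 6 1 ''fegfghefedee'' ''ssspDffpAffspAffp''"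
  "check 6 1 ''feghgdefedee'' ''sAffspFffAffpsspp''"
  "check 6 1 ''fffegfghefed'' ''AffpAffDffspCffsDefpAffs''"
  "check 6 2 ''fffegfefehed'' ''pAffpssAgfpAffAffsAffCefssspppAffss''"
  "check 6 1 ''fehgdfdgdeef'' ''BffsppspHffpsssEff''"
  "check 6 2 ''fegfefehedee'' ''AffAffAffspssBgfAgfpAffAffFfeEfgssppppss''"
  "check 6 1 ''fffhfehfdfeg'' ''ppBffpspBfgssAffspEff''"
  "check 6 1 ''fgfehedfdeef'' ''pBfepsAffpspsEff''"
  "check 6 1 ''fegfgeefehed'' ''AffAffpspsCffCefpp''"
  "check 6 1 ''fegfggefehed'' ''sBffpsspsCffDefppp''"
  "check 6 0 ''fffdfehfgiee'' ''Effp''"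
  "check 6 0 ''fhfghfggegee'' ''AffsAfeAff''"
  "check 6 0 ''fffhfghhegee'' ''pAffssAffssp''"
  "check 6 0 ''fghgheghgged'' ''Affp''"
  "check 6 0 ''fffgfehgghef'' ''pFfgsAffBfgs''"
  "check 6 1 ''fffhfghfegee'' ''ppspAffEffGgfsAffAffAffsp''"
  "check 6 0 ''fffhfgfehgef'' ''AffEffpBfg''"
  by (simp_all only: code top_code nodes7)

lemma level6_2:
  "check 6 1 ''fhfggfggegee'' ''AffppDfgDfgpCffspsss''"
  "check 6 2 ''fffgfehgefee'' ''pspspEffsGffsEffsEffpssBffpssVfg''"
  "check 6 0 ''fhfggggeedeg'' ''Aff''"
  "check 6 0 ''fhfigfghehed'' ''Affsp''"
  "check 6 2 ''fhfggggeegee'' ''AffppAffHggCffGggCffDfgpsDfgpCefsAefsAffBfgpsBfgpss''"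
  "check 6 0 ''fffdfehfghee'' ''Effs''"
  "check 6 1 ''fffhfdfehfee'' ''pppsFfgEffAffsssp''"
  "check 6 0 ''fffhfghfddeg'' ''sAffp''"
  "check 6 0 ''hggfghggefed'' ''Affpss''"
  "check 6 0 ''fghgdgdeeheg'' ''AfeAffAffp''"
  "check 6 0 ''fghedgdeeheg'' ''pssAff''"
  "check 6 0 ''fhfgggefegee'' ''AffAffsp''"
  "check 6 2 ''fffegfefehee'' ''psAffpsEfgsEfgpAffssEffspAffspsssVef''"
  "check 6 0 ''fegfgdehedee'' ''sssAffp''"
  "check 6 0 ''fhfehgdgdeef'' ''Aff''"
  "check 6 0 ''feghgdefedeg'' ''Aff''"
  "check 6 0 ''fffeghgdefed'' ''ssCffps''"
  "check 6 0 ''fffhfgfeggge'' ''psAffpFffFff''"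
  "check 6 0 ''fffhfdfeggge'' ''pAefsspsCff''"
  "check 6 0 ''hgdfdgdeefeh'' ''ssAgfps''"
  "check 6 0 ''fffhgfefegee'' ''pAffAffEfgEfgAffAffTgf''"
  "check 6 0 ''fghgdeghggeh'' ''ssEffp''"
  "check 6 0 ''fffhfdgfggge'' ''pssAefDffCff''"
  "check 6 3 ''fffgfegfghgg'' ''pBfgpspsAefssAefAefsDfgssppspCgfsAefsssDfgDfgDfgssTfgssssssss''"
  "check 6 2 ''fffgfegfghge'' ''psppAefAefAefsspsCgfpsCffssssTfgsss''"
  "check 6 0 ''hgdgdeefeheg'' ''Affsps''"
  "check 6 0 ''fffhhfefegee'' ''pAffsEffss''"
  "check 6 0 ''fffhhhefegee'' ''psHgfAff''"
  "check 6 0 ''fhfghgdegheh'' ''pAfess''"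
  "check 6 0 ''fffhhgefegee'' ''psAffsAff''"
  by (simp_all only: code top_code nodes7)

lemma level6_3:
  "check 6 1 ''fffhfggeegee'' ''psAffFffsCffAffAffspp''"
  "check 6 1 ''fffhfggfegee'' ''pppEffEfgGggHgfAffCffAffspTgf''"
  "check 6 0 ''fffhfggggeed'' ''ssspAff''"
  "check 6 0 ''fffghggfefee'' ''pEffsss''"
  "check 6 0 ''fegfghefedeg'' ''ssAffsps''"
  "check 6 0 ''fggfghefedeg'' ''ssspspBff''"
  "check 6 0 ''fehfgfghefed'' ''sEffps''"
  "check 6 0 ''fgfehgdfdeef'' ''psBffsss''"
  "check 6 3 ''fffhfgfegfgg'' ''ppppAefBegsBegsAefCffsDfgspBfgspsAffssssssCffGgfDfgEffUffYggUffsVfgssUffss''"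
  "check 6 3 ''fffegfefegee'' ''pAffBffAffsspssssEfgsGfgEfgpAffBffAffEffssspsBffppZffssssVffVffsVff''"
  "check 6 2 ''fffeghefegee'' ''psAffpAffDfgsssAffssspsppsssXff''"
  "check 6 2 ''fffgfehfefee'' ''pBffppssssEffBffssEffpsAffpsVgfsVgf''"
  "check 6 5 ''fffgfegfggge'' ''pAffBffppAefAefBefBefAefCffDffCffpCgfDgfppAefBefAefCffCffDffDffCffTfgUgfTfgUgfYgfUgfTfgXfg''"
  "check 6 2 ''fffehfefegee'' ''psBffAffpEffsssAffAffsEffpsppsssVff''"
  "check 6 6 ''fffgfegfefee'' ''pAffBffpBfepEffFggEffEffFffBggGfgEfgpAffCfgAffEffFfepAffAfgAffpYffTffVffVffSfgTffUfgTff''"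
  "check 6 2 ''fffhfggfggee'' ''pppEffAffsssssDfgpDfgpCffsAffAffYfgssYfg''"
  "check 6 2 ''fffgfeggefee'' ''psHffppssHffsssAffEffpssBffpsUffSffSff''"
  "check 6 2 ''fgfegfghefee'' ''AffsppsAffsDfgEfgppCffssspAffsss''"
  "check 6 2 ''fhfgfehggfef'' ''AffpsppsFfgBfgsspsHggsAffEffpGgfssss''"
  "check 6 2 ''fgfegfefehee'' ''AffsppsAffsFffspAffssFfeppAffss''"
  "check 6 2 ''ffhfgggeefee'' ''pAffAfgAffEffpssssssAffpspssAffssps''"
  "check 6 3 ''fffhgfggegee'' ''ppDffAffssEffsAffAffCgfssDfgGggDfgspspssCffsssAefsAffspAfepYfgsssssTgfs''"
  "check 6 0 ''fffhfggfefee'' ''AffCffAffAffs''"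
  "check 6 0 ''fffhfegfefeg'' ''pAffAffsAff''"
  "check 6 0 ''fhfdfegeefee'' ''Affs''"
  "check 6 0 ''fffghfgfefee'' ''pEffBffAffAffs''"
  "check 6 0 ''fghfhgghggee'' ''sEff''"
  "check 6 1 ''fffhfgfeggef'' ''ppCffspFffpGgfBfgsss''"
  "check 6 0 ''fhfghggfggee'' ''sspAff''"
  "check 6 0 ''fffhfgggefee'' ''psAffAffAff''"
  by (simp_all only: code top_code nodes7)

lemma level6_4:
  "check 6 1 ''fffggfgeefee'' ''pBffpEffAffCffpDffpBffsYffsTff''"
  "check 6 0 ''fffhfdfegfee'' ''sCffsp''"
  "check 6 0 ''fffhhggeegee'' ''sAffAff''"
  "check 6 1 ''fffhgggeefee'' ''pAffAffEffAffAffFffCffppsAffp''"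
  "check 6 0 ''ffhfghggegee'' ''AffAffEffEffp''"
  "check 6 0 ''fgfeghefehee'' ''ssAffp''"
  "check 6 1 ''fffggggeefee'' ''pAffHffEffAffHffDffppBffpss''"
  "check 6 0 ''fhfegfgeefed'' ''ssCffp''"
  "check 6 0 ''fhfegfgdedee'' ''ssAff''"
  "check 6 0 ''ffhggggeefee'' ''AffssspBff''"
  "check 6 0 ''fhfggfefehee'' ''sGggGgfs''"
  "check 6 0 ''fffghhgeegee'' ''sHgfAffs''"
  "check 6 0 ''ffhhgfggegee'' ''AffssEffp''"
  "check 6 0 ''fffgghefehee'' ''ssAffpBfg''"
  "check 6 0 ''fffhfdfghfee'' ''psAffAffss''"
  "check 6 0 ''fffhfdhfgfee'' ''CgfEffsAff''"
  "check 6 0 ''fffhfdhfedee'' ''pssEffs''"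
  "check 6 0 ''fffhfdhfefee'' ''pssAffAff''"
  "check 6 0 ''fffhhfdfdgee'' ''pBffss''"
  "check 6 0 ''fffhfdhfdeeg'' ''sAffs''"
  "check 6 0 ''fffhhfgeefee'' ''pAffssAffs''"
  "check 6 0 ''fgfeheefehee'' ''sssAff''"
  "check 6 0 ''fffghfgeefee'' ''psEffAffAffBff''"
  "check 6 1 ''fgfegfefegee'' ''AffppEfgGfgEfgpsspssZffVff''"
  "check 6 0 ''fffhgfgeefee'' ''EffCffAff''"
  "check 6 0 ''fgfehfefegee'' ''Aff''"
  "check 6 0 ''fgfehgghefeg'' ''spHgfAffs''"
  "check 6 1 ''fhfgfegfefee'' ''AffppsFffspsspss''"
  "check 6 1 ''fffhfeggefeg'' ''ppBfgsDfgsAffpFffpAffXff''"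
  "check 6 1 ''fffhfdgeefee'' ''ppAffAffssCffEfgAffpAffp''"
  by (simp_all only: code top_code nodes7)

lemma level6_5:
  "check 6 1 ''fhfghggfghee'' ''pspssppAffss''"
  "check 6 1 ''fgfegfggefee'' ''Affppsssspsspss''"
  "check 6 1 ''fhhggggeegee'' ''Affpspssspsp''"
  "check 6 1 ''fhgggeefegee'' ''AffAffsFffpspFfespsp''"
  "check 6 1 ''fegfghefehee'' ''AffAffppsssppAff''"
  "check 6 0 ''fffghegfghed'' ''sAffHffsAff''"
  "check 6 1 ''fgfehfghefeg'' ''AffppsAffpBfgpWef''"
  "check 6 0 ''fffehegfghed'' ''spCffEffsAff''"
  "check 6 0 ''fffghfggefee'' ''psAffAffGff''"
  "check 6 0 ''fffghgdgdeeh'' ''sEffBffAffp''"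
  "check 6 1 ''fffhhggeefee'' ''psEffpsAffppAffTfg''"
  "check 6 0 ''fffeheghefed'' ''EffAffss''"
  "check 6 0 ''fffhhfddgeef'' ''sspEfg''"
  "check 6 0 ''fffhfehfefeg'' ''pAffsss''"
  "check 6 0 ''fffhhhgfegee'' ''sAff''"
  "check 6 0 ''fffhhgdeeheg'' ''sGffp''"
  "check 6 0 ''fffdheghedee'' ''sEff''"
  "check 6 0 ''fffghgheghed'' ''pDffAff''"
  "check 6 0 ''fffhheghgged'' ''sHff''"
  "check 6 0 ''fffdfghfgiee'' ''pBfgs''"
  "check 6 1 ''fehfgfghefeg'' ''AffAffpppsspWef''"
  "check 6 0 ''ffheghgdefed'' ''sFffAff''"
  "check 6 0 ''fffghedgdegh'' ''sAff''"
  "check 6 0 ''fhfghfgfggee'' ''Affss''"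
  "check 6 0 ''fffgheghgged'' ''sHffs''"
  "check 6 1 ''fffehfghefeg'' ''AffppAffppAffWef''"
  "check 6 0 ''fffghgdeeheg'' ''sGffsp''"
  "check 6 0 ''ffhgdgdeefeh'' ''AffsBffsp''"
  "check 6 0 ''fffhfdgfegee'' ''FffDffCff''"
  "check 6 0 ''fffeheghedee'' ''sEffs''"
  by (simp_all only: code top_code nodes7)

lemma level6_6:
  "check 6 0 ''ffhghegfghed'' ''AffpDffs''"
  "check 6 1 ''fffhhggggeef'' ''pGgfCgfDggpFfgppBfgAffWef''"
  "check 6 0 ''ffhegfghefed'' ''AffAffBffAffs''"
  by (simp_all only: code top_code nodes7)

lemmas nodes6 =
  level6_1[THEN node_fact, unfolded node_code]
  level6_2[THEN node_fact, unfolded node_code]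
  level6_3[THEN node_fact, unfolded node_code]
  level6_4[THEN node_fact, unfolded node_code]
  level6_5[THEN node_fact, unfolded node_code]
  level6_6[THEN node_fact, unfolded node_code]

text \<open>No entry has excess 4, in accordance with the gap at seven triangles. The entry with
  excess 5 is a square with its centre, which has eight.\<close>

lemma level5:
  "check 5 2 ''ffgeefegee'' ''pAffBffBffBfeAffAffAffFffAggGfgEfgAffAffBfeAfepFfeFfeAefppBfepTffTfeYefYefYefYef''"
  "check 5 1 ''fhfgggegee'' ''AffppHgeAffHggCgfHgfGggHgfAffHgfCffpCfgDfgAffHgeHgeGggEfgAefAefAffBfgpBfgpVefYfgYfgTgfTgfTgf''"
  "check 5 1 ''fffgfegfgh'' ''pBfgpAfepAdfAefAefAefDfgGggDfgppCgfAffAffDegAefAefFfhAefDfgDfgDfgBfgEffUfeUfeUfeTfgUfeXef''"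
  "check 5 3 ''fffgfegfge'' ''pAfgppAefAefAefAefCffCffFffpAffBffAffpAefCffAfgCffFffYffXfgYffUgfZfgTffYff''"
  "check 5 5 ''fffgfegfef'' ''pppHfgFfgGfgEfgpDfgCfgDffCffpBfgAfgBffAffYffUffSffWff''"
  "check 5 1 ''fffggfefee'' ''pAffBffpBfeAffAffCggAffEfgBggGfgEfgpAffCfgHffAffHfepAffAfgBffpYffTffVffZffSfgTffTff''"
  "check 5 1 ''ffgggeefee'' ''pAffDffAffDfeAfeEffAffAffFfgFffFffDffEfgCffpDfepFfeAefAefpAffAfgAfepSffSffSffSffWffTffSff''"
  "check 5 0 ''fffhfeggge'' ''pAffAffAefAefFffCgfppAefFffFffFffYgf''"
  "check 5 0 ''fffgfeggge'' ''pAffBffAefFffAffppAefFffHffFffTfgXfgTfgXfg''"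
  "check 5 2 ''fgfegfefee'' ''AffAffAfgpBfepEffFggEffEffEfgBggGfgEfgpAffCfgAffEffFfepAffAfgAffpTffVffVffSfgTffUfgTff''"
  "check 5 0 ''fffghfggee'' ''pAffHfgppDggGgfEffHfgpAfeEffAffGffZfgZfg''"
  "check 5 0 ''fffhgeefee'' ''pAffEffAffAffFffAgfAffAffpFfepAffpYffTff''"
  "check 5 0 ''fffhfegfgg'' ''pAffAefAefCffppCgfCffCffEffUffUffVfgUff''"
  "check 5 0 ''fgfehfefee'' ''AffppBfgGffEffEffBffAfepAfgAffpVgfVgf''"
  "check 5 0 ''fgfehgefee'' ''AffpAfepEffGffEffEffpAfgVfg''"
  "check 5 0 ''fegfefehee'' ''AffAffpEffEfgFffEfgpAffBffFfepAffVef''"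
  "check 5 0 ''fffggeefee'' ''pBffEffAffFffAffAffpBffpYffTffTff''"
  "check 5 0 ''ffhggeefee'' ''pAffHfgHegEffHffAffpFggpAffpSffSff''"
  "check 5 0 ''fhgfggegee'' ''AffpAffHggCgfDfgpDfgCffDegAefpBfgpTgf''"
  "check 5 0 ''fhfgfehgef'' ''AffpAfeppFfgBfgGgfEffAffAfeHggEffpGgfBfgXef''"
  "check 5 0 ''fhfggfggee'' ''AffppAffCgfAffDfgpDfgpAefAffYfgYfgYfg''"
  "check 5 0 ''fffgggefee'' ''pAffHffpAffAffHffBggHffAffpBffVffSffUffUff''"
  "check 5 0 ''fffghfefee'' ''pBffpAffEffBfgAffBffAffAfeAffpBffpVgfZfgZfg''"
  "check 5 0 ''fffhgfegee'' ''ppAffAffEffAffCgfEfgGggBggAffCffAefAffppTgf''"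
  by (simp_all only: code top_code nodes6)

lemmas nodes5 =
  level5[THEN node_fact, unfolded node_code]

text \<open>Up to similarity a triangle extends to one of these four sets; the one with excess 2 is
  the square.\<close>

lemma level4:
  "check 4 1 ''fffgfegf'' ''pppBefAefGfgEfgpAffBffBffAffAffGffEffZffVffTffXff''"
  "check 4 0 ''fffeggge'' ''pAffAfgAffpAefFggFffCgfCggppAefAefEfeFffFffFffFffXfgTegTegXfgSef''"
  "check 4 2 ''fffggfgg'' ''pAfepBffEfeGgepCgepDgfFffHgfSfeTfgUfeVfgSfe''"
  "check 4 0 ''fffegfgg'' ''pAffBffpAefCggAefAefDffpDgfpCgfAefDffBfgDffDffTfgUgfVggTegUffSff''"
  by (simp_all only: code top_code nodes5)

lemmas nodes4 =
  level4[THEN node_fact, unfolded node_code]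

lemma level3:
  "check 3 0 ''fffggf'' ''ppAffEfepAfeAffBffEffFffYgfXffWff''"
  by (simp_all only: code top_code nodes4)

lemma node_start: "node (un 3) (un 0) (points ''fffggf'')"
  by (rule level3[THEN node_fact])

subsection \<open>The main theorem\<close>

lemma good_triangle: "good 3 {(0, 0), (1, 0), (0, 1)}"
proof -
  let ?ps = "[(0, 0), (0, 1), (1, 0)] :: (int \<times> int) list"
  have "points ''fffggf'' = map encp ?ps" by (simp add: letter_code encp_def enc7)
  then have n: "node 3 0 (map encp ?ps)" using node_start by (simp add: un_def)
  have img: "ri ` set ?ps = {(0, 0), (1, 0), (0, 1)}" by (simp add: ri_def insert_commute)
  have "apex (0, 0) (1, 0) (0, 1)" by (simp add: apex_def rot_def)
  then have "S_rt {(0, 0), (1, 0), (0, 1)} = 1" by (intro S_rt_irt) (auto simp: irt_iff)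
  then show ?thesis using good_of_node[OF n] unfolding img by (simp add: bnd_def th_def)
qed

section \<open>Lower bounds: triangles of the extremal sets counted by ordered pairs\<close>

definition triangle_pairs :: "(int \<times> int) list \<Rightarrow> nat" where
  "triangle_pairs ps = length (filter (\<lambda>(a, b). a \<noteq> b \<and> a + irot (b - a) \<in> set ps) (List.product ps ps))"

text \<open>The right angle singles out one vertex and the orientation orders the other two. Each of
  the five other matchings of the vertices gives linear equations that force
  \<open>a = b\<close>.\<close>

lemma apex_unique:
  assumes "apex a b c" "apex a' b' c'" "{a, b, c} = {a', b', c'}"
  shows "a = a' \<and> b = b'"
proof -
  have mem: "a' \<in> {a, b, c}" "b' \<in> {a, b, c}" "c' \<in> {a, b, c}" using assms(3) by auto
  have d: "a' \<noteq> b'" "a' \<noteq> c'" "b' \<noteq> c'" "a \<noteq> b" using apex_distinct assms by blast+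
  have eqs: "fst c = fst a - (snd b - snd a)" "snd c = snd a + (fst b - fst a)"
    "fst c' = fst a' - (snd b' - snd a')" "snd c' = snd a' + (fst b' - fst a')"
    using assms(1,2) by (simp_all add: apex_def rot_def)
  consider "a' = a" "b' = b" | "a' = a" "b' = c" "c' = b" | "a' = b" "b' = a" "c' = c"
    | "a' = b" "b' = c" "c' = a" | "a' = c" "b' = a" "c' = b" | "a' = c" "b' = b" "c' = a"
    using mem d by blast
  then show ?thesis
  proof cases
    case 1 then show ?thesis by simp
  next
    case 2
    have "fst a = fst b" "snd a = snd b" using eqs unfolding 2 by linarith+
    then show ?thesis using d(4) by (simp add: prod_eq_iff)
  next
    case 3
    have "fst a = fst b" "snd a = snd b" using eqs unfolding 3 by linarith+
    then show ?thesis using d(4) by (simp add: prod_eq_iff)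
  next
    case 4
    have "fst a = fst b" "snd a = snd b" using eqs unfolding 4 by linarith+
    then show ?thesis using d(4) by (simp add: prod_eq_iff)
  next
    case 5
    have "fst a = fst b" "snd a = snd b" using eqs unfolding 5 by linarith+
    then show ?thesis using d(4) by (simp add: prod_eq_iff)
  next
    case 6
    have "fst a = fst b" "snd a = snd b" using eqs unfolding 6 by linarith+
    then show ?thesis using d(4) by (simp add: prod_eq_iff)
  qed
qed

lemma ri_apex: "ri a \<noteq> ri b \<Longrightarrow> apex (ri a) (ri b) (ri (a + irot (b - a)))"
  by (simp add: apex_def ri_def rot_def irot_def)

text \<open>By \<open>apex_unique\<close> the counted pairs inject into the triangles. An inequality
  is enough, because the search supplies the opposite one.\<close>

lemma triangle_pairs_le:
  assumes "distinct ps"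
  shows "triangle_pairs ps \<le> S_rt (ri ` set ps)"
proof -
  let ?Q = "\<lambda>(a, b). a \<noteq> b \<and> a + irot (b - a) \<in> set ps"
  let ?T = "\<lambda>(a, b). {ri a, ri b, ri (a + irot (b - a))}"
  have "distinct (List.product ps ps)" using assms by (simp add: distinct_product)
  then have "triangle_pairs ps = card {p \<in> set ps \<times> set ps. ?Q p}"
    unfolding triangle_pairs_def
    by (subst distinct_card[symmetric]) (simp_all only: distinct_filter set_filter set_product)
  also have "\<dots> = card (?T ` {p \<in> set ps \<times> set ps. ?Q p})"
  proof (rule card_image[symmetric], rule inj_onI)
    fix p q assume "p \<in> {p \<in> set ps \<times> set ps. ?Q p}" "q \<in> {p \<in> set ps \<times> set ps. ?Q p}" "?T p = ?T q"
    moreover obtain a b c d where "p = (a, b)" "q = (c, d)" by (metis surj_pair)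
    ultimately show "p = q"
      using apex_unique[OF ri_apex[of a b] ri_apex[of c d]] by (simp add: ri_inj)
  qed
  also have "\<dots> \<le> S_rt (ri ` set ps)"
    unfolding S_rt_def
  proof (rule card_mono)
    show "finite {T. T \<subseteq> ri ` set ps \<and> irt T}" by (rule finite_triangles) simp
    show "?T ` {p \<in> set ps \<times> set ps. ?Q p} \<subseteq> {T. T \<subseteq> ri ` set ps \<and> irt T}"
    proof
      fix T assume "T \<in> ?T ` {p \<in> set ps \<times> set ps. ?Q p}"
      then obtain a b where ab: "a \<in> set ps" "b \<in> set ps" "a \<noteq> b" "a + irot (b - a) \<in> set ps"
        and T: "T = {ri a, ri b, ri (a + irot (b - a))}" by blast
      have "apex (ri a) (ri b) (ri (a + irot (b - a)))" using ab(3) by (intro ri_apex) (simp add: ri_inj)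
      then have "irt T" unfolding irt_iff T by blast
      then show "T \<in> {T. T \<subseteq> ri ` set ps \<and> irt T}" using ab T by blast
    qed
  qed
  finally show ?thesis .
qed

lemma extremal_lower:
  assumes "E = ri ` set ps" "distinct ps" "length ps = k" "ub k \<le> triangle_pairs ps"
  shows "n_point_set k E" "ub k \<le> S_rt E"
  using assms triangle_pairs_le[of ps]
  by (auto simp: n_point_set_def card_image inj_on_def ri_inj distinct_card)

lemma S_rt_max_eq:
  assumes "k \<in> {10..14}" "n_point_set k E" "ub k \<le> S_rt E"
  shows "S_rt_max k = ub k"
  unfolding S_rt_max_def
proof (rule Max_eqI)
  show "finite {S_rt P |P. n_point_set k P}" by (rule finite_S_rt_values)
  have le: "S_rt P \<le> ub k" if "n_point_set k P" for P using S_rt_le_ub[OF good_triangle assms(1) that] .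
  then show "y \<le> ub k" if "y \<in> {S_rt P |P. n_point_set k P}" for y using that by auto
  show "ub k \<in> {S_rt P |P. n_point_set k P}" using assms(2,3) le[OF assms(2)] by (auto intro!: exI[of _ E])
qed

lemma optimalI:
  assumes "k \<in> {10..14}" "n_point_set k E" "ub k \<le> S_rt E"
  shows "optimal k E"
  using S_rt_max_eq[OF assms] S_rt_le_ub[OF good_triangle assms(1,2)] assms by (simp add: optimal_def)

lemma dist_int_ge_1:
  assumes "x \<in> \<int> \<times> \<int>" "y \<in> \<int> \<times> \<int>" "x \<noteq> (y :: point)"
  shows "1 \<le> dist x y"
proof -
  obtain a b c d where xy: "x = (of_int a, of_int b)" "y = (of_int c, of_int d)"
    using assms(1,2) by (auto elim!: Ints_cases)
  have "a \<noteq> c \<or> b \<noteq> d" using assms(3) xy by auto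
  then have "1 \<le> (a - c)\<^sup>2 + (b - d)\<^sup>2"
    by (smt (verit) power2_eq_square sum_power2_gt_zero_iff zero_le_power2 right_minus_eq)
  then have "1 \<le> (of_int ((a - c)\<^sup>2 + (b - d)\<^sup>2) :: real)" by linarith
  then have "1 \<le> sqrt ((of_int a - of_int c)\<^sup>2 + (of_int b - of_int d)\<^sup>2)" by simp
  then show ?thesis unfolding xy dist_Pair_Pair dist_real_def by simp
qed

lemma lower_E10: "n_point_set 10 E10 \<and> ub 10 \<le> S_rt E10"
proof -
  let ?ps = "[(0, 0), (0, 1), (0, 2), (1, 0), (1, 1), (1, 2), (2, 0), (2, 1), (2, 2), (3, 1)] :: (int \<times> int) list"
  have "E10 = ri ` set ?ps" by (force simp: E10_def ri_def)
  moreover have "ub 10 \<le> triangle_pairs ?ps" unfolding ub_values by code_simp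
  moreover have "distinct ?ps" "length ?ps = 10" by simp_all
  ultimately show ?thesis using extremal_lower by blast
qed

lemma lower_E11: "n_point_set 11 E11 \<and> ub 11 \<le> S_rt E11"
proof -
  let ?ps = "[(0, 0), (0, 1), (0, 2), (1, 0), (1, 1), (1, 2), (2, 0), (2, 1), (2, 2), (3, 1), (1, -1)] :: (int \<times> int) list"
  have "E11 = ri ` set ?ps" by (force simp: E11_def ri_def)
  moreover have "ub 11 \<le> triangle_pairs ?ps" unfolding ub_values by code_simp
  moreover have "distinct ?ps" "length ?ps = 11" by simp_all
  ultimately show ?thesis using extremal_lower by blast
qed

lemma lower_E12a: "n_point_set 12 E12a \<and> ub 12 \<le> S_rt E12a"
proof -
  let ?ps = "[(0, 0), (0, 1), (0, 2), (1, 0), (1, 1), (1, 2), (2, 0), (2, 1), (2, 2), (-1, 1), (3, 1), (1, -1)] :: (int \<times> int) list"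
  have "E12a = ri ` set ?ps" by (force simp: E12a_def ri_def)
  moreover have "ub 12 \<le> triangle_pairs ?ps" unfolding ub_values by code_simp
  moreover have "distinct ?ps" "length ?ps = 12" by simp_all
  ultimately show ?thesis using extremal_lower by blast
qed

lemma lower_E12b: "n_point_set 12 E12b \<and> ub 12 \<le> S_rt E12b"
proof -
  let ?ps = "[(0, 1), (0, 2), (1, 0), (1, 1), (1, 2), (1, 3), (2, 0), (2, 1), (2, 2), (2, 3), (3, 1), (3, 2)] :: (int \<times> int) list"
  have "E12b = ri ` set ?ps" by (force simp: E12b_explicit ri_def)
  moreover have "ub 12 \<le> triangle_pairs ?ps" unfolding ub_values by code_simp
  moreover have "distinct ?ps" "length ?ps = 12" by simp_all
  ultimately show ?thesis using extremal_lower by blast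
qed

lemma lower_E13a: "n_point_set 13 E13a \<and> ub 13 \<le> S_rt E13a"
proof -
  let ?ps = "[(0, 0), (0, 2), (0, -2), (0, 1), (0, -1), (2, 0), (-2, 0), (1, 0), (1, 1), (1, -1), (-1, 0), (-1, 1), (-1, -1)] :: (int \<times> int) list"
  have "E13a = ri ` set ?ps" by (force simp: E13a_explicit ri_def)
  moreover have "ub 13 \<le> triangle_pairs ?ps" unfolding ub_values by code_simp
  moreover have "distinct ?ps" "length ?ps = 13" by simp_all
  ultimately show ?thesis using extremal_lower by blast
qed

lemma lower_E13b: "n_point_set 13 E13b \<and> ub 13 \<le> S_rt E13b"
proof -
  let ?ps = "[(1, 2), (1, -2), (-1, 2), (-1, -2), (2, 1), (2, -1), (-2, 1), (-2, -1), (0, 1), (0, -1), (-1, 0), (0, 0), (1, 0)] :: (int \<times> int) list"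
  have "E13b = ri ` set ?ps" by (force simp: E13b_def ri_def)
  moreover have "ub 13 \<le> triangle_pairs ?ps" unfolding ub_values by code_simp
  moreover have "distinct ?ps" "length ?ps = 13" by simp_all
  ultimately show ?thesis using extremal_lower by blast
qed

lemma lower_E14: "n_point_set 14 E14 \<and> ub 14 \<le> S_rt E14"
proof -
  let ?ps = "[(1, 2), (1, -2), (-1, 2), (-1, -2), (2, 1), (2, -1), (-2, 1), (-2, -1), (0, 1), (0, -1), (-1, 0), (0, 0), (1, 0), (3, 0)] :: (int \<times> int) list"
  have "E14 = ri ` set ?ps" by (force simp: E14_def E13b_def ri_def)
  moreover have "ub 14 \<le> triangle_pairs ?ps" unfolding ub_values by code_simp
  moreover have "distinct ?ps" "length ?ps = 14" by simp_all
  ultimately show ?thesis using extremal_lower by blast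
qed

section \<open>The extremal sets of equal size are not similar\<close>

lemma Ints_E12b: "E12b \<subseteq> \<int> \<times> \<int>"
  by (simp add: E12b_explicit)

lemma Ints_E13a: "E13a \<subseteq> \<int> \<times> \<int>"
  by (simp add: E13a_explicit)

text \<open>\<open>E12a\<close> has pairs at distances 1 and 4. The images of the first pair are
  distinct integral points, so the scaling factor is at least 1; but all distances in
  \<open>E12b\<close> are below 4.\<close>

lemma not_similar_E12: "\<not> similar E12a E12b"
proof
  assume "similar E12a E12b"
  then obtain f c where c: "c > 0" "\<And>x y. dist (f x) (f y) = c * dist x y" "f ` E12a = E12b"
    unfolding similar_def similarity_def by blast
  have B: "f (0, 0) \<in> E12b" "f (0, 1) \<in> E12b" "f (-1, 1) \<in> E12b" "f (3, 1) \<in> E12b"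
    unfolding c(3)[symmetric] by (intro imageI; simp add: E12a_def)+
  have d: "dist (f (0, 0)) (f (0, 1)) = c" "dist (f (-1, 1)) (f (3, 1)) = c * 4"
    unfolding c(2) by (simp_all add: dist_Pair_Pair dist_real_def)
  then have "f (0, 0) \<noteq> f (0, 1)" using c(1) by auto
  then have "1 \<le> c" unfolding d(1)[symmetric] using B Ints_E12b by (intro dist_int_ge_1) blast+
  have "(dist (f (-1, 1)) (f (3, 1)))\<^sup>2 < 4\<^sup>2"
    using B(3,4) unfolding E12b_explicit
    by (elim insertE emptyE) (simp_all add: dist_Pair_Pair dist_real_def)
  then have "dist (f (-1, 1)) (f (3, 1)) < 4" by (rule power2_less_imp_less) simp
  then show False using d(2) \<open>1 \<le> c\<close> by simp
qed

text \<open>The argument runs backwards: \<open>E13b\<close> has pairs at distances 1 and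
  \<open>sqrt 20\<close>. The preimages of the first pair are at distance at least 1, so the factor
  is at most 1; but distances in \<open>E13a\<close> are at most 4, which is less than
  \<open>sqrt 20\<close>.\<close>

lemma not_similar_E13: "\<not> similar E13a E13b"
proof
  assume "similar E13a E13b"
  then obtain f c where c: "c > 0" "\<And>x y. dist (f x) (f y) = c * dist x y" "f ` E13a = E13b"
    unfolding similar_def similarity_def by blast
  have "(0, 0) \<in> f ` E13a" "(0, 1) \<in> f ` E13a" "(1, 2) \<in> f ` E13a" "(-1, -2) \<in> f ` E13a"
    unfolding c(3) by (simp_all add: E13b_def)
  then obtain p q r s where pq: "p \<in> E13a" "q \<in> E13a" "f p = (0, 0)" "f q = (0, 1)"
    and rs: "r \<in> E13a" "s \<in> E13a" "f r = (1, 2)" "f s = (-1, -2)"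
    by (elim imageE) (rule that, (assumption | rule sym, assumption)+)
  have "p \<noteq> q" using pq by auto
  then have "1 \<le> dist p q" using pq(1,2) Ints_E13a by (intro dist_int_ge_1) blast+
  moreover have "c * dist p q = 1" using c(2)[of p q] pq by (simp add: dist_Pair_Pair dist_real_def)
  ultimately have "c \<le> 1" using mult_left_mono[of 1 "dist p q" c] c(1) by simp
  have "(dist r s)\<^sup>2 \<le> 16"
    using rs(1,2) unfolding E13a_explicit by (elim insertE emptyE) (simp_all add: dist_Pair_Pair dist_real_def)
  moreover have "(c * dist r s)\<^sup>2 = 20" unfolding c(2)[symmetric] rs(3,4) by (simp add: dist_Pair_Pair dist_real_def)
  moreover have "(c * dist r s)\<^sup>2 \<le> (1 * dist r s)\<^sup>2"
    using \<open>c \<le> 1\<close> c(1) by (intro power_mono mult_right_mono) auto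
  ultimately show False by simp
qed

lemma optimal_similar: "k \<in> {10..14} \<Longrightarrow> n_point_set k E \<Longrightarrow> ub k \<le> S_rt E \<Longrightarrow> optimal k P \<Longrightarrow>
    \<exists>E\<in>extremal k. similar P E"
  using max_similar[OF good_triangle, of k P] S_rt_max_eq[of k E] by (simp add: optimal_def)

theorem theorem14:
  shows "(S_rt_max 10 = 35 \<and> S_rt_max 11 = 43 \<and> S_rt_max 12 = 52 \<and>
          S_rt_max 13 = 64 \<and> S_rt_max 14 = 74)
    \<and> (\<forall>P. optimal 10 P \<longrightarrow> similar P E10)
    \<and> (\<forall>P. optimal 11 P \<longrightarrow> similar P E11)
    \<and> (\<forall>P. optimal 12 P \<longrightarrow> similar P E12a \<or> similar P E12b)
    \<and> (\<forall>P. optimal 13 P \<longrightarrow> similar P E13a \<or> similar P E13b)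
    \<and> (\<forall>P. optimal 14 P \<longrightarrow> similar P E14)
    \<and> optimal 10 E10 \<and> optimal 11 E11
    \<and> optimal 12 E12a \<and> optimal 12 E12b
    \<and> optimal 13 E13a \<and> optimal 13 E13b
    \<and> optimal 14 E14
    \<and> \<not> similar E12a E12b \<and> \<not> similar E13a E13b"
proof (intro conjI allI impI)
  show "S_rt_max 10 = 35" "S_rt_max 11 = 43" "S_rt_max 12 = 52" "S_rt_max 13 = 64" "S_rt_max 14 = 74"
    using S_rt_max_eq[of 10 E10] S_rt_max_eq[of 11 E11] S_rt_max_eq[of 12 E12a] S_rt_max_eq[of 13 E13a]
      S_rt_max_eq[of 14 E14] lower_E10 lower_E11 lower_E12a lower_E13a lower_E14
    by (simp_all add: ub_values)
  show "optimal 10 E10" "optimal 11 E11" "optimal 12 E12a" "optimal 12 E12b" "optimal 13 E13a"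
    "optimal 13 E13b" "optimal 14 E14"
    using lower_E10 lower_E11 lower_E12a lower_E12b lower_E13a lower_E13b lower_E14
    by (auto intro!: optimalI)
next
  fix P assume "optimal 10 P"
  then have "\<exists>E\<in>extremal 10. similar P E" using lower_E10 by (intro optimal_similar[of 10 E10]) simp_all
  then show "similar P E10" by (simp add: extremal_def)
next
  fix P assume "optimal 11 P"
  then have "\<exists>E\<in>extremal 11. similar P E" using lower_E11 by (intro optimal_similar[of 11 E11]) simp_all
  then show "similar P E11" by (simp add: extremal_def)
next
  fix P assume "optimal 12 P"
  then have "\<exists>E\<in>extremal 12. similar P E" using lower_E12a by (intro optimal_similar[of 12 E12a]) simp_all
  then show "similar P E12a \<or> similar P E12b" by (simp add: extremal_def)
next
  fix P assume "optimal 13 P"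
  then have "\<exists>E\<in>extremal 13. similar P E" using lower_E13a by (intro optimal_similar[of 13 E13a]) simp_all
  then show "similar P E13a \<or> similar P E13b" by (simp add: extremal_def)
next
  fix P assume "optimal 14 P"
  then have "\<exists>E\<in>extremal 14. similar P E" using lower_E14 by (intro optimal_similar[of 14 E14]) simp_all
  then show "similar P E14" by (simp add: extremal_def)
qed (fact not_similar_E12 not_similar_E13)+

end
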